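(* Let $H\in\mathcal{H}_2$ and let $\hat H_k,\hat H_{k+1}\in\mathcal{M}$ be two consecutive iterates of IRKA for $H$. Let $f:\mathcal{M}\to\mathbb{R}$, $f(\hat H)=\|H-\hat H\|_{\mathcal{H}_2}^2$, and let $\mathrm{R}:\mathrm{T}\mathcal{M}\to\mathcal{M}$ be the orthographic retraction. Suppose that $\hat H_{k+1}$ is the unique element of $\mathcal{M}$ satisfying $$H-\hat H_{k+1}\perp\mathrm{T}_{\hat H_k}\mathcal{M},$$ and that $\mathrm{R}_{\hat H_k}(-\operatorname{grad}f(\hat H_k))$ exists. Then $$\hat H_{k+1}=\mathrm{R}_{\hat H_k}\bigl(-\operatorname{grad}f(\hat H_k)\bigr).$$
   Context: $\mathcal{H}_2=\mathcal{H}_2^{p\times m}(\mathbb{C}^+)$ is the Hardy space of analytic functions $F:\mathbb{C}^+\to\mathbb{C}^{p\times m}$ on the open right half-plane with $\sup_{\xi>0}\int_{-\infty}^{\infty}\|F(\xi+\mathrm{i}\omega)\|_{\mathrm{F}}^2\,d\omega<\infty$ and inner product $\langle F,G\rangle_{\mathcal{H}_2}=\frac{1}{2\pi}\int_{-\infty}^{\infty}\operatorname{tr}(F(\mathrm{i}\omega)^*G(\mathrm{i}\omega))\,d\omega$; $\perp$ is orthogonality in this inner product. $\mathcal{M}$ is the set of $\hat C(sI-\hat A)^{-1}\hat B$ with $\hat A\in\mathbb{C}^{r\times r}$ Hurwitz (all eigenvalues in the open left half-plane), $\hat B\in\mathbb{C}^{r\times m}$, $\hat C\in\mathbb{C}^{p\times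 r}$, and $(\hat A,\hat B,\hat C)$ minimal (least possible order). $\mathcal{M}$ is an embedded submanifold of $\mathcal{H}_2$ of complex dimension $r(m+p)$, and its tangent spaces $\mathrm{T}_{\hat H}\mathcal{M}$ are viewed as (finite-dimensional) subspaces of $\mathcal{H}_2$; $\mathcal{M}$ inherits the inner product of $\mathcal{H}_2$ as Riemannian metric. Gradient convention: using the Wirtinger gradient $\nabla_{\overline G}\|H-G\|_{\mathcal{H}_2}^2=G-H$, the Riemannian gradient is $\operatorname{grad}f(\hat H)=\operatorname{Proj}_{\hat H}(\hat H-H)$, where $\operatorname{Proj}_{\hat H}:\mathcal{H}_2\to\mathrm{T}_{\hat H}\mathcal{M}$ is the orthogonal projector. Orthographic retraction: $\mathrm{R}$ assigns to $\hat H\in\mathcal{M}$ and $G$ in an open subset of $\mathrm{T}_{\hat H}\mathcal{M}$ containing $0$ an element $\mathrm{R}_{\hat H}(G)\in\mathcal{M}$ with $\hat H+G-\mathrm{R}_{\hat H}(G)\perp\mathrm{T}_{\hat H}\mathcal{M}$ (it may be only locally defined). IRKA (iterative rational Krylov algorithm): from an iterate $\hat H_k(s)=\sum_{i=1}^r\frac{c_ib_i^*}{s-\lambda_i}$ with pairwise distinct poles, the next iterate $\hat H_{k+1}$ is determined by the conditions $H(-\overline{\lambda_i})b_i=\hat H_{k+1}(-\overline{\lambda_i})b_i$, $c_i^*H(-\overline{\lambda_i})=c_i^*\hat H_{k+1}(-\overline{\lambda_i})$, $c_i^*H'(-\overline{\lambda_i})b_i=c_i^*\hat H_{k+1}'(-\overline{\lambda_i})b_i$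 for $i=1,\dots,r$. *)

theory Defs
  imports
    "HOL-Complex_Analysis.Complex_Analysis"
    "HOL-Library.Function_Algebras"
    "Jordan_Normal_Form.Schur_Decomposition"
    "Jordan_Normal_Form.Gauss_Jordan_Elimination"
begin

no_notation Finite_Cartesian_Product.vec_nth (infixl "$" 90)

text \<open>
  Matrices are the dimension-indexed matrices of Jordan_Normal_Form, because minimality of a
  realization quantifies over state dimensions. Matrix functions are added and subtracted
  pointwise (Function_Algebras).
\<close>

definition frob_norm :: "complex mat \<Rightarrow> real" where
  "frob_norm A = sqrt (\<Sum>i<dim_row A. \<Sum>j<dim_col A. (cmod (A $$ (i, j)))\<^sup>2)"

definition mat_trace :: "complex mat \<Rightarrow> complex" where
  "mat_trace A = (\<Sum>i<dim_row A. A $$ (i, i))"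

definition mat_deriv :: "(complex \<Rightarrow> complex mat) \<Rightarrow> complex \<Rightarrow> complex mat" where
  "mat_deriv F s = mat (dim_row (F s)) (dim_col (F s)) (\<lambda>ij. deriv (\<lambda>z. F z $$ ij) s)"

definition scale_fun :: "complex \<Rightarrow> (complex \<Rightarrow> complex mat) \<Rightarrow> complex \<Rightarrow> complex mat" where
  "scale_fun a F = (\<lambda>s. a \<cdot>\<^sub>m F s)"

definition zero_fun :: "nat \<Rightarrow> nat \<Rightarrow> complex \<Rightarrow> complex mat" where
  "zero_fun p m = (\<lambda>s. 0\<^sub>m p m)"


section \<open>The Hardy space\<close>

text \<open>
  A function on the open right half-plane is represented by its extension by zero, so that HOL
  equality is equality of functions on the half-plane.
\<close>

definition hardy2 :: "nat \<Rightarrow> nat \<Rightarrow> (complex \<Rightarrow> complex mat) set" where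
  "hardy2 p m = {F.
     (\<forall>s. F s \<in> carrier_mat p m) \<and>
     (\<forall>s. Re s \<le> 0 \<longrightarrow> F s = 0\<^sub>m p m) \<and>
     (\<forall>i<p. \<forall>j<m. (\<lambda>s. F s $$ (i, j)) holomorphic_on {s. Re s > 0}) \<and>
     (SUP \<xi>\<in>{0<..}. \<integral>\<^sup>+ \<omega>. ennreal ((frob_norm (F (Complex \<xi> \<omega>)))\<^sup>2) \<partial>lborel) < \<infinity>}"

text \<open>
  The boundary function \<open>\<omega> \<mapsto> F(i\<omega>)\<close> of an element of the Hardy space is the limit of
  \<open>F(\<xi> + i \<cdot>)\<close> in \<open>L\<^sup>2\<close> as \<open>\<xi>\<close> decreases to 0. It is determined up to null sets, so any choice gives
  the same inner product.
\<close>

definition is_boundary_fun ::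
    "nat \<Rightarrow> nat \<Rightarrow> (complex \<Rightarrow> complex mat) \<Rightarrow> (real \<Rightarrow> complex mat) \<Rightarrow> bool" where
  "is_boundary_fun p m F g \<longleftrightarrow>
     (\<forall>\<omega>. g \<omega> \<in> carrier_mat p m) \<and>
     (\<forall>i<p. \<forall>j<m. (\<lambda>\<omega>. g \<omega> $$ (i, j)) \<in> borel_measurable lborel) \<and>
     ((\<lambda>\<xi>. \<integral>\<^sup>+ \<omega>. ennreal ((frob_norm (F (Complex \<xi> \<omega>) - g \<omega>))\<^sup>2) \<partial>lborel) \<longlongrightarrow> 0) (at_right 0)"

definition boundary_fun :: "nat \<Rightarrow> nat \<Rightarrow> (complex \<Rightarrow> complex mat) \<Rightarrow> real \<Rightarrow> complex mat" where
  "boundary_fun p m F = (SOME g. is_boundary_fun p m F g)"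

definition h2_inner ::
    "nat \<Rightarrow> nat \<Rightarrow> (complex \<Rightarrow> complex mat) \<Rightarrow> (complex \<Rightarrow> complex mat) \<Rightarrow> complex" where
  "h2_inner p m F G = complex_of_real (1 / (2 * pi)) *
     (\<integral>\<omega>. mat_trace (mat_adjoint (boundary_fun p m F \<omega>) * boundary_fun p m G \<omega>) \<partial>lborel)"

definition h2_norm :: "nat \<Rightarrow> nat \<Rightarrow> (complex \<Rightarrow> complex mat) \<Rightarrow> real" where
  "h2_norm p m F = sqrt (Re (h2_inner p m F F))"

definition h2_orth ::
    "nat \<Rightarrow> nat \<Rightarrow> (complex \<Rightarrow> complex mat) \<Rightarrow> (complex \<Rightarrow> complex mat) set \<Rightarrow> bool" where
  "h2_orth p m F S \<longleftrightarrow> (\<forall>V\<in>S. h2_inner p m F V = 0)"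

definition h2_closed_subspace :: "nat \<Rightarrow> nat \<Rightarrow> (complex \<Rightarrow> complex mat) set \<Rightarrow> bool" where
  "h2_closed_subspace p m W \<longleftrightarrow>
     W \<subseteq> hardy2 p m \<and> zero_fun p m \<in> W \<and>
     (\<forall>F\<in>W. \<forall>G\<in>W. F + G \<in> W) \<and> (\<forall>a. \<forall>F\<in>W. scale_fun a F \<in> W) \<and>
     (\<forall>F\<in>hardy2 p m. (\<forall>\<epsilon>>0. \<exists>G\<in>W. h2_norm p m (F - G) < \<epsilon>) \<longrightarrow> F \<in> W)"

definition h2_closed_span ::
    "nat \<Rightarrow> nat \<Rightarrow> (complex \<Rightarrow> complex mat) set \<Rightarrow> (complex \<Rightarrow> complex mat) set" where
  "h2_closed_span p m S = \<Inter> {W. h2_closed_subspace p m W \<and> S \<subseteq> W}"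

text \<open>
  Orthogonal projector onto the closed span of a set \<open>S\<close>. If \<open>S\<close> is a finite-dimensional subspace,
  as the tangent spaces below are, its closed span is \<open>S\<close> itself.
\<close>

definition h2_proj ::
    "nat \<Rightarrow> nat \<Rightarrow> (complex \<Rightarrow> complex mat) set \<Rightarrow> (complex \<Rightarrow> complex mat) \<Rightarrow> (complex \<Rightarrow> complex mat)" where
  "h2_proj p m S X = (THE P. P \<in> h2_closed_span p m S \<and> h2_orth p m (X - P) S)"


section \<open>The manifold of stable systems of order r\<close>

definition transfer :: "complex mat \<Rightarrow> complex mat \<Rightarrow> complex mat \<Rightarrow> complex \<Rightarrow> complex mat" where
  "transfer A B C s = C * the (mat_inverse (s \<cdot>\<^sub>m 1\<^sub>m (dim_row A) - A)) * B"

definition hurwitz :: "complex mat \<Rightarrow> bool" where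
  "hurwitz A \<longleftrightarrow> (\<forall>z. eigenvalue A z \<longrightarrow> Re z < 0)"

text \<open>
  A realization need not be stable here; the equation is required wherever the resolvent exists in
  the right half-plane, which determines a rational function.
\<close>

definition realizes ::
    "nat \<Rightarrow> nat \<Rightarrow> nat \<Rightarrow> complex mat \<Rightarrow> complex mat \<Rightarrow> complex mat \<Rightarrow> (complex \<Rightarrow> complex mat) \<Rightarrow> bool" where
  "realizes p m n A B C F \<longleftrightarrow>
     A \<in> carrier_mat n n \<and> B \<in> carrier_mat n m \<and> C \<in> carrier_mat p n \<and>
     (\<forall>s. Re s > 0 \<and> \<not> eigenvalue A s \<longrightarrow> F s = transfer A B C s)"

definition sys_manifold :: "nat \<Rightarrow> nat \<Rightarrow> nat \<Rightarrow> (complex \<Rightarrow> complex mat) set" where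
  "sys_manifold p m r = {F.
     (\<forall>s. Re s \<le> 0 \<longrightarrow> F s = 0\<^sub>m p m) \<and>
     (\<exists>A B C. hurwitz A \<and> realizes p m r A B C F) \<and>
     (\<forall>n<r. \<not> (\<exists>A B C. realizes p m n A B C F))}"

definition h2_curve_deriv ::
    "nat \<Rightarrow> nat \<Rightarrow> (real \<Rightarrow> complex \<Rightarrow> complex mat) \<Rightarrow> (complex \<Rightarrow> complex mat) \<Rightarrow> real \<Rightarrow> bool" where
  "h2_curve_deriv p m \<gamma> V t \<longleftrightarrow>
     ((\<lambda>h. h2_norm p m (scale_fun (complex_of_real (1 / h)) (\<gamma> (t + h) - \<gamma> t) - V)) \<longlongrightarrow> 0) (at 0)"

text \<open>Tangent vectors are the velocities at time 0 of continuously differentiable curves in the manifold.\<close>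

definition tangent_space ::
    "nat \<Rightarrow> nat \<Rightarrow> nat \<Rightarrow> (complex \<Rightarrow> complex mat) \<Rightarrow> (complex \<Rightarrow> complex mat) set" where
  "tangent_space p m r F = {V.
     \<exists>\<gamma> \<gamma>' \<epsilon>. \<epsilon> > 0 \<and> \<gamma> 0 = F \<and> \<gamma>' 0 = V \<and>
       (\<forall>t. \<bar>t\<bar> < \<epsilon> \<longrightarrow> \<gamma> t \<in> sys_manifold p m r \<and> \<gamma>' t \<in> hardy2 p m \<and>
          h2_curve_deriv p m \<gamma> (\<gamma>' t) t \<and>
          ((\<lambda>u. h2_norm p m (\<gamma>' u - \<gamma>' t)) \<longlongrightarrow> 0) (at t))}"


section \<open>Gradients, retraction and IRKA\<close>

text \<open>
  Wirtinger gradient \<open>\<nabla>\<close> with respect to the conjugate variable of a real-valued function: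
  \<open>f (G + X) = f G + 2 Re \<langle>\<nabla>, X\<rangle> + o(norm X)\<close>. For \<open>f G = (norm (H - G))\<^sup>2\<close> this is \<open>G - H\<close>.
\<close>

definition wirtinger_grad ::
    "nat \<Rightarrow> nat \<Rightarrow> ((complex \<Rightarrow> complex mat) \<Rightarrow> real) \<Rightarrow> (complex \<Rightarrow> complex mat) \<Rightarrow> (complex \<Rightarrow> complex mat)" where
  "wirtinger_grad p m f G = (THE W. W \<in> hardy2 p m \<and>
     (\<forall>\<epsilon>>0. \<exists>\<delta>>0. \<forall>X\<in>hardy2 p m. h2_norm p m X < \<delta> \<longrightarrow>
        \<bar>f (G + X) - f G - 2 * Re (h2_inner p m W X)\<bar> \<le> \<epsilon> * h2_norm p m X))"

text \<open>
  The Riemannian gradient on \<open>sys_manifold p m r\<close> of the restriction of \<open>f\<close>, which is given on the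
  ambient space.
\<close>

definition riem_grad ::
    "nat \<Rightarrow> nat \<Rightarrow> nat \<Rightarrow> ((complex \<Rightarrow> complex mat) \<Rightarrow> real) \<Rightarrow> (complex \<Rightarrow> complex mat) \<Rightarrow> (complex \<Rightarrow> complex mat)" where
  "riem_grad p m r f F = h2_proj p m (tangent_space p m r F) (wirtinger_grad p m f F)"

text \<open>
  \<open>D F\<close> is the (relatively open) part of the tangent space at \<open>F\<close> on which \<open>R F\<close> is defined.
\<close>

definition orthographic_retraction ::
    "nat \<Rightarrow> nat \<Rightarrow> nat \<Rightarrow>
     ((complex \<Rightarrow> complex mat) \<Rightarrow> (complex \<Rightarrow> complex mat) set) \<Rightarrow>
     ((complex \<Rightarrow> complex mat) \<Rightarrow> (complex \<Rightarrow> complex mat) \<Rightarrow> (complex \<Rightarrow> complex mat)) \<Rightarrow> bool" where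
  "orthographic_retraction p m r D R \<longleftrightarrow>
     (\<forall>F\<in>sys_manifold p m r.
        D F \<subseteq> tangent_space p m r F \<and> zero_fun p m \<in> D F \<and>
        (\<forall>G\<in>D F. \<exists>\<epsilon>>0. \<forall>G'\<in>tangent_space p m r F. h2_norm p m (G' - G) < \<epsilon> \<longrightarrow> G' \<in> D F) \<and>
        (\<forall>G\<in>D F. R F G \<in> sys_manifold p m r \<and>
           h2_orth p m (F + G - R F G) (tangent_space p m r F)))"

text \<open>
  One IRKA step. The poles \<open>\<mu> i\<close> have negative real part since the current iterate is stable, so all
  evaluation points \<open>- cnj (\<mu> i)\<close> lie in the right half-plane. The row vector equation
  \<open>c\<^sup>* X = c\<^sup>* Y\<close> is written in transposed form.
\<close>

definition irka_step ::
    "nat \<Rightarrow> nat \<Rightarrow> nat \<Rightarrow> (complex \<Rightarrow> complex mat) \<Rightarrow> (complex \<Rightarrow> complex mat) \<Rightarrow> (complex \<Rightarrow> complex mat) \<Rightarrow> bool" where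
  "irka_step p m r H F F' \<longleftrightarrow>
     (\<exists>(\<mu>::nat \<Rightarrow> complex) b c.
        inj_on \<mu> {..<r} \<and>
        (\<forall>i<r. Re (\<mu> i) < 0 \<and> b i \<in> carrier_vec m \<and> c i \<in> carrier_vec p) \<and>
        (\<forall>s. Re s > 0 \<longrightarrow>
           F s = mat p m (\<lambda>(k, l). \<Sum>i<r. c i $ k * cnj (b i $ l) / (s - \<mu> i))) \<and>
        (\<forall>i<r. let \<sigma> = - cnj (\<mu> i) in
           H \<sigma> *\<^sub>v b i = F' \<sigma> *\<^sub>v b i \<and>
           transpose_mat (H \<sigma>) *\<^sub>v conjugate (c i) = transpose_mat (F' \<sigma>) *\<^sub>v conjugate (c i) \<and>
           scalar_prod (conjugate (c i)) (mat_deriv H \<sigma> *\<^sub>v b i) =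
             scalar_prod (conjugate (c i)) (mat_deriv F' \<sigma> *\<^sub>v b i)))"

end

theory Submission
  imports Defs
begin

text \<open>
  By uniqueness of \<open>Hk1\<close> it suffices that \<open>G = R Hk (- P)\<close> satisfies \<open>H - G \<perp> T\<close>, where \<open>P\<close> is the
  projection of \<open>Hk - H\<close> onto the tangent space \<open>T\<close> at \<open>Hk\<close>. This holds because
  \<open>H - G = (Hk - P - G) - (Hk - H - P)\<close> and both terms are orthogonal to \<open>T\<close>.

  The substance is that inner product, projector and Wirtinger gradient, which are defined through
  choice operators, are what they should be on the Hardy space. For the boundary functions, put
  \<open>f\<^sub>\<xi> \<omega> = f (\<xi> + i\<omega>)\<close>. By Cauchy's theorem \<open>\<langle>f\<^sub>\<xi>, f\<^sub>\<eta>\<rangle>\<close> depends only on \<open>\<xi> + \<eta>\<close>, so \<open>N \<xi> = \<parallel>f\<^sub>\<xi>\<parallel>\<^sup>2\<close>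
  satisfies \<open>\<parallel>f\<^sub>\<xi> - f\<^sub>\<eta>\<parallel>\<^sup>2 = N \<xi> + N \<eta> - 2 N ((\<xi> + \<eta>) / 2)\<close>. Hence \<open>N\<close> is midpoint convex and bounded,
  therefore nonincreasing and convergent as \<open>\<xi> \<rightarrow> 0\<close>, and \<open>f\<^sub>\<xi>\<close> is a Cauchy family. Completeness of the
  Hardy space comes from point evaluation being bounded, by Cauchy's formula on a strip.
\<close>

section \<open>Shifting vertical contours\<close>

text \<open>The obstacle is that membership in \<open>hardy2\<close> gives integral bounds on
  vertical lines but no pointwise decay, so the horizontal edges of a rectangle cannot be estimated
  one at a time. The shift lemma carries a threshold \<open>T0\<close> and a value \<open>K\<close>
  so that it serves both Cauchy's theorem (\<open>K = 0\<close>) and Cauchy's formula, whose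
  integrand has a pole at height below \<open>T0\<close> in absolute value. Since boundary functions
  come from a choice operator, the laws of the inner product are proved on lines
  \<open>Re z = \<xi>\<close> with \<open>\<xi> > 0\<close>, where the functions themselves are
  integrated, and then passed to the limit. The projector is defined on the closed span of a set, so
  the projection theorem provides it for every subset of the Hardy space. For tangent spaces it
  remains to see that they lie in \<open>hardy2\<close>; for systems in the manifold this rests on
  the decay of the resolvent.\<close>

text \<open>With an extended nonnegative integral on the right, the bound can itself be integrated
  over the height \<open>T\<close> and the order of integration exchanged.\<close>

lemma horizontal_segment_bound:
  fixes h :: "complex \<Rightarrow> complex"
  assumes "continuous_on {0..1::real} (\<lambda>u. h (Complex (a + u * (b - a)) T))" "a < b"
  shows "ennreal (cmod (contour_integral (linepath (Complex a T) (Complex b T)) h)) \<le>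
    ennreal (b - a) * (\<integral>\<^sup>+u. indicator {0..1} u * ennreal (cmod (h (Complex (a + u * (b - a)) T))) \<partial>lborel)"
proof -
  let ?q = "\<lambda>u. h (Complex (a + u * (b - a)) T)"
  have lp: "linepath (Complex a T) (Complex b T) u = Complex (a + u * (b - a)) T" for u
    by (simp add: linepath_def complex_eq_iff algebra_simps)
  have "contour_integral (linepath (Complex a T) (Complex b T)) h =
      (Complex b T - Complex a T) * integral {0..1} ?q"
    by (simp add: contour_integral_integral lp)
  also have "Complex b T - Complex a T = of_real (b - a)"
    by (simp add: complex_eq_iff)
  finally have 1: "cmod (contour_integral (linepath (Complex a T) (Complex b T)) h) =
      (b - a) * cmod (integral {0..1} ?q)"
    using assms(2) by (simp only: norm_mult norm_of_real)
  have si: "set_integrable lborel {0..1} ?q"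
    unfolding set_integrable_def
    by (rule borel_integrable_compact) (use assms in auto)
  have "integral {0..1} ?q = set_lebesgue_integral lborel {0..1} ?q"
    using set_borel_integral_eq_integral(2)[OF si] by simp
  then have "ennreal (cmod (integral {0..1} ?q)) \<le>
      (\<integral>\<^sup>+u. ennreal (cmod (indicator {0..1} u *\<^sub>R ?q u)) \<partial>lborel)"
    using integral_norm_bound_ennreal[OF si[unfolded set_integrable_def]]
    by (simp add: set_lebesgue_integral_def)
  also have "\<dots> = (\<integral>\<^sup>+u. indicator {0..1} u * ennreal (cmod (?q u)) \<partial>lborel)"
    by (intro nn_integral_cong) (simp split: split_indicator)
  finally show ?thesis
    unfolding 1 using assms(2) by (simp add: ennreal_mult mult_left_mono)
qed

text \<open>Links the gauge integrals over finite segments, in which contour integrals are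
  expressed, to the Lebesgue integral over the whole line.\<close>

lemma LINT_line_tendsto:
  fixes g :: "real \<Rightarrow> complex"
  assumes "integrable lborel g"
  shows "((\<lambda>T. integral {-T..T} g) \<longlongrightarrow> (LINT x|lborel. g x)) at_top"
proof -
  have "((\<lambda>T. LINT x|lborel. indicator {-T..T} x *\<^sub>R g x) \<longlongrightarrow> (LINT x|lborel. g x)) at_top"
  proof (rule integral_dominated_convergence_at_top[where w = "\<lambda>x. norm (g x)"])
    show "\<forall>\<^sub>F T in at_top. AE x in lborel. norm (indicator {-T..T} x *\<^sub>R g x) \<le> norm (g x)"
      by (auto split: split_indicator)
    show "AE x in lborel. ((\<lambda>T. indicator {-T..T} x *\<^sub>R g x) \<longlongrightarrow> g x) at_top"
    proof (rule AE_I2, rule tendsto_eventually)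
      fix x :: real
      show "\<forall>\<^sub>F T in at_top. indicator {-T..T} x *\<^sub>R g x = g x"
        using eventually_ge_at_top[of "\<bar>x\<bar>"] by eventually_elim (auto split: split_indicator)
    qed
  qed (use assms in auto)
  moreover have "(LINT x|lborel. indicator {-T..T} x *\<^sub>R g x) = integral {-T..T} g" for T
  proof -
    have "set_integrable lborel {-T..T} g"
      by (rule set_integrable_subset[of _ UNIV]) (use assms in \<open>auto simp: set_integrable_def\<close>)
    from set_borel_integral_eq_integral(2)[OF this] show ?thesis
      by (simp add: set_lebesgue_integral_def)
  qed
  ultimately show ?thesis by simp
qed

text \<open>The factor \<open>\<i>\<close> is the direction of the vertical sides. The horizontal
  sides stay contour integrals, both oriented from left to right, because they will only be
  estimated.\<close>

lemma contour_integral_rectpath_split: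
  fixes h :: "complex \<Rightarrow> complex"
  assumes ab: "a < b" and T: "T > 0"
    and cont: "continuous_on {z. Re z \<in> {a, b} \<and> Im z \<in> {-T..T}} h"
              "continuous_on {z. Im z \<in> {-T, T} \<and> Re z \<in> {a..b}} h"
  shows "contour_integral (rectpath (Complex a (-T)) (Complex b T)) h =
     \<i> * (integral {-T..T} (\<lambda>x. h (Complex b x)) - integral {-T..T} (\<lambda>x. h (Complex a x)))
     + contour_integral (linepath (Complex a (-T)) (Complex b (-T))) h
     - contour_integral (linepath (Complex a T) (Complex b T)) h"
proof -
  let ?a1 = "Complex a (-T)" and ?a2 = "Complex b (-T)" and ?a3 = "Complex b T" and ?a4 = "Complex a T"
  have c: "continuous_on (closed_segment ?a1 ?a2) h" "continuous_on (closed_segment ?a2 ?a3) h"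
    "continuous_on (closed_segment ?a4 ?a3) h" "continuous_on (closed_segment ?a1 ?a4) h"
       apply (rule continuous_on_subset[OF cont(2)],
        use ab T in \<open>auto simp: closed_segment_same_Im closed_segment_eq_real_ivl\<close>)
      apply (rule continuous_on_subset[OF cont(1)],
        use ab T in \<open>auto simp: closed_segment_same_Re closed_segment_eq_real_ivl\<close>)
     apply (rule continuous_on_subset[OF cont(2)],
        use ab T in \<open>auto simp: closed_segment_same_Im closed_segment_eq_real_ivl\<close>)
    apply (rule continuous_on_subset[OF cont(1)],
        use ab T in \<open>auto simp: closed_segment_same_Re closed_segment_eq_real_ivl\<close>)
    done
  have ci: "h contour_integrable_on linepath ?a1 ?a2" "h contour_integrable_on linepath ?a2 ?a3"
    "h contour_integrable_on linepath ?a3 ?a4" "h contour_integrable_on linepath ?a4 ?a1"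
    using c by (auto intro!: contour_integrable_continuous_linepath simp: closed_segment_commute)
  have "contour_integral (rectpath ?a1 ?a3) h =
      contour_integral (linepath ?a1 ?a2) h + contour_integral (linepath ?a2 ?a3) h
      + contour_integral (linepath ?a3 ?a4) h + contour_integral (linepath ?a4 ?a1) h"
    using ci by (simp add: rectpath_def Let_def)
  moreover have "contour_integral (linepath ?a3 ?a4) h = - contour_integral (linepath ?a4 ?a3) h"
    using c by (subst contour_integral_reverse_linepath) (auto simp: closed_segment_commute)
  moreover have "contour_integral (linepath ?a4 ?a1) h = - contour_integral (linepath ?a1 ?a4) h"
    using c by (subst contour_integral_reverse_linepath) (auto simp: closed_segment_commute)
  moreover have "contour_integral (linepath ?a2 ?a3) h = \<i> * integral {-T..T} (\<lambda>x. h (Complex b x))"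
    "contour_integral (linepath ?a1 ?a4) h = \<i> * integral {-T..T} (\<lambda>x. h (Complex a x))"
    using T by (auto intro!: contour_integral_linepath_same_Re)
  ultimately show ?thesis
    by (simp add: algebra_simps)
qed

lemma emeasure_lborel_Ici: "emeasure lborel {S::real..} = \<infinity>"
proof (rule ccontr)
  assume fin: "emeasure lborel {S..} \<noteq> \<infinity>"
  then have "emeasure lborel {S..} < \<infinity>" by (simp add: less_top)
  then obtain n :: nat where n: "emeasure lborel {S..} < of_nat n"
    using ennreal_Ex_less_of_nat[of "emeasure lborel {S..}"] by auto
  have "of_nat n = emeasure lborel {S..S + real n}"
    by (simp add: ennreal_of_nat_eq_real_of_nat)
  also have "\<dots> \<le> emeasure lborel {S..}"
    by (rule emeasure_mono) auto
  finally show False using n by simp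
qed

text \<open>
  The edges at height \<open>\<plusminus>T\<close> are controlled through their integral over \<open>T\<close>: if their limit were nonzero,
  that integral would be infinite.
\<close>
lemma strip_contour_shift:
  fixes h :: "complex \<Rightarrow> complex"
  assumes ab: "a < b" and T0: "T0 > 0"
    and cont: "continuous_on {z. Re z \<in> {a, b}} h"
              "continuous_on {z. Re z \<in> {a..b} \<and> T0 \<le> \<bar>Im z\<bar>} h"
    and int: "integrable lborel (\<lambda>\<omega>. h (Complex a \<omega>))" "integrable lborel (\<lambda>\<omega>. h (Complex b \<omega>))"
    and bound: "\<And>x. x \<in> {a..b} \<Longrightarrow>
      (\<integral>\<^sup>+\<omega>. indicator {\<omega>. T0 \<le> \<bar>\<omega>\<bar>} \<omega> * ennreal (cmod (h (Complex x \<omega>))) \<partial>lborel) \<le> ennreal C"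
    and rect: "\<And>T. T \<ge> T0 \<Longrightarrow> contour_integral (rectpath (Complex a (-T)) (Complex b T)) h = K"
  shows "\<i> * ((LINT \<omega>|lborel. h (Complex b \<omega>)) - (LINT \<omega>|lborel. h (Complex a \<omega>))) = K"
proof (rule ccontr)
  let ?J = "\<i> * ((LINT \<omega>|lborel. h (Complex b \<omega>)) - (LINT \<omega>|lborel. h (Complex a \<omega>)))"
  let ?I = "\<lambda>T. \<i> * (integral {-T..T} (\<lambda>x. h (Complex b x)) - integral {-T..T} (\<lambda>x. h (Complex a x)))"
  assume "?J \<noteq> K"
  define \<kappa> where "\<kappa> = cmod (K - ?J)"
  have \<kappa>: "\<kappa> > 0" using \<open>?J \<noteq> K\<close> by (simp add: \<kappa>_def)
  have "(?I \<longlongrightarrow> ?J) at_top"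
    by (intro tendsto_intros LINT_line_tendsto int)
  then have "((\<lambda>T. cmod (K - ?I T)) \<longlongrightarrow> \<kappa>) at_top"
    unfolding \<kappa>_def by (intro tendsto_norm tendsto_diff tendsto_const)
  then have "\<forall>\<^sub>F T in at_top. cmod (K - ?I T) > \<kappa> / 2"
    by (rule order_tendstoD(1)) (use \<kappa> in simp)
  then obtain T1 where T1: "\<And>T. T \<ge> T1 \<Longrightarrow> cmod (K - ?I T) > \<kappa> / 2"
    unfolding eventually_at_top_linorder by blast
  define Q where "Q = (\<lambda>u \<omega>. h (Complex (a + u * (b - a)) \<omega>))"
  \<comment> \<open>The cutoff to heights beyond \<open>T0\<close> leaves a closed set on which
    \<open>h\<close> is continuous up to the sides of the strip; this gives the joint measurability
    that Tonelli's theorem asks for.\<close>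
  define \<phi> where "\<phi> = (\<lambda>u \<omega>. indicator ({0..1} \<times> {\<omega>. T0 \<le> \<bar>\<omega>\<bar>}) (u, \<omega>) * ennreal (cmod (Q u \<omega>)))"
  define E where "E = (\<lambda>\<omega>. \<integral>\<^sup>+u. \<phi> u \<omega> \<partial>lborel)"
  have in_ab: "a + u * (b - a) \<in> {a..b}" if "u \<in> {0..1}" for u
  proof -
    have "0 \<le> u * (b - a)" "0 \<le> (1 - u) * (b - a)" using that ab by simp_all
    moreover have "a + u * (b - a) = b - (1 - u) * (b - a)" by (simp add: algebra_simps)
    ultimately show ?thesis by simp
  qed
  have closedA: "closed {\<omega>::real. T0 \<le> \<bar>\<omega>\<bar>}"
    by (rule closed_Collect_le[OF continuous_on_const continuous_on_rabs[OF continuous_on_id]])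
  have contQ: "continuous_on ({0..1} \<times> {\<omega>. T0 \<le> \<bar>\<omega>\<bar>}) (\<lambda>(u,\<omega>). Q u \<omega>)"
    unfolding Q_def split_def
  proof (rule continuous_on_compose2[OF cont(2)])
    show "continuous_on ({0..1} \<times> {\<omega>. T0 \<le> \<bar>\<omega>\<bar>}) (\<lambda>x::real \<times> real. Complex (a + fst x * (b - a)) (snd x))"
      unfolding Complex_eq by (intro continuous_intros)
    show "(\<lambda>x. Complex (a + fst x * (b - a)) (snd x)) ` ({0..1} \<times> {\<omega>. T0 \<le> \<bar>\<omega>\<bar>}) \<subseteq> {z. Re z \<in> {a..b} \<and> T0 \<le> \<bar>Im z\<bar>}"
      using in_ab by (simp add: image_subset_iff)
  qed
  have "(\<lambda>x. indicator ({0..1} \<times> {\<omega>. T0 \<le> \<bar>\<omega>\<bar>}) x *\<^sub>R (case x of (u,\<omega>) \<Rightarrow> Q u \<omega>)) \<in> borel_measurable borel"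
    by (rule borel_measurable_continuous_on_indicator[OF _ contQ])
       (intro borel_closed closed_Times closedA, auto)
  then have "(\<lambda>x. ennreal (norm (indicator ({0..1} \<times> {\<omega>. T0 \<le> \<bar>\<omega>\<bar>}) x *\<^sub>R (case x of (u,\<omega>) \<Rightarrow> Q u \<omega>)))) \<in> borel_measurable (lborel \<Otimes>\<^sub>M lborel)"
    unfolding lborel_prod by measurable
  also have "(\<lambda>x. ennreal (norm (indicator ({0..1} \<times> {\<omega>. T0 \<le> \<bar>\<omega>\<bar>}) x *\<^sub>R (case x of (u,\<omega>) \<Rightarrow> Q u \<omega>)))) = case_prod \<phi>"
    by (auto simp: \<phi>_def fun_eq_iff split: split_indicator)
  finally have meas[measurable]: "case_prod \<phi> \<in> borel_measurable (lborel \<Otimes>\<^sub>M lborel)" .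
  have measE[measurable]: "E \<in> borel_measurable lborel"
    unfolding E_def by measurable
  have "(\<integral>\<^sup>+\<omega>. E \<omega> \<partial>lborel) = (\<integral>\<^sup>+u. (\<integral>\<^sup>+\<omega>. \<phi> u \<omega> \<partial>lborel) \<partial>lborel)"
    unfolding E_def by (rule lborel_pair.Fubini'[OF meas])
  also have "\<dots> \<le> (\<integral>\<^sup>+u. ennreal C * indicator {0..1::real} u \<partial>lborel)"
  proof (rule nn_integral_mono)
    fix u :: real
    show "(\<integral>\<^sup>+\<omega>. \<phi> u \<omega> \<partial>lborel) \<le> ennreal C * indicator {0..1} u"
      using bound[OF in_ab] by (cases "u \<in> {0..1}") (auto simp: \<phi>_def Q_def indicator_times)
  qed
  also have "\<dots> = ennreal C"
    by (subst nn_integral_cmult_indicator) auto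
  finally have E_fin: "(\<integral>\<^sup>+\<omega>. E \<omega> \<partial>lborel) \<le> ennreal C" .
  \<comment> \<open>The lower edge enters as \<open>E (- T)\<close>, whose integral over
    \<open>T\<close> is again that of \<open>E\<close>.\<close>
  have reflect: "(\<integral>\<^sup>+\<omega>. E (-\<omega>) \<partial>lborel) = (\<integral>\<^sup>+\<omega>. E \<omega> \<partial>lborel)"
    using nn_integral_real_affine[of E "-1" 0] by simp
  define S where "S = max T0 T1"
  \<comment> \<open>By the rectangle identity the two horizontal edges account for the whole gap
    between \<open>K\<close> and the truncated vertical integrals, which exceeds
    \<open>\<kappa> / 2\<close> from \<open>T1\<close> on.\<close>
  have lower: "ennreal (\<kappa> / 2) \<le> ennreal (b - a) * (E T + E (- T))" if "T \<ge> S" for T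
  proof -
    have T: "T \<ge> T0" "T \<ge> T1" "T > 0" using that T0 by (auto simp: S_def)
    have E_eq: "E \<tau> = (\<integral>\<^sup>+u. indicator {0..1} u * ennreal (cmod (h (Complex (a + u * (b - a)) \<tau>))) \<partial>lborel)"
      if "\<bar>\<tau>\<bar> \<ge> T0" for \<tau>
      unfolding E_def \<phi>_def Q_def using that by (intro nn_integral_cong) (auto split: split_indicator)
    have hb: "ennreal (cmod (contour_integral (linepath (Complex a \<tau>) (Complex b \<tau>)) h)) \<le> ennreal (b - a) * E \<tau>"
      if "\<bar>\<tau>\<bar> \<ge> T0" for \<tau>
      unfolding E_eq[OF that]
    proof (rule horizontal_segment_bound[OF _ ab], rule continuous_on_compose2[OF cont(2)])
      show "continuous_on {0..1} (\<lambda>u. Complex (a + u * (b - a)) \<tau>)"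
        unfolding Complex_eq by (intro continuous_intros)
      show "(\<lambda>u. Complex (a + u * (b - a)) \<tau>) ` {0..1} \<subseteq> {z. Re z \<in> {a..b} \<and> T0 \<le> \<bar>Im z\<bar>}"
        using in_ab that by (simp add: image_subset_iff)
    qed
    have "K = ?I T + contour_integral (linepath (Complex a (-T)) (Complex b (-T))) h
       - contour_integral (linepath (Complex a T) (Complex b T)) h"
      unfolding rect[OF T(1), symmetric]
      by (rule contour_integral_rectpath_split[OF ab T(3)]; rule continuous_on_subset[OF cont(1)] continuous_on_subset[OF cont(2)])
         (use T in auto)
    then have "K - ?I T = contour_integral (linepath (Complex a (-T)) (Complex b (-T))) h
       - contour_integral (linepath (Complex a T) (Complex b T)) h" by simp
    then have "cmod (K - ?I T) \<le> cmod (contour_integral (linepath (Complex a (-T)) (Complex b (-T))) h)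
       + cmod (contour_integral (linepath (Complex a T) (Complex b T)) h)"
      by (metis norm_triangle_ineq4)
    then have "\<kappa> / 2 \<le> cmod (contour_integral (linepath (Complex a (-T)) (Complex b (-T))) h)
       + cmod (contour_integral (linepath (Complex a T) (Complex b T)) h)"
      using T1[OF T(2)] by linarith
    then have "ennreal (\<kappa> / 2) \<le> ennreal (cmod (contour_integral (linepath (Complex a (-T)) (Complex b (-T))) h))
       + ennreal (cmod (contour_integral (linepath (Complex a T) (Complex b T)) h))"
      by (simp add: ennreal_leI flip: ennreal_plus)
    also have "\<dots> \<le> ennreal (b - a) * E (-T) + ennreal (b - a) * E T"
      using T by (intro add_mono hb) auto
    finally show ?thesis by (simp add: distrib_left add.commute)
  qed
  have "\<infinity> = (\<integral>\<^sup>+T. ennreal (\<kappa> / 2) * indicator {S..} T \<partial>lborel)"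
    using \<kappa> by (subst nn_integral_cmult_indicator) (auto simp: emeasure_lborel_Ici ennreal_mult_top)
  also have "\<dots> \<le> (\<integral>\<^sup>+T. ennreal (b - a) * (E T + E (- T)) \<partial>lborel)"
    using lower by (intro nn_integral_mono) (auto split: split_indicator)
  also have "\<dots> = ennreal (b - a) * ((\<integral>\<^sup>+\<omega>. E \<omega> \<partial>lborel) + (\<integral>\<^sup>+\<omega>. E (-\<omega>) \<partial>lborel))"
    by (subst nn_integral_cmult; (subst nn_integral_add)?) auto
  also have "\<dots> \<le> ennreal (b - a) * (ennreal C + ennreal C)"
    unfolding reflect using E_fin by (intro mult_left_mono add_mono) auto
  also have "\<dots> < \<infinity>" by (simp add: ennreal_mult_less_top)
  finally show False by simp
qed

section \<open>Square-integrable functions on the line\<close>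

definition l2 :: "(real \<Rightarrow> complex) \<Rightarrow> ennreal" where
  "l2 u = (\<integral>\<^sup>+\<omega>. ennreal ((cmod (u \<omega>))\<^sup>2) \<partial>lborel)"

text \<open>\<open>enn2real\<close> sends infinity to 0, so this value carries meaning only together
  with finiteness of \<open>l2 u\<close>.\<close>

definition l2_norm :: "(real \<Rightarrow> complex) \<Rightarrow> real" where
  "l2_norm u = sqrt (enn2real (l2 u))"

text \<open>A crude substitute for Minkowski's inequality: only finiteness and some explicit bound
  are wanted from it.\<close>

lemma l2_add_le:
  assumes [measurable]: "u \<in> borel_measurable lborel" "v \<in> borel_measurable lborel"
  shows "l2 (\<lambda>\<omega>. u \<omega> + v \<omega>) \<le> 2 * l2 u + 2 * l2 v"
proof -
  have "l2 (\<lambda>\<omega>. u \<omega> + v \<omega>) \<le> (\<integral>\<^sup>+\<omega>. 2 * ennreal ((cmod (u \<omega>))\<^sup>2) + 2 * ennreal ((cmod (v \<omega>))\<^sup>2) \<partial>lborel)"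
    unfolding l2_def
  proof (rule nn_integral_mono)
    fix \<omega>
    have "(cmod (u \<omega> + v \<omega>))\<^sup>2 \<le> (cmod (u \<omega>) + cmod (v \<omega>))\<^sup>2"
      by (intro power_mono norm_triangle_ineq) auto
    also have "\<dots> \<le> 2 * (cmod (u \<omega>))\<^sup>2 + 2 * (cmod (v \<omega>))\<^sup>2"
      using zero_le_power2[of "cmod (u \<omega>) - cmod (v \<omega>)"] by (simp add: power2_eq_square algebra_simps)
    finally have "ennreal ((cmod (u \<omega> + v \<omega>))\<^sup>2) \<le> ennreal (2 * (cmod (u \<omega>))\<^sup>2 + 2 * (cmod (v \<omega>))\<^sup>2)"
      by (rule ennreal_leI)
    then show "ennreal ((cmod (u \<omega> + v \<omega>))\<^sup>2) \<le> 2 * ennreal ((cmod (u \<omega>))\<^sup>2) + 2 * ennreal ((cmod (v \<omega>))\<^sup>2)"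
      by (simp add: ennreal_mult)
  qed
  also have "\<dots> = 2 * l2 u + 2 * l2 v"
    unfolding l2_def by (subst nn_integral_add) (auto simp: nn_integral_cmult)
  finally show ?thesis .
qed

lemma l2_minus_commute: "l2 (\<lambda>\<omega>. u \<omega> - v \<omega>) = l2 (\<lambda>\<omega>. v \<omega> - u \<omega>)"
  by (simp add: l2_def norm_minus_commute)

lemma l2_integrable:
  assumes [measurable]: "u \<in> borel_measurable lborel" and fin: "l2 u < \<infinity>"
  shows "integrable lborel (\<lambda>\<omega>. (cmod (u \<omega>))\<^sup>2)"
    and "l2 u = ennreal (LINT \<omega>|lborel. (cmod (u \<omega>))\<^sup>2)"
proof -
  show 1: "integrable lborel (\<lambda>\<omega>. (cmod (u \<omega>))\<^sup>2)"
    using fin by (intro integrableI_nonneg) (auto simp: l2_def)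
  show "l2 u = ennreal (LINT \<omega>|lborel. (cmod (u \<omega>))\<^sup>2)"
    unfolding l2_def by (rule nn_integral_eq_integral[OF 1]) auto
qed

lemma l2_eq_norm: "l2 u < \<infinity> \<Longrightarrow> l2 u = ennreal ((l2_norm u)\<^sup>2)"
  by (simp add: l2_norm_def)

lemma l2_norm_nonneg [simp]: "0 \<le> l2_norm u"
  by (simp add: l2_norm_def)

lemma l2_norm_le: "l2 u \<le> ennreal (c\<^sup>2) \<Longrightarrow> 0 \<le> c \<Longrightarrow> l2_norm u \<le> c"
  unfolding l2_norm_def by (rule real_le_lsqrt) (auto simp: enn2real_leI)

text \<open>Cauchy-Schwarz at the level of \<open>ennreal\<close>, so that it also delivers
  integrability of the product.\<close>

lemma nn_integral_prod_le:
  assumes [measurable]: "u \<in> borel_measurable lborel" "v \<in> borel_measurable lborel"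
    and fin: "l2 u < \<infinity>" "l2 v < \<infinity>"
  shows "(\<integral>\<^sup>+\<omega>. ennreal (cmod (u \<omega> * v \<omega>)) \<partial>lborel) \<le> ennreal (l2_norm u * l2_norm v)"
proof -
  let ?x = "\<integral>\<^sup>+\<omega>. ennreal (cmod (u \<omega> * v \<omega>)) \<partial>lborel"
  have "?x = (\<integral>\<^sup>+\<omega>. ennreal (cmod (u \<omega>)) * ennreal (cmod (v \<omega>)) \<partial>lborel)"
    by (intro nn_integral_cong) (simp add: norm_mult ennreal_mult)
  then have "?x\<^sup>2 \<le> (\<integral>\<^sup>+\<omega>. (ennreal (cmod (u \<omega>)))\<^sup>2 \<partial>lborel) * (\<integral>\<^sup>+\<omega>. (ennreal (cmod (v \<omega>)))\<^sup>2 \<partial>lborel)"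
    using Cauchy_Schwarz_nn_integral[of "\<lambda>\<omega>. ennreal (cmod (u \<omega>))" lborel "\<lambda>\<omega>. ennreal (cmod (v \<omega>))"]
    by simp
  also have "\<dots> = l2 u * l2 v"
    unfolding l2_def by (simp add: ennreal_power)
  also have "\<dots> = ennreal ((l2_norm u * l2_norm v)\<^sup>2)"
    using fin by (simp add: l2_eq_norm ennreal_mult power_mult_distrib)
  finally have le: "?x\<^sup>2 \<le> ennreal ((l2_norm u * l2_norm v)\<^sup>2)" .
  show ?thesis
  proof (cases ?x)
    case (real r)
    then have "r\<^sup>2 \<le> (l2_norm u * l2_norm v)\<^sup>2"
      using le by (simp add: ennreal_power)
    then have "r \<le> l2_norm u * l2_norm v"
      by (rule power2_le_imp_le) simp
    then show ?thesis using real by (simp add: ennreal_leI)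
  next
    case top
    then show ?thesis using le by (simp add: power2_eq_square top_unique)
  qed
qed

lemma l2_prod_integrable:
  assumes [measurable]: "u \<in> borel_measurable lborel" "v \<in> borel_measurable lborel"
    and fin: "l2 u < \<infinity>" "l2 v < \<infinity>"
  shows "integrable lborel (\<lambda>\<omega>. u \<omega> * v \<omega>)"
    and "cmod (LINT \<omega>|lborel. u \<omega> * v \<omega>) \<le> l2_norm u * l2_norm v"
proof -
  note le = nn_integral_prod_le[OF assms]
  show i: "integrable lborel (\<lambda>\<omega>. u \<omega> * v \<omega>)"
    by (rule integrableI_bounded) (use le in \<open>auto intro: le_less_trans\<close>)
  have "ennreal (cmod (LINT \<omega>|lborel. u \<omega> * v \<omega>)) \<le> ennreal (l2_norm u * l2_norm v)"
    using integral_norm_bound_ennreal[OF i] le by (rule order_trans)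
  then show "cmod (LINT \<omega>|lborel. u \<omega> * v \<omega>) \<le> l2_norm u * l2_norm v"
    by (subst (asm) ennreal_le_iff) auto
qed

lemma l2_cnj [simp]: "l2 (\<lambda>\<omega>. cnj (u \<omega>)) = l2 u" "l2_norm (\<lambda>\<omega>. cnj (u \<omega>)) = l2_norm u"
  by (simp_all add: l2_norm_def l2_def)

lemma borel_measurable_cnj [measurable (raw)]:
  "u \<in> borel_measurable M \<Longrightarrow> (\<lambda>x. cnj (u x)) \<in> borel_measurable M"
  by (rule measurable_compose[OF _ borel_measurable_continuous_onI])
     (auto intro: continuous_intros)

text \<open>The pointwise half of Riesz-Fischer. The decay \<open>(1/4)^n\<close> leaves room for
  the weight \<open>2^n\<close>: the weighted squares still have a finite total integral, and the
  weight turns summable squares into summable increments.\<close>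

lemma l2_Cauchy_AE_convergent:
  fixes u :: "nat \<Rightarrow> real \<Rightarrow> complex"
  assumes [measurable]: "\<And>n. u n \<in> borel_measurable lborel"
    and diff: "\<And>n. l2 (\<lambda>\<omega>. u (Suc n) \<omega> - u n \<omega>) \<le> ennreal (C * (1/4)^n)" and C: "C \<ge> 0"
  shows "AE \<omega> in lborel. convergent (\<lambda>n. u n \<omega>)"
proof -
  let ?w = "\<lambda>n \<omega>. 2^n * (cmod (u (Suc n) \<omega> - u n \<omega>))\<^sup>2"
  have "(\<integral>\<^sup>+\<omega>. (\<Sum>n. ennreal (?w n \<omega>)) \<partial>lborel) = (\<Sum>n. \<integral>\<^sup>+\<omega>. ennreal (?w n \<omega>) \<partial>lborel)"
    by (rule nn_integral_suminf) auto
  also have "\<dots> \<le> (\<Sum>n. ennreal (C * (1/2)^n))"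
  proof (rule suminf_le)
    fix n
    have "(\<integral>\<^sup>+\<omega>. ennreal (?w n \<omega>) \<partial>lborel) = ennreal (2^n) * l2 (\<lambda>\<omega>. u (Suc n) \<omega> - u n \<omega>)"
      unfolding l2_def by (subst nn_integral_cmult[symmetric]) (auto simp: ennreal_mult)
    also have "\<dots> \<le> ennreal (2^n) * ennreal (C * (1/4)^n)"
      by (intro mult_left_mono diff) auto
    also have "\<dots> = ennreal (C * (1/2)^n)"
      using C by (simp add: ennreal_mult[symmetric] power_divide flip: power_mult_distrib)
         (simp add: field_simps flip: power_mult_distrib)
    finally show "(\<integral>\<^sup>+\<omega>. ennreal (?w n \<omega>) \<partial>lborel) \<le> ennreal (C * (1/2)^n)" .
  qed auto
  also have "\<dots> = ennreal (\<Sum>n. C * (1/2)^n)"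
    using C by (intro suminf_ennreal2) (auto intro!: summable_mult summable_geometric)
  finally have "(\<integral>\<^sup>+\<omega>. (\<Sum>n. ennreal (?w n \<omega>)) \<partial>lborel) \<noteq> \<infinity>"
    by (auto simp: top_unique)
  then have "AE \<omega> in lborel. (\<Sum>n. ennreal (?w n \<omega>)) \<noteq> \<infinity>"
    by (intro nn_integral_PInf_AE) auto
  then show ?thesis
  proof eventually_elim
    fix \<omega> assume fin: "(\<Sum>n. ennreal (?w n \<omega>)) \<noteq> \<infinity>"
    have "summable (\<lambda>n. ?w n \<omega>)"
      by (rule summable_suminf_not_top) (use fin in auto)
    then have s: "summable (\<lambda>n. (1/2)^n + ?w n \<omega>)"
      by (intro summable_add summable_geometric) auto
    \<comment> \<open>AM-GM: \<open>a \<le> 2\<^sup>-\<^sup>n + 2\<^sup>n a\<^sup>2\<close>\<close>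
    have "summable (\<lambda>n. u (Suc n) \<omega> - u n \<omega>)"
    proof (rule summable_comparison_test'[OF s])
      fix n :: nat
      let ?a = "cmod (u (Suc n) \<omega> - u n \<omega>)"
      have "0 \<le> (1 - 2^n * ?a)\<^sup>2" by simp
      then have "2 * (2^n * ?a) \<le> 1 + (2^n * ?a)\<^sup>2"
        by (simp add: power2_eq_square algebra_simps)
      moreover have "0 \<le> 2^n * ?a" by simp
      ultimately have "2^n * ?a \<le> 1 + (2^n * ?a)\<^sup>2" by linarith
      also have "\<dots> = 2^n * ((1/2)^n + ?w n \<omega>)"
        by (simp add: field_simps power_divide power2_eq_square)
      finally show "?a \<le> (1/2)^n + ?w n \<omega>"
        by simp
    qed
    then have "convergent (\<lambda>n. \<Sum>k<n. u (Suc k) \<omega> - u k \<omega>)"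
      by (simp add: summable_iff_convergent)
    then have "convergent (\<lambda>n. u n \<omega> - u 0 \<omega>)"
      using sum_lessThan_telescope[of "\<lambda>n. u n \<omega>"] by simp
    then have "convergent (\<lambda>n. (u n \<omega> - u 0 \<omega>) + u 0 \<omega>)"
      by (intro convergent_add convergent_const)
    then show "convergent (\<lambda>n. u n \<omega>)" by simp
  qed
qed

text \<open>This lower semicontinuity carries Cauchy estimates over to limits, for boundary
  functions as well as for completeness.\<close>

lemma l2_Fatou:
  assumes [measurable]: "\<And>n. u n \<in> borel_measurable lborel"
    and lim: "AE \<omega> in lborel. (\<lambda>n. u n \<omega>) \<longlonglongrightarrow> v \<omega>"
    and bound: "\<forall>\<^sub>F n in sequentially. l2 (u n) \<le> c"
  shows "l2 v \<le> c"
proof -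
  have "l2 v = (\<integral>\<^sup>+\<omega>. liminf (\<lambda>n. ennreal ((cmod (u n \<omega>))\<^sup>2)) \<partial>lborel)"
    unfolding l2_def
  proof (rule nn_integral_cong_AE)
    show "AE \<omega> in lborel. ennreal ((cmod (v \<omega>))\<^sup>2) = liminf (\<lambda>n. ennreal ((cmod (u n \<omega>))\<^sup>2))"
      using lim
    proof eventually_elim
      fix \<omega> assume "(\<lambda>n. u n \<omega>) \<longlonglongrightarrow> v \<omega>"
      then have "(\<lambda>n. ennreal ((cmod (u n \<omega>))\<^sup>2)) \<longlonglongrightarrow> ennreal ((cmod (v \<omega>))\<^sup>2)"
        by (intro tendsto_ennrealI tendsto_intros)
      then show "ennreal ((cmod (v \<omega>))\<^sup>2) = liminf (\<lambda>n. ennreal ((cmod (u n \<omega>))\<^sup>2))"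
        by (rule lim_imp_Liminf[OF sequentially_bot, symmetric])
    qed
  qed
  also have "\<dots> \<le> liminf (\<lambda>n. l2 (u n))"
    unfolding l2_def by (rule nn_integral_liminf) auto
  also have "\<dots> \<le> liminf (\<lambda>n. c)"
    using bound by (rule Liminf_mono)
  also have "\<dots> = c" by (simp add: Liminf_const)
  finally show ?thesis .
qed

text \<open>Along equally spaced points midpoint convexity makes the increments nondecreasing. One
  increase \<open>\<delta>\<close> would thus recur at every later step and force linear growth,
  against the bound; continuity of \<open>N\<close> does not enter.\<close>

lemma midconvex_bounded_antimono:
  fixes N :: "real \<Rightarrow> real"
  assumes conv: "\<And>x y. 0 < x \<Longrightarrow> 0 < y \<Longrightarrow> 2 * N ((x + y) / 2) \<le> N x + N y"
    and bdd: "\<And>x. 0 < x \<Longrightarrow> N x \<le> M" and ab: "0 < a" "a \<le> b"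
  shows "N b \<le> N a"
proof (rule ccontr)
  assume "\<not> N b \<le> N a"
  define d where "d = b - a"
  define \<delta> where "\<delta> = N b - N a"
  have d: "d \<ge> 0" and \<delta>: "\<delta> > 0" using ab \<open>\<not> N b \<le> N a\<close> by (auto simp: d_def \<delta>_def)
  have step: "N (a + real (Suc n) * d) - N (a + real n * d) \<ge> \<delta>" for n
  proof (induction n)
    case 0
    then show ?case by (simp add: d_def \<delta>_def)
  next
    case (Suc n)
    have pos: "0 < a + real k * d" for k
      using ab d by (simp add: add_pos_nonneg)
    have mid: "(a + real n * d + (a + real (Suc (Suc n)) * d)) / 2 = a + real (Suc n) * d"
      by (simp add: field_simps)
    show ?case
      using conv[OF pos[of n] pos[of "Suc (Suc n)"]] Suc unfolding mid by linarith
  qed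
  have "N (a + real n * d) \<ge> N a + real n * \<delta>" for n
  proof (induction n)
    case (Suc n)
    have "real (Suc n) * \<delta> = real n * \<delta> + \<delta>" by (simp add: algebra_simps)
    then show ?case using Suc step[of n] by linarith
  qed simp
  moreover obtain n where "real n * \<delta> > M - N a"
    using reals_Archimedean3[OF \<delta>] by blast
  moreover have "0 < a + real n * d" using ab d by (simp add: add_pos_nonneg)
  ultimately show False using bdd[of "a + real n * d"] by (smt (verit))
qed

section \<open>Scalar Hardy functions on vertical lines\<close>

text \<open>Scalar form of the Hardy space with an explicit bound on the squared norms, without the
  factor \<open>1 / (2 * pi)\<close> of the inner product. The condition \<open>M \<ge> 0\<close>
  keeps \<open>ennreal M\<close> faithful, as \<open>ennreal\<close> truncates negative
  numbers.\<close>

definition hardy_bound :: "(complex \<Rightarrow> complex) \<Rightarrow> real \<Rightarrow> bool" where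
  "hardy_bound f M \<longleftrightarrow> f holomorphic_on {s. Re s > 0} \<and> M \<ge> 0 \<and>
     (\<forall>\<xi>>0. l2 (\<lambda>\<omega>. f (Complex \<xi> \<omega>)) \<le> ennreal M)"

lemma open_right_half_plane: "open {s. 0 < Re s}"
  by (simp add: open_halfspace_Re_gt)

lemma borel_measurable_vertical_line:
  assumes "continuous_on {s. Re s > 0} f" "\<xi> > 0"
  shows "(\<lambda>\<omega>. f (Complex \<xi> \<omega>)) \<in> borel_measurable lborel"
proof -
  have "continuous_on UNIV (\<lambda>\<omega>. f (Complex \<xi> \<omega>))"
    by (rule continuous_on_compose2[OF assms(1)])
       (use assms(2) in \<open>auto simp: Complex_eq intro!: continuous_intros\<close>)
  then show ?thesis by (simp add: borel_measurable_continuous_onI)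
qed

lemma hardy_boundD:
  assumes "hardy_bound f M" "\<xi> > 0"
  shows "(\<lambda>\<omega>. f (Complex \<xi> \<omega>)) \<in> borel_measurable lborel"
    and "l2 (\<lambda>\<omega>. f (Complex \<xi> \<omega>)) < \<infinity>"
    and "l2_norm (\<lambda>\<omega>. f (Complex \<xi> \<omega>)) \<le> sqrt M"
proof -
  show "(\<lambda>\<omega>. f (Complex \<xi> \<omega>)) \<in> borel_measurable lborel"
    using assms by (intro borel_measurable_vertical_line holomorphic_on_imp_continuous_on)
      (auto simp: hardy_bound_def)
  have le: "l2 (\<lambda>\<omega>. f (Complex \<xi> \<omega>)) \<le> ennreal M" and M: "0 \<le> M"
    using assms by (auto simp: hardy_bound_def)
  from le show "l2 (\<lambda>\<omega>. f (Complex \<xi> \<omega>)) < \<infinity>"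
    by (rule le_less_trans) simp
  show "l2_norm (\<lambda>\<omega>. f (Complex \<xi> \<omega>)) \<le> sqrt M"
    by (rule l2_norm_le) (use le M in auto)
qed

section \<open>Boundary functions\<close>

text \<open>The reflection \<open>z \<mapsto> of_real t - cnj z\<close> preserves imaginary parts,
  and together with the outer conjugation it yields a holomorphic function. The integrand is
  therefore holomorphic in the strip \<open>0 < Re z < t\<close>, where the line of integration can
  be moved.\<close>

lemma line_correlation_shift:
  assumes f: "hardy_bound f M" and ab: "0 < a" "a \<le> b" "b < t"
  shows "(LINT \<omega>|lborel. cnj (f (Complex (t - a) \<omega>)) * f (Complex a \<omega>)) =
         (LINT \<omega>|lborel. cnj (f (Complex (t - b) \<omega>)) * f (Complex b \<omega>))"
proof (cases "a = b")
  case False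
  then have "a < b" using ab by simp
  \<comment> \<open>On the line \<open>Re z = x\<close> this holomorphic function is the integrand \<open>cnj f\<^bsub>t - x\<^esub> * f\<^sub>x\<close>.\<close>
  define h where "h = (\<lambda>z. cnj (f (of_real t - cnj z)) * f z)"
  let ?S = "{z. 0 < Re z \<and> Re z < t}"
  have h_line: "h (Complex x \<omega>) = cnj (f (Complex (t - x) \<omega>)) * f (Complex x \<omega>)" for x \<omega>
  proof -
    have "of_real t - cnj (Complex x \<omega>) = Complex (t - x) \<omega>" by (simp add: complex_eq_iff)
    then show ?thesis by (simp add: h_def)
  qed
  have hol_f: "f holomorphic_on {s. Re s > 0}" using f by (simp add: hardy_bound_def)
  have S: "open ?S" "convex ?S"
    by (auto simp: Collect_conj_eq open_halfspace_Re_gt open_halfspace_Re_lt convex_halfspace_Re_gt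
        convex_halfspace_Re_lt intro!: open_Int convex_Int)
  have cnjS: "cnj ` ?S = ?S"
    by (auto simp: image_cnj_conv_vimage_cnj)
  have "(\<lambda>z. f (of_real t - z)) holomorphic_on cnj ` ?S"
    unfolding cnjS by (rule holomorphic_on_compose_gen[OF _ hol_f, unfolded o_def])
      (auto intro!: holomorphic_intros)
  then have "cnj \<circ> (\<lambda>z. f (of_real t - z)) \<circ> cnj holomorphic_on ?S"
    by (rule holomorphic_on_compose_cnj_cnj) (rule S(1))
  then have hol: "h holomorphic_on ?S"
    unfolding h_def o_def by (intro holomorphic_intros holomorphic_on_subset[OF hol_f]) auto
  then have cont: "continuous_on ?S h" by (rule holomorphic_on_imp_continuous_on)
  have fx: "(\<lambda>\<omega>. cnj (f (Complex (t - x) \<omega>))) \<in> borel_measurable lborel"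
      "(\<lambda>\<omega>. f (Complex x \<omega>)) \<in> borel_measurable lborel"
      "l2 (\<lambda>\<omega>. cnj (f (Complex (t - x) \<omega>))) < \<infinity>" "l2 (\<lambda>\<omega>. f (Complex x \<omega>)) < \<infinity>"
    if "x \<in> {a..b}" for x
    using hardy_boundD(1,2)[OF f, of x] hardy_boundD(1,2)[OF f, of "t - x"] that ab
    by (auto intro: borel_measurable_cnj)
  \<comment> \<open>The function \<open>h\<close> has no pole in the strip, so any positive
    threshold does. The constant \<open>M\<close> is Cauchy-Schwarz on each line,
    \<open>sqrt M * sqrt M\<close>.\<close>
  have "\<i> * ((LINT \<omega>|lborel. h (Complex b \<omega>)) - (LINT \<omega>|lborel. h (Complex a \<omega>))) = 0"
  proof (rule strip_contour_shift[OF \<open>a < b\<close>, where ?T0.0 = 1 and C = M])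
    show "integrable lborel (\<lambda>\<omega>. h (Complex a \<omega>))" "integrable lborel (\<lambda>\<omega>. h (Complex b \<omega>))"
      unfolding h_line using ab by (auto intro!: l2_prod_integrable(1)[OF fx])
  next
    fix x assume x: "x \<in> {a..b}"
    have "(\<integral>\<^sup>+\<omega>. indicator {\<omega>. 1 \<le> \<bar>\<omega>\<bar>} \<omega> * ennreal (cmod (h (Complex x \<omega>))) \<partial>lborel)
        \<le> (\<integral>\<^sup>+\<omega>. ennreal (cmod (h (Complex x \<omega>))) \<partial>lborel)"
      by (intro nn_integral_mono) (auto split: split_indicator)
    also have "\<dots> \<le> ennreal (l2_norm (\<lambda>\<omega>. cnj (f (Complex (t - x) \<omega>))) * l2_norm (\<lambda>\<omega>. f (Complex x \<omega>)))"
      unfolding h_line by (rule nn_integral_prod_le[OF fx[OF x]])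
    also have "\<dots> \<le> ennreal (sqrt M * sqrt M)"
      using hardy_boundD(3)[OF f, of x] hardy_boundD(3)[OF f, of "t - x"] x ab f
      by (intro ennreal_leI mult_mono) (auto simp: hardy_bound_def)
    finally show "(\<integral>\<^sup>+\<omega>. indicator {\<omega>. 1 \<le> \<bar>\<omega>\<bar>} \<omega> * ennreal (cmod (h (Complex x \<omega>))) \<partial>lborel) \<le> ennreal M"
      using f by (simp add: hardy_bound_def)
  next
    fix T :: real assume T: "1 \<le> T"
    have "path_image (rectpath (Complex a (-T)) (Complex b T)) \<subseteq> ?S"
      using ab T by (auto simp: path_image_rectpath)
    then have "(h has_contour_integral 0) (rectpath (Complex a (-T)) (Complex b T))"
      by (intro Cauchy_theorem_convex_simple[OF hol S(2)]) auto
    then show "contour_integral (rectpath (Complex a (-T)) (Complex b T)) h = 0"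
      by (rule contour_integral_unique)
  qed (use ab in \<open>auto intro!: continuous_on_subset[OF cont]\<close>)
  then show ?thesis unfolding h_line by simp
qed simp

lemma of_real_l2_norm_power2:
  assumes "u \<in> borel_measurable lborel" "l2 u < \<infinity>"
  shows "(LINT \<omega>|lborel. cnj (u \<omega>) * u \<omega>) = of_real ((l2_norm u)\<^sup>2)"
proof -
  have "(LINT \<omega>|lborel. cnj (u \<omega>) * u \<omega>) = (LINT \<omega>|lborel. of_real ((cmod (u \<omega>))\<^sup>2))"
    by (intro Bochner_Integration.integral_cong refl) (simp only: complex_norm_square mult.commute)
  also have "\<dots> = of_real (LINT \<omega>|lborel. (cmod (u \<omega>))\<^sup>2)"
    by (rule integral_complex_of_real)
  also have "(LINT \<omega>|lborel. (cmod (u \<omega>))\<^sup>2) = (l2_norm u)\<^sup>2"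
    using l2_integrable(2)[OF assms] by (simp add: l2_norm_def)
  finally show ?thesis .
qed

text \<open>Once both abscissae, whose sum is fixed, stand at the midpoint, the correlation is a
  squared norm. Two cases arise because \<open>line_correlation_shift\<close> goes from a smaller to
  a larger abscissa.\<close>

lemma line_inner_midpoint:
  assumes f: "hardy_bound f M" and pos: "0 < \<xi>" "0 < \<eta>"
  shows "(LINT \<omega>|lborel. cnj (f (Complex \<xi> \<omega>)) * f (Complex \<eta> \<omega>)) =
    of_real ((l2_norm (\<lambda>\<omega>. f (Complex ((\<xi> + \<eta>) / 2) \<omega>)))\<^sup>2)"
proof -
  let ?m = "(\<xi> + \<eta>) / 2"
  let ?I = "\<lambda>x. LINT \<omega>|lborel. cnj (f (Complex (\<xi> + \<eta> - x) \<omega>)) * f (Complex x \<omega>)"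
  have "?I \<eta> = ?I ?m"
  proof (cases "\<eta> \<le> \<xi>")
    case True
    then show ?thesis using pos by (intro line_correlation_shift[OF f]) auto
  next
    case False
    then show ?thesis using pos by (intro line_correlation_shift[OF f, symmetric]) auto
  qed
  moreover have "\<xi> + \<eta> - ?m = ?m" by (simp add: field_simps)
  ultimately show ?thesis
    using of_real_l2_norm_power2[OF hardy_boundD(1,2)[OF f, of ?m]] pos by simp
qed

lemma l2_line_diff:
  assumes f: "hardy_bound f M" and pos: "0 < \<xi>" "0 < \<eta>"
  defines "N \<equiv> \<lambda>x. (l2_norm (\<lambda>\<omega>. f (Complex x \<omega>)))\<^sup>2"
  shows "l2 (\<lambda>\<omega>. f (Complex \<xi> \<omega>) - f (Complex \<eta> \<omega>)) = ennreal (N \<xi> + N \<eta> - 2 * N ((\<xi> + \<eta>) / 2))"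
    and "2 * N ((\<xi> + \<eta>) / 2) \<le> N \<xi> + N \<eta>"
proof -
  let ?u = "\<lambda>\<omega>. f (Complex \<xi> \<omega>)" and ?v = "\<lambda>\<omega>. f (Complex \<eta> \<omega>)"
  note [measurable] = hardy_boundD(1)[OF f pos(1)] hardy_boundD(1)[OF f pos(2)]
  note fin = hardy_boundD(2)[OF f pos(1)] hardy_boundD(2)[OF f pos(2)]
  have int: "integrable lborel (\<lambda>\<omega>. cnj (?u \<omega>) * ?u \<omega>)" "integrable lborel (\<lambda>\<omega>. cnj (?u \<omega>) * ?v \<omega>)"
    "integrable lborel (\<lambda>\<omega>. cnj (?v \<omega>) * ?u \<omega>)" "integrable lborel (\<lambda>\<omega>. cnj (?v \<omega>) * ?v \<omega>)"
    using fin by (auto intro!: l2_prod_integrable(1))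
  have "l2 (\<lambda>\<omega>. ?u \<omega> - ?v \<omega>) \<le> 2 * l2 ?u + 2 * l2 (\<lambda>\<omega>. - ?v \<omega>)"
    using l2_add_le[of ?u "\<lambda>\<omega>. - ?v \<omega>"] by simp
  also have "\<dots> < \<infinity>" using fin by (simp add: l2_def ennreal_mult_less_top)
  finally have dfin: "l2 (\<lambda>\<omega>. ?u \<omega> - ?v \<omega>) < \<infinity>" .
  have "of_real ((l2_norm (\<lambda>\<omega>. ?u \<omega> - ?v \<omega>))\<^sup>2) =
      (LINT \<omega>|lborel. cnj (?u \<omega> - ?v \<omega>) * (?u \<omega> - ?v \<omega>))"
    by (rule of_real_l2_norm_power2[symmetric]) (use dfin in auto)
  also have "\<dots> = (LINT \<omega>|lborel. (cnj (?u \<omega>) * ?u \<omega> - cnj (?u \<omega>) * ?v \<omega>) - (cnj (?v \<omega>) * ?u \<omega> - cnj (?v \<omega>) * ?v \<omega>))"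
    by (intro Bochner_Integration.integral_cong) (simp_all add: algebra_simps)
  also have "\<dots> = (LINT \<omega>|lborel. cnj (?u \<omega>) * ?u \<omega>) - (LINT \<omega>|lborel. cnj (?u \<omega>) * ?v \<omega>)
      - ((LINT \<omega>|lborel. cnj (?v \<omega>) * ?u \<omega>) - (LINT \<omega>|lborel. cnj (?v \<omega>) * ?v \<omega>))"
    using int by (simp add: Bochner_Integration.integral_diff)
  also have "\<dots> = of_real (N \<xi> + N \<eta> - 2 * N ((\<xi> + \<eta>) / 2))"
    using pos by (simp add: line_inner_midpoint[OF f] N_def add.commute[of \<eta> \<xi>])
  finally have eq: "(l2_norm (\<lambda>\<omega>. ?u \<omega> - ?v \<omega>))\<^sup>2 = N \<xi> + N \<eta> - 2 * N ((\<xi> + \<eta>) / 2)"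
    by (simp only: of_real_eq_iff)
  show "l2 (\<lambda>\<omega>. ?u \<omega> - ?v \<omega>) = ennreal (N \<xi> + N \<eta> - 2 * N ((\<xi> + \<eta>) / 2))"
    using l2_eq_norm[OF dfin] eq by simp
  show "2 * N ((\<xi> + \<eta>) / 2) \<le> N \<xi> + N \<eta>"
    using eq zero_le_power2[of "l2_norm (\<lambda>\<omega>. ?u \<omega> - ?v \<omega>)"] by linarith
qed

lemma l2_norm_line_antimono:
  assumes f: "hardy_bound f M" and "0 < a" "a \<le> b"
  shows "(l2_norm (\<lambda>\<omega>. f (Complex b \<omega>)))\<^sup>2 \<le> (l2_norm (\<lambda>\<omega>. f (Complex a \<omega>)))\<^sup>2"
proof (rule midconvex_bounded_antimono[of "\<lambda>x. (l2_norm (\<lambda>\<omega>. f (Complex x \<omega>)))\<^sup>2" M])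
  fix x :: real assume "0 < x"
  then have "(l2_norm (\<lambda>\<omega>. f (Complex x \<omega>)))\<^sup>2 \<le> (sqrt M)\<^sup>2"
    by (intro power_mono hardy_boundD(3)[OF f]) auto
  then show "(l2_norm (\<lambda>\<omega>. f (Complex x \<omega>)))\<^sup>2 \<le> M"
    using f by (simp add: hardy_bound_def)
qed (use assms l2_line_diff(2)[OF f] in auto)

definition scalar_boundary :: "(complex \<Rightarrow> complex) \<Rightarrow> (real \<Rightarrow> complex) \<Rightarrow> bool" where
  "scalar_boundary f g \<longleftrightarrow> g \<in> borel_measurable lborel \<and>
     ((\<lambda>\<xi>. l2 (\<lambda>\<omega>. f (Complex \<xi> \<omega>) - g \<omega>)) \<longlongrightarrow> 0) (at_right 0)"

text \<open>The distance between two lines is controlled by how far \<open>N\<close> still is from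
  its supremum \<open>L\<close>. A sequence along which that gap shrinks geometrically produces a
  pointwise limit almost everywhere, and the limit is then compared with all lines.\<close>

lemma scalar_boundary_exists:
  assumes f: "hardy_bound f M"
  shows "\<exists>g. scalar_boundary f g"
proof -
  define N where "N = (\<lambda>x. (l2_norm (\<lambda>\<omega>. f (Complex x \<omega>)))\<^sup>2)"
  have N_anti: "N b \<le> N a" if "0 < a" "a \<le> b" for a b
    unfolding N_def using l2_norm_line_antimono[OF f that] .
  have N_le: "N x \<le> M" if "0 < x" for x
  proof -
    have "N x \<le> (sqrt M)\<^sup>2"
      unfolding N_def using that by (intro power_mono hardy_boundD(3)[OF f]) auto
    then show ?thesis using f by (simp add: hardy_bound_def)
  qed
  define L where "L = (SUP x\<in>{0<..}. N x)"
  have bdd: "bdd_above (N ` {0<..})" using N_le by (auto intro!: bdd_aboveI2)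
  have N_L: "N x \<le> L" if "0 < x" for x
    unfolding L_def using that bdd by (intro cSUP_upper) auto
  have L_approx: "\<exists>x>0. N x > L - e" if "e > 0" for e
  proof -
    have "L - e < (SUP x\<in>{0<..}. N x)" using that by (simp add: L_def)
    then show ?thesis using less_cSUP_iff[OF _ bdd, of "L - e"] by auto
  qed
  have diff: "l2 (\<lambda>\<omega>. f (Complex \<xi> \<omega>) - f (Complex \<eta> \<omega>)) \<le> ennreal (2 * (L - N \<xi>))"
    if "0 < \<eta>" "\<eta> \<le> \<xi>" for \<xi> \<eta>
  proof -
    \<comment> \<open>Here \<open>N \<eta> \<le> L\<close>, and the midpoint is at most
      \<open>\<xi>\<close>, so the value there is at least \<open>N \<xi>\<close>. This already
      bounds the left side by \<open>L - N \<xi>\<close>; the factor 2 is slack.\<close>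
    have "N \<xi> + N \<eta> - 2 * N ((\<xi> + \<eta>) / 2) \<le> 2 * (L - N \<xi>)"
      using N_L[of \<eta>] N_L[of \<xi>] N_anti[of "(\<xi> + \<eta>) / 2" \<xi>] that by simp
    then show ?thesis
      using l2_line_diff(1)[OF f, of \<xi> \<eta>] that by (simp add: N_def ennreal_leI)
  qed
  have "\<exists>x>0. N x > L - (1/4)^n" for n by (rule L_approx) simp
  then obtain x where x: "\<And>n. x n > 0" "\<And>n. N (x n) > L - (1/4)^n" by metis
  \<comment> \<open>Minima make \<open>y\<close> decreasing and, since \<open>N\<close> is
    nonincreasing, preserve the gap \<open>(1/4)^n\<close> attained at \<open>x n\<close>; the entry
    \<open>1 / real (Suc n)\<close> forces \<open>y\<close> to 0.\<close>
  define y where "y = (\<lambda>n. Min (insert (1 / real (Suc n)) (x ` {..n})))"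
  have y_pos: "y n > 0" for n using x(1) by (simp add: y_def)
  have y_dec: "y (Suc n) \<le> y n" for n
    unfolding y_def
  proof (rule Min.boundedI)
    fix a assume "a \<in> insert (1 / real (Suc n)) (x ` {..n})"
    then consider "a = 1 / real (Suc n)" | k where "k \<le> n" "a = x k" by auto
    then show "Min (insert (1 / real (Suc (Suc n))) (x ` {..Suc n})) \<le> a"
    proof cases
      case 1
      have "Min (insert (1 / real (Suc (Suc n))) (x ` {..Suc n})) \<le> 1 / real (Suc (Suc n))"
        by (intro Min_le) auto
      also have "\<dots> \<le> a" unfolding 1 by (intro divide_left_mono) auto
      finally show ?thesis .
    next
      case 2
      then show ?thesis by (intro Min_le) auto
    qed
  qed auto
  have y_le: "y n \<le> x n" "y n \<le> 1 / real (Suc n)" for n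
    unfolding y_def by (rule Min_le; simp)+
  have Ny: "N (y n) \<ge> L - (1/4)^n" for n
    using x(2)[of n] N_anti[OF y_pos[of n] y_le(1)] by linarith
  have meas_y[measurable]: "(\<lambda>\<omega>. f (Complex (y n) \<omega>)) \<in> borel_measurable lborel" for n
    using y_pos by (rule hardy_boundD(1)[OF f])
  have "l2 (\<lambda>\<omega>. f (Complex (y (Suc n)) \<omega>) - f (Complex (y n) \<omega>)) \<le> ennreal (2 * (1/4)^n)" for n
  proof -
    have "l2 (\<lambda>\<omega>. f (Complex (y (Suc n)) \<omega>) - f (Complex (y n) \<omega>)) \<le> ennreal (2 * (L - N (y n)))"
      by (subst l2_minus_commute) (rule diff[OF y_pos y_dec])
    also have "\<dots> \<le> ennreal (2 * (1/4)^n)"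
      using Ny[of n] by (intro ennreal_leI) simp
    finally show ?thesis .
  qed
  then have conv: "AE \<omega> in lborel. convergent (\<lambda>n. f (Complex (y n) \<omega>))"
    by (intro l2_Cauchy_AE_convergent[where C = 2]) auto
  \<comment> \<open>On the null set without convergence \<open>lim\<close> is an unspecified value;
    \<open>g\<close> is measurable on the whole line all the same.\<close>
  define g where "g = (\<lambda>\<omega>. lim (\<lambda>n. f (Complex (y n) \<omega>)))"
  have g_meas[measurable]: "g \<in> borel_measurable lborel"
    unfolding g_def by measurable
  have y_ev: "\<forall>\<^sub>F n in sequentially. y n \<le> \<xi>" if "\<xi> > 0" for \<xi>
  proof -
    have "(\<lambda>n. 1 / real (Suc n)) \<longlonglongrightarrow> 0" by (rule LIMSEQ_Suc[OF lim_1_over_n])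
    then have "\<forall>\<^sub>F n in sequentially. 1 / real (Suc n) < \<xi>"
      by (rule order_tendstoD(2)) (rule that)
    then show ?thesis
      by eventually_elim (use y_le(2) in \<open>meson le_less_trans less_imp_le\<close>)
  qed
  \<comment> \<open>The estimate \<open>diff\<close> is uniform in the smaller abscissa, so Fatou's
    lemma along \<open>y\<close> gives it for \<open>g\<close> and for every \<open>\<xi>\<close>,
    not only for members of the sequence.\<close>
  have close: "l2 (\<lambda>\<omega>. f (Complex \<xi> \<omega>) - g \<omega>) \<le> ennreal (2 * (L - N \<xi>))" if "\<xi> > 0" for \<xi>
  proof (rule l2_Fatou[where u = "\<lambda>n \<omega>. f (Complex \<xi> \<omega>) - f (Complex (y n) \<omega>)"])
    show "(\<lambda>\<omega>. f (Complex \<xi> \<omega>) - f (Complex (y n) \<omega>)) \<in> borel_measurable lborel" for n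
      using hardy_boundD(1)[OF f that] by measurable
    show "AE \<omega> in lborel. (\<lambda>n. f (Complex \<xi> \<omega>) - f (Complex (y n) \<omega>)) \<longlonglongrightarrow> f (Complex \<xi> \<omega>) - g \<omega>"
      using conv by eventually_elim (auto simp: g_def convergent_LIMSEQ_iff intro!: tendsto_intros)
    show "\<forall>\<^sub>F n in sequentially. l2 (\<lambda>\<omega>. f (Complex \<xi> \<omega>) - f (Complex (y n) \<omega>)) \<le> ennreal (2 * (L - N \<xi>))"
      using y_ev[OF that] by eventually_elim (rule diff[OF y_pos])
  qed
  have N_lim: "(N \<longlongrightarrow> L) (at_right 0)"
  proof (rule order_tendstoI)
    fix a assume "a < L"
    then obtain x0 where x0: "x0 > 0" "N x0 > a" using L_approx[of "L - a"] by auto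
    have "\<forall>\<^sub>F \<xi> in at_right 0. \<xi> \<in> {0<..<x0}" using x0(1) by (rule eventually_at_right_real)
    then show "\<forall>\<^sub>F \<xi> in at_right 0. a < N \<xi>"
      by eventually_elim (use x0(2) N_anti in \<open>auto intro: less_le_trans\<close>)
  next
    fix a assume "L < a"
    have "\<forall>\<^sub>F \<xi> in at_right (0::real). 0 < \<xi>" by (simp add: eventually_at_filter)
    then show "\<forall>\<^sub>F \<xi> in at_right 0. N \<xi> < a"
      by eventually_elim (use \<open>L < a\<close> N_L in \<open>auto intro: le_less_trans\<close>)
  qed
  have "((\<lambda>\<xi>. ennreal (2 * (L - N \<xi>))) \<longlongrightarrow> ennreal (2 * (L - L))) (at_right 0)"
    by (intro tendsto_ennrealI tendsto_intros N_lim)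
  then have upper: "((\<lambda>\<xi>. ennreal (2 * (L - N \<xi>))) \<longlongrightarrow> 0) (at_right 0)" by simp
  have "\<forall>\<^sub>F \<xi> in at_right (0::real). 0 < \<xi>" by (simp add: eventually_at_filter)
  then have "\<forall>\<^sub>F \<xi> in at_right 0. l2 (\<lambda>\<omega>. f (Complex \<xi> \<omega>) - g \<omega>) \<le> ennreal (2 * (L - N \<xi>))"
    by eventually_elim (rule close)
  then have "((\<lambda>\<xi>. l2 (\<lambda>\<omega>. f (Complex \<xi> \<omega>) - g \<omega>)) \<longlongrightarrow> 0) (at_right 0)"
    by (intro tendsto_sandwich[OF _ _ tendsto_const upper]) auto
  then show ?thesis using g_meas unfolding scalar_boundary_def by blast
qed

lemma eventually_at_right_0_pos: "\<forall>\<^sub>F \<xi> in at_right (0::real). 0 < \<xi>"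
  by (simp add: eventually_at_filter)

lemma scalar_boundary_l2_finite:
  assumes f: "hardy_bound f M" and g: "scalar_boundary f g"
  shows "l2 g < \<infinity>"
proof -
  have [measurable]: "g \<in> borel_measurable lborel" using g by (simp add: scalar_boundary_def)
  have "((\<lambda>\<xi>. l2 (\<lambda>\<omega>. f (Complex \<xi> \<omega>) - g \<omega>)) \<longlongrightarrow> 0) (at_right 0)"
    using g by (simp add: scalar_boundary_def)
  then have "\<forall>\<^sub>F \<xi> in at_right 0. l2 (\<lambda>\<omega>. f (Complex \<xi> \<omega>) - g \<omega>) < 1"
    by (rule order_tendstoD(2)) simp
  from eventually_conj[OF eventually_at_right_0_pos this]
  obtain \<xi> where \<xi>: "0 < \<xi>" "l2 (\<lambda>\<omega>. f (Complex \<xi> \<omega>) - g \<omega>) < 1"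
    using eventually_happens'[OF trivial_limit_at_right_real] by blast
  have dfin: "l2 (\<lambda>\<omega>. g \<omega> - f (Complex \<xi> \<omega>)) < \<infinity>"
    unfolding l2_minus_commute[of g] by (rule less_trans[OF \<xi>(2)]) simp
  note [measurable] = hardy_boundD(1)[OF f \<xi>(1)]
  have "l2 (\<lambda>\<omega>. f (Complex \<xi> \<omega>) + (g \<omega> - f (Complex \<xi> \<omega>)))
      \<le> 2 * l2 (\<lambda>\<omega>. f (Complex \<xi> \<omega>)) + 2 * l2 (\<lambda>\<omega>. g \<omega> - f (Complex \<xi> \<omega>))"
    by (rule l2_add_le) auto
  also have "\<dots> < \<infinity>"
    using hardy_boundD(2)[OF f \<xi>(1)] dfin by (simp add: ennreal_mult_less_top)
  finally show ?thesis by simp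
qed

text \<open>Holds for every choice of boundary functions, which makes the inner product accessible
  through the functions inside the half-plane.\<close>

lemma scalar_boundary_inner_tendsto:
  assumes f: "hardy_bound f M" and g: "scalar_boundary f g"
    and h: "hardy_bound h M'" and k: "scalar_boundary h k"
  shows "((\<lambda>\<xi>. LINT \<omega>|lborel. cnj (f (Complex \<xi> \<omega>)) * h (Complex \<xi> \<omega>)) \<longlongrightarrow>
          (LINT \<omega>|lborel. cnj (g \<omega>) * k \<omega>)) (at_right 0)"
proof -
  let ?f = "\<lambda>\<xi> \<omega>. f (Complex \<xi> \<omega>)" and ?h = "\<lambda>\<xi> \<omega>. h (Complex \<xi> \<omega>)"
  have [measurable]: "g \<in> borel_measurable lborel" "k \<in> borel_measurable lborel"
    using g k by (auto simp: scalar_boundary_def)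
  have fin: "l2 g < \<infinity>" "l2 k < \<infinity>"
    using scalar_boundary_l2_finite[OF f g] scalar_boundary_l2_finite[OF h k] by auto
  have norm_lim: "((\<lambda>\<xi>. l2_norm (\<lambda>\<omega>. u \<xi> \<omega>)) \<longlongrightarrow> 0) (at_right 0)"
    if "((\<lambda>\<xi>. l2 (\<lambda>\<omega>. u \<xi> \<omega>)) \<longlongrightarrow> 0) (at_right (0::real))" for u
  proof -
    have "((\<lambda>\<xi>. sqrt (enn2real (l2 (\<lambda>\<omega>. u \<xi> \<omega>)))) \<longlongrightarrow> sqrt 0) (at_right 0)"
      by (intro tendsto_real_sqrt tendsto_enn2real) (use that in auto)
    then show ?thesis by (simp add: l2_norm_def)
  qed
  have fg: "((\<lambda>\<xi>. l2_norm (\<lambda>\<omega>. ?f \<xi> \<omega> - g \<omega>)) \<longlongrightarrow> 0) (at_right 0)"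
    and hk: "((\<lambda>\<xi>. l2_norm (\<lambda>\<omega>. ?h \<xi> \<omega> - k \<omega>)) \<longlongrightarrow> 0) (at_right 0)"
    using g k by (auto intro: norm_lim simp: scalar_boundary_def)
  have fin_ev: "\<forall>\<^sub>F \<xi> in at_right 0. l2 (\<lambda>\<omega>. ?f \<xi> \<omega> - g \<omega>) < 1" "\<forall>\<^sub>F \<xi> in at_right 0. l2 (\<lambda>\<omega>. ?h \<xi> \<omega> - k \<omega>) < 1"
    using g k by (auto simp: scalar_boundary_def intro: order_tendstoD(2))
  have "((\<lambda>\<xi>. (LINT \<omega>|lborel. cnj (?f \<xi> \<omega>) * ?h \<xi> \<omega>) - (LINT \<omega>|lborel. cnj (g \<omega>) * k \<omega>)) \<longlongrightarrow> 0) (at_right 0)"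
  proof (rule Lim_null_comparison)
    show "((\<lambda>\<xi>. l2_norm (\<lambda>\<omega>. ?f \<xi> \<omega> - g \<omega>) * sqrt M' + l2_norm g * l2_norm (\<lambda>\<omega>. ?h \<xi> \<omega> - k \<omega>)) \<longlongrightarrow> 0) (at_right 0)"
      using tendsto_add[OF tendsto_mult[OF fg tendsto_const] tendsto_mult[OF tendsto_const hk]] by simp
    show "\<forall>\<^sub>F \<xi> in at_right 0. cmod ((LINT \<omega>|lborel. cnj (?f \<xi> \<omega>) * ?h \<xi> \<omega>) - (LINT \<omega>|lborel. cnj (g \<omega>) * k \<omega>))
        \<le> l2_norm (\<lambda>\<omega>. ?f \<xi> \<omega> - g \<omega>) * sqrt M' + l2_norm g * l2_norm (\<lambda>\<omega>. ?h \<xi> \<omega> - k \<omega>)"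
      using eventually_at_right_0_pos fin_ev
    proof eventually_elim
      fix \<xi> :: real
      assume \<xi>: "0 < \<xi>" and lt1: "l2 (\<lambda>\<omega>. ?f \<xi> \<omega> - g \<omega>) < 1" "l2 (\<lambda>\<omega>. ?h \<xi> \<omega> - k \<omega>) < 1"
      note [measurable] = hardy_boundD(1)[OF f \<xi>] hardy_boundD(1)[OF h \<xi>]
      note fin' = hardy_boundD(2)[OF f \<xi>] hardy_boundD(2)[OF h \<xi>]
      have lt: "l2 (\<lambda>\<omega>. ?f \<xi> \<omega> - g \<omega>) < \<infinity>" "l2 (\<lambda>\<omega>. ?h \<xi> \<omega> - k \<omega>) < \<infinity>"
        using lt1 less_trans[of _ 1 "\<infinity>::ennreal"] by auto
      have int: "integrable lborel (\<lambda>\<omega>. cnj (?f \<xi> \<omega>) * ?h \<xi> \<omega>)" "integrable lborel (\<lambda>\<omega>. cnj (g \<omega>) * k \<omega>)"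
        using fin fin' by (auto intro!: l2_prod_integrable(1))
      have p1: "integrable lborel (\<lambda>\<omega>. cnj (?f \<xi> \<omega> - g \<omega>) * ?h \<xi> \<omega>)"
        "cmod (LINT \<omega>|lborel. cnj (?f \<xi> \<omega> - g \<omega>) * ?h \<xi> \<omega>) \<le> l2_norm (\<lambda>\<omega>. cnj (?f \<xi> \<omega> - g \<omega>)) * l2_norm (?h \<xi>)"
        by (rule l2_prod_integrable; use lt fin' in \<open>simp only: l2_cnj | measurable\<close>)+
      have p2: "integrable lborel (\<lambda>\<omega>. cnj (g \<omega>) * (?h \<xi> \<omega> - k \<omega>))"
        "cmod (LINT \<omega>|lborel. cnj (g \<omega>) * (?h \<xi> \<omega> - k \<omega>)) \<le> l2_norm (\<lambda>\<omega>. cnj (g \<omega>)) * l2_norm (\<lambda>\<omega>. ?h \<xi> \<omega> - k \<omega>)"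
        by (rule l2_prod_integrable; use lt fin in \<open>simp only: l2_cnj | measurable\<close>)+
      have "(LINT \<omega>|lborel. cnj (?f \<xi> \<omega>) * ?h \<xi> \<omega>) - (LINT \<omega>|lborel. cnj (g \<omega>) * k \<omega>)
          = (LINT \<omega>|lborel. cnj (?f \<xi> \<omega>) * ?h \<xi> \<omega> - cnj (g \<omega>) * k \<omega>)"
        using int by simp
      \<comment> \<open>In this splitting the partner of each vanishing difference stays bounded:
        \<open>?h \<xi>\<close> by \<open>sqrt M'\<close>, and \<open>g\<close> because it does not
        depend on \<open>\<xi>\<close>.\<close>
      also have "\<dots> = (LINT \<omega>|lborel. cnj (?f \<xi> \<omega> - g \<omega>) * ?h \<xi> \<omega> + cnj (g \<omega>) * (?h \<xi> \<omega> - k \<omega>))"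
        by (intro Bochner_Integration.integral_cong) (simp_all add: algebra_simps)
      also have "\<dots> = (LINT \<omega>|lborel. cnj (?f \<xi> \<omega> - g \<omega>) * ?h \<xi> \<omega>) + (LINT \<omega>|lborel. cnj (g \<omega>) * (?h \<xi> \<omega> - k \<omega>))"
        by (rule Bochner_Integration.integral_add[OF p1(1) p2(1)])
      finally have "cmod ((LINT \<omega>|lborel. cnj (?f \<xi> \<omega>) * ?h \<xi> \<omega>) - (LINT \<omega>|lborel. cnj (g \<omega>) * k \<omega>))
          \<le> l2_norm (\<lambda>\<omega>. ?f \<xi> \<omega> - g \<omega>) * l2_norm (?h \<xi>) + l2_norm g * l2_norm (\<lambda>\<omega>. ?h \<xi> \<omega> - k \<omega>)"
        using p1(2) p2(2) unfolding l2_cnj by (simp add: norm_triangle_le)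
      also have "\<dots> \<le> l2_norm (\<lambda>\<omega>. ?f \<xi> \<omega> - g \<omega>) * sqrt M' + l2_norm g * l2_norm (\<lambda>\<omega>. ?h \<xi> \<omega> - k \<omega>)"
        by (intro add_right_mono mult_left_mono hardy_boundD(3)[OF h \<xi>] l2_norm_nonneg)
      finally show "cmod ((LINT \<omega>|lborel. cnj (?f \<xi> \<omega>) * ?h \<xi> \<omega>) - (LINT \<omega>|lborel. cnj (g \<omega>) * k \<omega>))
        \<le> l2_norm (\<lambda>\<omega>. ?f \<xi> \<omega> - g \<omega>) * sqrt M' + l2_norm g * l2_norm (\<lambda>\<omega>. ?h \<xi> \<omega> - k \<omega>)" .
    qed
  qed
  then show ?thesis by (simp add: LIM_zero_iff)
qed

section \<open>The Cauchy kernel and bounded point evaluation\<close>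

lemma nn_integral_inverse_square_le:
  fixes d c :: real
  assumes d: "d > 0"
  shows "(\<integral>\<^sup>+\<omega>. ennreal (1 / (d\<^sup>2 + (\<omega> - c)\<^sup>2)) \<partial>lborel) \<le> ennreal (pi / d)"
proof -
  let ?f = "\<lambda>\<omega>::real. 1 / (d\<^sup>2 + \<omega>\<^sup>2)"
  have [simp]: "d\<^sup>2 + \<omega>\<^sup>2 \<noteq> 0" "0 < d\<^sup>2 + \<omega>\<^sup>2" for \<omega> :: real
    using d zero_le_power2[of \<omega>] zero_less_power[of d 2] by linarith+
  have half: "(\<integral>\<^sup>+\<omega>. ennreal (?f \<omega>) * indicator {0..} \<omega> \<partial>lborel) = ennreal (pi / 2 / d - arctan (0 / d) / d)"
  proof (rule nn_integral_FTC_atLeast)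
    show "?f \<in> borel_measurable borel" by measurable
    show "((\<lambda>x. arctan (x / d) / d) has_real_derivative ?f x) (at x)" for x
    proof -
      have "d * (d * (d * d)) + d * (d * (x * x)) \<noteq> 0"
        using d by (intro less_imp_neq[symmetric] add_pos_nonneg) auto
      then show ?thesis
        using d by (auto intro!: derivative_eq_intros simp: field_simps power2_eq_square)
    qed
    show "0 \<le> ?f x" for x by simp
    have "filterlim (\<lambda>x. x / d) at_top at_top"
      using d by (auto simp: divide_inverse intro!: filterlim_at_top_mult_tendsto_pos[OF tendsto_const _ filterlim_ident])
    then have "((\<lambda>x. arctan (x / d)) \<longlongrightarrow> pi / 2) at_top"
      by (rule filterlim_compose[OF tendsto_arctan_at_top])
    then show "((\<lambda>x. arctan (x / d) / d) \<longlongrightarrow> pi / 2 / d) at_top"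
      by (intro tendsto_intros) (use d in auto)
  qed
  have "(\<integral>\<^sup>+\<omega>. ennreal (1 / (d\<^sup>2 + (\<omega> - c)\<^sup>2)) \<partial>lborel) = (\<integral>\<^sup>+\<omega>. ennreal (?f \<omega>) \<partial>lborel)"
    using nn_integral_real_affine[of "\<lambda>\<omega>. ennreal (1 / (d\<^sup>2 + (\<omega> - c)\<^sup>2))" 1 c] by simp
  \<comment> \<open>The two half-lines share the point 0, where the integrand is counted twice;
    hence an inequality.\<close>
  also have "\<dots> \<le> (\<integral>\<^sup>+\<omega>. ennreal (?f \<omega>) * indicator {0..} \<omega> + ennreal (?f (-\<omega>)) * indicator {0..} (-\<omega>) \<partial>lborel)"
    by (intro nn_integral_mono) (auto split: split_indicator)
  also have "\<dots> = (\<integral>\<^sup>+\<omega>. ennreal (?f \<omega>) * indicator {0..} \<omega> \<partial>lborel)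
      + (\<integral>\<^sup>+\<omega>. ennreal (?f (-\<omega>)) * indicator {0..} (-\<omega>) \<partial>lborel)"
    by (rule nn_integral_add) auto
  also have "(\<integral>\<^sup>+\<omega>. ennreal (?f (-\<omega>)) * indicator {0..} (-\<omega>) \<partial>lborel) = (\<integral>\<^sup>+\<omega>. ennreal (?f \<omega>) * indicator {0..} \<omega> \<partial>lborel)"
    using nn_integral_real_affine[of "\<lambda>\<omega>. ennreal (?f \<omega>) * indicator {0..} \<omega>" "-1" 0] by simp
  also have "(\<integral>\<^sup>+\<omega>. ennreal (?f \<omega>) * indicator {0..} \<omega> \<partial>lborel) + (\<integral>\<^sup>+\<omega>. ennreal (?f \<omega>) * indicator {0..} \<omega> \<partial>lborel) = ennreal (pi / d)"
    unfolding half using d by (subst ennreal_plus[symmetric]) auto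
  finally show ?thesis by simp
qed

lemma l2_Cauchy_kernel:
  assumes d: "d > 0" "\<bar>x - Re s\<bar> \<ge> d"
  shows "(\<lambda>\<omega>. 1 / (Complex x \<omega> - s)) \<in> borel_measurable lborel"
    and "l2 (\<lambda>\<omega>. 1 / (Complex x \<omega> - s)) \<le> ennreal (pi / d)"
proof -
  have ne: "Complex x \<omega> - s \<noteq> 0" for \<omega> using d by (auto simp: complex_eq_iff)
  have "continuous_on UNIV (\<lambda>\<omega>. 1 / (Complex x \<omega> - s))"
    by (intro continuous_intros) (use ne in \<open>auto simp: Complex_eq intro!: continuous_intros\<close>)
  then show "(\<lambda>\<omega>. 1 / (Complex x \<omega> - s)) \<in> borel_measurable lborel"
    by (simp add: borel_measurable_continuous_onI)
  have "l2 (\<lambda>\<omega>. 1 / (Complex x \<omega> - s)) \<le> (\<integral>\<^sup>+\<omega>. ennreal (1 / (d\<^sup>2 + (\<omega> - Im s)\<^sup>2)) \<partial>lborel)"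
    unfolding l2_def
  proof (intro nn_integral_mono ennreal_leI)
    fix \<omega>
    have "d\<^sup>2 \<le> (x - Re s)\<^sup>2" using power_mono[OF d(2), of 2] d(1) by simp
    then have "d\<^sup>2 + (\<omega> - Im s)\<^sup>2 \<le> (cmod (Complex x \<omega> - s))\<^sup>2" by (simp add: cmod_power2)
    moreover have "0 < d\<^sup>2 + (\<omega> - Im s)\<^sup>2" using d(1) by (simp add: add_pos_nonneg)
    ultimately show "(cmod (1 / (Complex x \<omega> - s)))\<^sup>2 \<le> 1 / (d\<^sup>2 + (\<omega> - Im s)\<^sup>2)"
      by (simp add: norm_divide power_divide frac_le)
  qed
  also have "\<dots> \<le> ennreal (pi / d)" by (rule nn_integral_inverse_square_le[OF d(1)])
  finally show "l2 (\<lambda>\<omega>. 1 / (Complex x \<omega> - s)) \<le> ennreal (pi / d)" .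
qed

text \<open>Each of the two lines at distance \<open>d\<close> from \<open>s\<close> contributes at
  most \<open>sqrt M * sqrt (pi / d)\<close>, by Cauchy-Schwarz against the kernel, and Cauchy's
  formula divides their sum by \<open>2 * pi\<close>. The condition \<open>d < Re s\<close> keeps
  the left line inside the half-plane.\<close>

lemma hardy_point_bound:
  assumes f: "hardy_bound f M" and d: "0 < d" "d < Re s"
  shows "cmod (f s) \<le> sqrt M * sqrt (pi / d) / pi"
proof -
  define a b where "a = Re s - d" and "b = Re s + d"
  have ab: "0 < a" "a < b" "a < Re s" "Re s < b" using d by (auto simp: a_def b_def)
  define h where "h = (\<lambda>z. f z / (z - s))"
  \<comment> \<open>From this height on, points are at distance at least 1 from the pole, and every
    rectangle reaching it winds once around \<open>s\<close>.\<close>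
  define T0 where "T0 = \<bar>Im s\<bar> + 1"
  let ?S = "{z. 0 < Re z}"
  have hol: "f holomorphic_on ?S" using f by (simp add: hardy_bound_def)
  have cont: "continuous_on (?S - {s}) h"
    unfolding h_def
    by (intro continuous_intros holomorphic_on_imp_continuous_on holomorphic_on_subset[OF hol]) auto
  have M: "M \<ge> 0" using f by (simp add: hardy_bound_def)
  have h_eq: "h (Complex x \<omega>) = f (Complex x \<omega>) * (1 / (Complex x \<omega> - s))" for x \<omega>
    by (simp add: h_def)
  have ker: "(\<lambda>\<omega>. 1 / (Complex x \<omega> - s)) \<in> borel_measurable lborel"
    "l2 (\<lambda>\<omega>. 1 / (Complex x \<omega> - s)) < \<infinity>" "l2_norm (\<lambda>\<omega>. 1 / (Complex x \<omega> - s)) \<le> sqrt (pi / d)"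
    if "x \<in> {a, b}" for x
  proof -
    have x: "\<bar>x - Re s\<bar> \<ge> d" using that d by (auto simp: a_def b_def)
    note k = l2_Cauchy_kernel[OF d(1) x]
    show "(\<lambda>\<omega>. 1 / (Complex x \<omega> - s)) \<in> borel_measurable lborel" by (rule k(1))
    show "l2 (\<lambda>\<omega>. 1 / (Complex x \<omega> - s)) < \<infinity>" using k(2) by (rule le_less_trans) simp
    show "l2_norm (\<lambda>\<omega>. 1 / (Complex x \<omega> - s)) \<le> sqrt (pi / d)"
      by (rule l2_norm_le) (use k(2) d(1) in auto)
  qed
  have line: "integrable lborel (\<lambda>\<omega>. h (Complex x \<omega>))"
    "cmod (LINT \<omega>|lborel. h (Complex x \<omega>)) \<le> sqrt M * sqrt (pi / d)" if "x \<in> {a, b}" for x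
  proof -
    have x: "0 < x" using that ab by auto
    note p = l2_prod_integrable[OF hardy_boundD(1)[OF f x] ker(1)[OF that] hardy_boundD(2)[OF f x] ker(2)[OF that]]
    show "integrable lborel (\<lambda>\<omega>. h (Complex x \<omega>))" unfolding h_eq by (rule p(1))
    have "cmod (LINT \<omega>|lborel. h (Complex x \<omega>)) \<le> l2_norm (\<lambda>\<omega>. f (Complex x \<omega>)) * l2_norm (\<lambda>\<omega>. 1 / (Complex x \<omega> - s))"
      unfolding h_eq by (rule p(2))
    also have "\<dots> \<le> sqrt M * sqrt (pi / d)"
      by (intro mult_mono hardy_boundD(3)[OF f x] ker(3)[OF that]) (use M in auto)
    finally show "cmod (LINT \<omega>|lborel. h (Complex x \<omega>)) \<le> sqrt M * sqrt (pi / d)" .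
  qed
  have "\<i> * ((LINT \<omega>|lborel. h (Complex b \<omega>)) - (LINT \<omega>|lborel. h (Complex a \<omega>))) = 2 * of_real pi * \<i> * f s"
  proof (rule strip_contour_shift[OF ab(2), where ?T0.0 = T0 and C = "M + 2 * pi"])
    show "0 < T0" by (simp add: T0_def)
    show "continuous_on {z. Re z \<in> {a, b}} h" "continuous_on {z. Re z \<in> {a..b} \<and> T0 \<le> \<bar>Im z\<bar>} h"
      by (rule continuous_on_subset[OF cont]; use ab in \<open>force simp: T0_def\<close>)+
    show "integrable lborel (\<lambda>\<omega>. h (Complex a \<omega>))" "integrable lborel (\<lambda>\<omega>. h (Complex b \<omega>))"
      using line(1) by auto
  next
    fix x assume x: "x \<in> {a..b}"
    then have x0: "0 < x" using ab by auto
    \<comment> \<open>Lines close to \<open>s\<close> admit no uniform bound on the norm of the full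
      kernel. Beyond \<open>T0\<close> one has \<open>(\<omega> - Im s)\<^sup>2 \<ge> 1\<close>, so
      the squared kernel is at most \<open>2 / (1 + (\<omega> - Im s)\<^sup>2)\<close>, of integral
      \<open>2 * pi\<close>; bounding the product by the sum of squares then gives
      \<open>M + 2 * pi\<close> for every line of the strip.\<close>
    note [measurable] = hardy_boundD(1)[OF f x0]
    have "(\<integral>\<^sup>+\<omega>. indicator {\<omega>. T0 \<le> \<bar>\<omega>\<bar>} \<omega> * ennreal (cmod (h (Complex x \<omega>))) \<partial>lborel)
        \<le> (\<integral>\<^sup>+\<omega>. ennreal ((cmod (f (Complex x \<omega>)))\<^sup>2) + 2 * ennreal (1 / (1\<^sup>2 + (\<omega> - Im s)\<^sup>2)) \<partial>lborel)"
    proof (rule nn_integral_mono)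
      fix \<omega>
      let ?A = "cmod (f (Complex x \<omega>))" and ?B = "1 / cmod (Complex x \<omega> - s)"
      have "?A * ?B \<le> ?A\<^sup>2 + 2 * (1 / (1\<^sup>2 + (\<omega> - Im s)\<^sup>2))" if "T0 \<le> \<bar>\<omega>\<bar>"
      proof -
        have "1 \<le> \<bar>\<omega> - Im s\<bar>" using that by (simp add: T0_def)
        then have 1: "1 \<le> (\<omega> - Im s)\<^sup>2" using power_mono[of 1 "\<bar>\<omega> - Im s\<bar>" 2] by simp
        have "(1 + u) / 2 \<le> v + u" if "1 \<le> u" "0 \<le> v" for u v :: real
          using that by simp
        from this[OF 1, of "(x - Re s)\<^sup>2"]
        have "(1 + (\<omega> - Im s)\<^sup>2) / 2 \<le> (cmod (Complex x \<omega> - s))\<^sup>2"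
          by (simp add: cmod_power2)
        then have "1 / (cmod (Complex x \<omega> - s))\<^sup>2 \<le> 1 / ((1 + (\<omega> - Im s)\<^sup>2) / 2)"
          using 1 by (intro divide_left_mono mult_pos_pos) auto
        then have "?B\<^sup>2 \<le> 2 * (1 / (1\<^sup>2 + (\<omega> - Im s)\<^sup>2))" by (simp add: power_divide)
        moreover have "?A * ?B \<le> ?A\<^sup>2 + ?B\<^sup>2"
        proof -
          have "u * v \<le> u\<^sup>2 + v\<^sup>2" if "0 \<le> u" "0 \<le> v" for u v :: real
            using sum_squares_bound[of u v] mult_nonneg_nonneg[OF that] unfolding mult.assoc by linarith
          from this[of ?A ?B] show ?thesis by simp
        qed
        ultimately show ?thesis by linarith
      qed
      then have "ennreal (?A * ?B) \<le> ennreal (?A\<^sup>2 + 2 * (1 / (1\<^sup>2 + (\<omega> - Im s)\<^sup>2)))" if "T0 \<le> \<bar>\<omega>\<bar>"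
        using that by (intro ennreal_leI) auto
      also have "ennreal (?A\<^sup>2 + 2 * (1 / (1\<^sup>2 + (\<omega> - Im s)\<^sup>2))) =
          ennreal (?A\<^sup>2) + 2 * ennreal (1 / (1\<^sup>2 + (\<omega> - Im s)\<^sup>2))"
        by (subst ennreal_plus; (subst ennreal_mult)?) simp_all
      finally show "indicator {\<omega>. T0 \<le> \<bar>\<omega>\<bar>} \<omega> * ennreal (cmod (h (Complex x \<omega>))) \<le>
          ennreal (?A\<^sup>2) + 2 * ennreal (1 / (1\<^sup>2 + (\<omega> - Im s)\<^sup>2))"
        by (auto simp: h_def norm_divide split: split_indicator)
    qed
    also have "\<dots> = l2 (\<lambda>\<omega>. f (Complex x \<omega>)) + 2 * (\<integral>\<^sup>+\<omega>. ennreal (1 / (1\<^sup>2 + (\<omega> - Im s)\<^sup>2)) \<partial>lborel)"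
      unfolding l2_def by (subst nn_integral_add) (auto simp: nn_integral_cmult)
    also have "\<dots> \<le> ennreal M + 2 * ennreal (pi / 1)"
      by (intro add_mono mult_left_mono nn_integral_inverse_square_le) (use f x0 in \<open>auto simp: hardy_bound_def\<close>)
    also have "\<dots> = ennreal (M + 2 * pi)"
      using M by (simp add: ennreal_mult)
    finally show "(\<integral>\<^sup>+\<omega>. indicator {\<omega>. T0 \<le> \<bar>\<omega>\<bar>} \<omega> * ennreal (cmod (h (Complex x \<omega>))) \<partial>lborel) \<le> ennreal (M + 2 * pi)" .
  next
    fix T assume T: "T0 \<le> T"
    let ?R = "rectpath (Complex a (-T)) (Complex b T)"
    have T': "\<bar>Im s\<bar> < T" using T by (simp add: T0_def)
    have sb: "s \<in> box (Complex a (-T)) (Complex b T)"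
      using ab T' by (auto simp: in_box_complex_iff)
    have "(h has_contour_integral (of_real (2 * pi) * \<i> * winding_number ?R s * f s)) ?R"
      unfolding h_def
    proof (rule Cauchy_integral_formula_convex_simple[OF _ hol])
      show "convex ?S" by (rule convex_halfspace_Re_gt)
      show "s \<in> interior ?S" using ab d by (simp add: interior_open open_right_half_plane)
      show "path_image ?R \<subseteq> ?S - {s}"
        using ab T' by (auto simp: path_image_rectpath)
    qed auto
    then have "(h has_contour_integral (2 * of_real pi * \<i> * f s)) ?R"
      using winding_number_rectpath[OF sb] by simp
    then show "contour_integral ?R h = 2 * of_real pi * \<i> * f s"
      by (rule contour_integral_unique)
  qed
  then have "2 * of_real pi * f s = (LINT \<omega>|lborel. h (Complex b \<omega>)) - (LINT \<omega>|lborel. h (Complex a \<omega>))"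
    by (metis (no_types, lifting) complex_i_not_zero mult.assoc mult.commute mult_left_cancel)
  then have "cmod (2 * of_real pi * f s) \<le> cmod (LINT \<omega>|lborel. h (Complex b \<omega>)) + cmod (LINT \<omega>|lborel. h (Complex a \<omega>))"
    by (simp add: norm_triangle_ineq4)
  also have "\<dots> \<le> 2 * (sqrt M * sqrt (pi / d))"
    using line(2)[of a] line(2)[of b] by simp
  finally have "pi * cmod (f s) \<le> sqrt M * sqrt (pi / d)"
    by (simp add: norm_mult)
  then show ?thesis by (simp add: field_simps)
qed

section \<open>The inner product of the Hardy space\<close>

lemma frob_norm_power2:
  assumes "A \<in> carrier_mat p m"
  shows "(frob_norm A)\<^sup>2 = (\<Sum>i<p. \<Sum>j<m. (cmod (A $$ (i, j)))\<^sup>2)"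
  using assms by (simp add: frob_norm_def sum_nonneg)

lemma nn_integral_frob_norm:
  assumes "\<And>\<omega>. G \<omega> \<in> carrier_mat p m"
    and "\<And>i j. i < p \<Longrightarrow> j < m \<Longrightarrow> (\<lambda>\<omega>. G \<omega> $$ (i, j)) \<in> borel_measurable lborel"
  shows "(\<integral>\<^sup>+\<omega>. ennreal ((frob_norm (G \<omega>))\<^sup>2) \<partial>lborel) = (\<Sum>i<p. \<Sum>j<m. l2 (\<lambda>\<omega>. G \<omega> $$ (i, j)))"
proof -
  have meas: "(\<lambda>\<omega>. ennreal ((cmod (G \<omega> $$ (i, j)))\<^sup>2)) \<in> borel_measurable lborel" if "i < p" "j < m" for i j
    using assms(2)[OF that] by measurable
  have "(\<integral>\<^sup>+\<omega>. ennreal ((frob_norm (G \<omega>))\<^sup>2) \<partial>lborel)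
      = (\<integral>\<^sup>+\<omega>. (\<Sum>i<p. \<Sum>j<m. ennreal ((cmod (G \<omega> $$ (i, j)))\<^sup>2)) \<partial>lborel)"
    by (simp add: frob_norm_power2[OF assms(1)] sum_nonneg)
  also have "\<dots> = (\<Sum>i<p. \<integral>\<^sup>+\<omega>. (\<Sum>j<m. ennreal ((cmod (G \<omega> $$ (i, j)))\<^sup>2)) \<partial>lborel)"
    by (rule nn_integral_sum, rule borel_measurable_sum, rule meas) auto
  also have "\<dots> = (\<Sum>i<p. \<Sum>j<m. l2 (\<lambda>\<omega>. G \<omega> $$ (i, j)))"
    unfolding l2_def by (intro sum.cong refl nn_integral_sum meas) auto
  finally show ?thesis .
qed

lemma mat_trace_adjoint_mult:
  assumes "A \<in> carrier_mat p m" "B \<in> carrier_mat p m"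
  shows "mat_trace (mat_adjoint A * B) = (\<Sum>i<p. \<Sum>j<m. cnj (A $$ (i, j)) * B $$ (i, j))"
proof -
  have "mat_trace (mat_adjoint A * B) = (\<Sum>j<m. \<Sum>i<p. cnj (A $$ (i, j)) * B $$ (i, j))"
    using assms by (auto simp: mat_trace_def mat_adjoint_def mat_of_rows_def times_mat_def scalar_prod_def
        conjugate_complex_def lessThan_atLeast0 intro!: sum.cong)
  then show ?thesis by (subst sum.swap)
qed

lemma hardy_bound_mono: "hardy_bound f M \<Longrightarrow> M \<le> M' \<Longrightarrow> hardy_bound f M'"
  by (auto simp: hardy_bound_def intro: order_trans ennreal_leI)

text \<open>Reduces the matrix-valued space to its entries: there are finitely many, so a bound on
  the Frobenius norms amounts to one common bound for all entries.\<close>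

lemma hardy2_iff:
  "F \<in> hardy2 p m \<longleftrightarrow> (\<forall>s. F s \<in> carrier_mat p m) \<and> (\<forall>s. Re s \<le> 0 \<longrightarrow> F s = 0\<^sub>m p m) \<and>
     (\<exists>M. \<forall>i<p. \<forall>j<m. hardy_bound (\<lambda>s. F s $$ (i, j)) M)" (is "?L \<longleftrightarrow> ?C \<and> ?Z \<and> ?B")
proof -
  let ?S = "SUP \<xi>\<in>{0<..}. \<integral>\<^sup>+ \<omega>. ennreal ((frob_norm (F (Complex \<xi> \<omega>)))\<^sup>2) \<partial>lborel"
  let ?hol = "\<forall>i<p. \<forall>j<m. (\<lambda>s. F s $$ (i, j)) holomorphic_on {s. Re s > 0}"
  have int: "(\<integral>\<^sup>+ \<omega>. ennreal ((frob_norm (F (Complex \<xi> \<omega>)))\<^sup>2) \<partial>lborel)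
      = (\<Sum>i<p. \<Sum>j<m. l2 (\<lambda>\<omega>. F (Complex \<xi> \<omega>) $$ (i, j)))" if "?C" "?hol" "\<xi> > 0" for \<xi>
    using that by (intro nn_integral_frob_norm
        borel_measurable_vertical_line[where f = "\<lambda>s. F s $$ (i, j)" for i j]
        holomorphic_on_imp_continuous_on) auto
  have "?S < \<infinity> \<longleftrightarrow> ?B" if C: "?C" and hol: "?hol"
  proof
    assume fin: "?S < \<infinity>"
    then obtain M where M: "?S = ennreal M" "M \<ge> 0" by (cases ?S) auto
    have "l2 (\<lambda>\<omega>. F (Complex \<xi> \<omega>) $$ (i, j)) \<le> ennreal M" if "\<xi> > 0" "i < p" "j < m" for \<xi> i j
    proof -
      have "l2 (\<lambda>\<omega>. F (Complex \<xi> \<omega>) $$ (i, j)) \<le> (\<Sum>j<m. l2 (\<lambda>\<omega>. F (Complex \<xi> \<omega>) $$ (i, j)))"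
        using that by (intro member_le_sum) auto
      also have "\<dots> \<le> (\<Sum>i<p. \<Sum>j<m. l2 (\<lambda>\<omega>. F (Complex \<xi> \<omega>) $$ (i, j)))"
        using that by (intro member_le_sum[of i "{..<p}" "\<lambda>i. \<Sum>j<m. l2 (\<lambda>\<omega>. F (Complex \<xi> \<omega>) $$ (i, j))"]) auto
      also have "\<dots> = (\<integral>\<^sup>+ \<omega>. ennreal ((frob_norm (F (Complex \<xi> \<omega>)))\<^sup>2) \<partial>lborel)"
        using int[OF C hol that(1)] by simp
      also have "\<dots> \<le> ?S" using that by (intro SUP_upper) auto
      finally show ?thesis unfolding M(1) .
    qed
    then show ?B using M(2) hol by (auto simp: hardy_bound_def)
  next
    assume ?B
    then obtain M where M: "\<And>i j. i < p \<Longrightarrow> j < m \<Longrightarrow> hardy_bound (\<lambda>s. F s $$ (i, j)) M" by blast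
    have "?S \<le> (\<Sum>i<p. \<Sum>j<m. ennreal M)"
    proof (rule SUP_least)
      fix \<xi> :: real assume "\<xi> \<in> {0<..}"
      then have \<xi>: "\<xi> > 0" by simp
      show "(\<integral>\<^sup>+ \<omega>. ennreal ((frob_norm (F (Complex \<xi> \<omega>)))\<^sup>2) \<partial>lborel) \<le> (\<Sum>i<p. \<Sum>j<m. ennreal M)"
        unfolding int[OF C hol \<xi>] using M \<xi> by (intro sum_mono) (auto simp: hardy_bound_def)
    qed
    also have "\<dots> < \<infinity>" by (simp add: ennreal_mult_less_top of_nat_less_top)
    finally show "?S < \<infinity>" .
  qed
  moreover have "?hol" if "?B" using that by (auto simp: hardy_bound_def)
  ultimately show ?thesis unfolding hardy2_def mem_Collect_eq by blast
qed

lemma hardy2D: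
  assumes "F \<in> hardy2 p m"
  shows hardy2_carrier: "F s \<in> carrier_mat p m"
    and hardy2_zero: "Re s \<le> 0 \<Longrightarrow> F s = 0\<^sub>m p m"
    and hardy2_obtain_bound: "\<exists>M. \<forall>i<p. \<forall>j<m. hardy_bound (\<lambda>s. F s $$ (i, j)) M"
  using assms unfolding hardy2_iff by auto

lemma hardy2_line:
  assumes F: "F \<in> hardy2 p m" and ij: "i < p" "j < m" and \<xi>: "0 < \<xi>"
  shows "(\<lambda>\<omega>. F (Complex \<xi> \<omega>) $$ (i, j)) \<in> borel_measurable lborel"
    and "l2 (\<lambda>\<omega>. F (Complex \<xi> \<omega>) $$ (i, j)) < \<infinity>"
  using hardy2_obtain_bound[OF F] ij hardy_boundD(1,2)[OF _ \<xi>, of "\<lambda>s. F s $$ (i, j)"] by blast+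

lemma hardy2_entry_holomorphic:
  assumes "F \<in> hardy2 p m" "i < p" "j < m"
  shows "(\<lambda>s. F s $$ (i, j)) holomorphic_on {s. Re s > 0}"
  using assms by (auto simp: hardy2_def)

text \<open>The scalar boundary functions are assembled into a matrix; existence guarantees that the
  choice operator picks a genuine boundary function.\<close>

lemma boundary_fun_exists:
  assumes F: "F \<in> hardy2 p m"
  shows "is_boundary_fun p m F (boundary_fun p m F)"
proof -
  obtain M where M: "\<And>i j. i < p \<Longrightarrow> j < m \<Longrightarrow> hardy_bound (\<lambda>s. F s $$ (i, j)) M"
    using hardy2_obtain_bound[OF F] by blast
  then have "\<exists>g. scalar_boundary (\<lambda>s. F s $$ (i, j)) g" if "i < p" "j < m" for i j
    using that scalar_boundary_exists by blast
  then obtain g where g: "\<And>i j. i < p \<Longrightarrow> j < m \<Longrightarrow> scalar_boundary (\<lambda>s. F s $$ (i, j)) (g i j)"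
    by metis
  define G where "G = (\<lambda>\<omega>. mat p m (\<lambda>(i, j). g i j \<omega>))"
  have G_meas: "(\<lambda>\<omega>. G \<omega> $$ (i, j)) \<in> borel_measurable lborel" if "i < p" "j < m" for i j
    using g[OF that] that by (simp add: G_def scalar_boundary_def)
  have "((\<lambda>\<xi>. \<integral>\<^sup>+ \<omega>. ennreal ((frob_norm (F (Complex \<xi> \<omega>) - G \<omega>))\<^sup>2) \<partial>lborel) \<longlongrightarrow> 0) (at_right 0)"
  proof (rule Lim_transform_eventually)
    have "((\<lambda>\<xi>. \<Sum>i<p. \<Sum>j<m. l2 (\<lambda>\<omega>. F (Complex \<xi> \<omega>) $$ (i, j) - g i j \<omega>)) \<longlongrightarrow> (\<Sum>i<p. \<Sum>j<m. 0)) (at_right 0)"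
      using g by (intro tendsto_sum) (auto simp: scalar_boundary_def)
    then show "((\<lambda>\<xi>. \<Sum>i<p. \<Sum>j<m. l2 (\<lambda>\<omega>. F (Complex \<xi> \<omega>) $$ (i, j) - g i j \<omega>)) \<longlongrightarrow> 0) (at_right 0)"
      by simp
    show "\<forall>\<^sub>F \<xi> in at_right 0. (\<Sum>i<p. \<Sum>j<m. l2 (\<lambda>\<omega>. F (Complex \<xi> \<omega>) $$ (i, j) - g i j \<omega>)) =
        (\<integral>\<^sup>+ \<omega>. ennreal ((frob_norm (F (Complex \<xi> \<omega>) - G \<omega>))\<^sup>2) \<partial>lborel)"
      using eventually_at_right_0_pos
    proof eventually_elim
      fix \<xi> :: real assume \<xi>: "0 < \<xi>"
      have e: "(F (Complex \<xi> \<omega>) - G \<omega>) $$ (i, j) = F (Complex \<xi> \<omega>) $$ (i, j) - g i j \<omega>" if "i < p" "j < m" for i j \<omega>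
        using that by (simp add: G_def)
      have "(\<integral>\<^sup>+ \<omega>. ennreal ((frob_norm (F (Complex \<xi> \<omega>) - G \<omega>))\<^sup>2) \<partial>lborel)
          = (\<Sum>i<p. \<Sum>j<m. l2 (\<lambda>\<omega>. (F (Complex \<xi> \<omega>) - G \<omega>) $$ (i, j)))"
      proof (rule nn_integral_frob_norm)
        show "F (Complex \<xi> \<omega>) - G \<omega> \<in> carrier_mat p m" for \<omega> by (simp add: G_def minus_carrier_mat)
        show "(\<lambda>\<omega>. (F (Complex \<xi> \<omega>) - G \<omega>) $$ (i, j)) \<in> borel_measurable lborel" if "i < p" "j < m" for i j
          using borel_measurable_diff[OF hardy2_line(1)[OF F that \<xi>], of "g i j"] g[OF that]
          unfolding e[OF that] scalar_boundary_def by blast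
      qed
      then show "(\<Sum>i<p. \<Sum>j<m. l2 (\<lambda>\<omega>. F (Complex \<xi> \<omega>) $$ (i, j) - g i j \<omega>)) =
        (\<integral>\<^sup>+ \<omega>. ennreal ((frob_norm (F (Complex \<xi> \<omega>) - G \<omega>))\<^sup>2) \<partial>lborel)"
        by (simp add: e)
    qed
  qed
  then have "is_boundary_fun p m F G"
    using G_meas by (auto simp: is_boundary_fun_def G_def)
  then show ?thesis unfolding boundary_fun_def by (rule someI[of "is_boundary_fun p m F"])
qed

lemma boundary_fun_entry:
  assumes F: "F \<in> hardy2 p m" and ij: "i < p" "j < m"
  shows "scalar_boundary (\<lambda>s. F s $$ (i, j)) (\<lambda>\<omega>. boundary_fun p m F \<omega> $$ (i, j))"
proof -
  let ?g = "boundary_fun p m F"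
  have g: "\<And>\<omega>. ?g \<omega> \<in> carrier_mat p m"
    "\<And>i j. i < p \<Longrightarrow> j < m \<Longrightarrow> (\<lambda>\<omega>. ?g \<omega> $$ (i, j)) \<in> borel_measurable lborel"
    "((\<lambda>\<xi>. \<integral>\<^sup>+ \<omega>. ennreal ((frob_norm (F (Complex \<xi> \<omega>) - ?g \<omega>))\<^sup>2) \<partial>lborel) \<longlongrightarrow> 0) (at_right 0)"
    using boundary_fun_exists[OF F] by (auto simp: is_boundary_fun_def)
  have "l2 (\<lambda>\<omega>. F (Complex \<xi> \<omega>) $$ (i, j) - ?g \<omega> $$ (i, j))
      \<le> (\<integral>\<^sup>+ \<omega>. ennreal ((frob_norm (F (Complex \<xi> \<omega>) - ?g \<omega>))\<^sup>2) \<partial>lborel)" for \<xi>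
    unfolding l2_def
  proof (intro nn_integral_mono ennreal_leI)
    fix \<omega>
    let ?A = "F (Complex \<xi> \<omega>) - ?g \<omega>"
    have "(cmod (?A $$ (i, j)))\<^sup>2 \<le> (\<Sum>j<m. (cmod (?A $$ (i, j)))\<^sup>2)"
      using ij by (intro member_le_sum) auto
    also have "\<dots> \<le> (\<Sum>i<p. \<Sum>j<m. (cmod (?A $$ (i, j)))\<^sup>2)"
      using ij by (intro member_le_sum[of i "{..<p}" "\<lambda>i. \<Sum>j<m. (cmod (?A $$ (i, j)))\<^sup>2"]) (auto intro: sum_nonneg)
    also have "\<dots> = (frob_norm ?A)\<^sup>2"
      using g(1) by (intro frob_norm_power2[symmetric] minus_carrier_mat)
    also have "?A $$ (i, j) = F (Complex \<xi> \<omega>) $$ (i, j) - ?g \<omega> $$ (i, j)"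
      using g(1)[of \<omega>] ij by simp
    finally show "(cmod (F (Complex \<xi> \<omega>) $$ (i, j) - ?g \<omega> $$ (i, j)))\<^sup>2 \<le> (frob_norm ?A)\<^sup>2" .
  qed
  then have "((\<lambda>\<xi>. l2 (\<lambda>\<omega>. F (Complex \<xi> \<omega>) $$ (i, j) - ?g \<omega> $$ (i, j))) \<longlongrightarrow> 0) (at_right 0)"
    by (intro tendsto_sandwich[OF _ _ tendsto_const g(3)]) auto
  then show ?thesis using g(2)[OF ij] unfolding scalar_boundary_def by blast
qed

text \<open>The inner product taken on the line \<open>Re z = \<xi>\<close> and without
  \<open>1 / (2 * pi)\<close>; it involves no choice.\<close>

definition line_inner ::
    "nat \<Rightarrow> nat \<Rightarrow> (complex \<Rightarrow> complex mat) \<Rightarrow> (complex \<Rightarrow> complex mat) \<Rightarrow> real \<Rightarrow> complex" where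
  "line_inner p m F G \<xi> =
     (\<Sum>i<p. \<Sum>j<m. LINT \<omega>|lborel. cnj (F (Complex \<xi> \<omega>) $$ (i, j)) * G (Complex \<xi> \<omega>) $$ (i, j))"

lemma line_inner_integrable:
  assumes "F \<in> hardy2 p m" "G \<in> hardy2 p m" "i < p" "j < m" "0 < \<xi>"
  shows "integrable lborel (\<lambda>\<omega>. cnj (F (Complex \<xi> \<omega>) $$ (i, j)) * G (Complex \<xi> \<omega>) $$ (i, j))"
  by (rule l2_prod_integrable(1)) (use assms hardy2_line in \<open>auto intro!: borel_measurable_cnj\<close>)

text \<open>Gateway to all laws below: an identity is checked for \<open>line_inner\<close> at
  \<open>\<xi> > 0\<close> and transferred by uniqueness of limits, with no comparison of chosen
  boundary functions up to null sets.\<close>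

lemma h2_inner_tendsto:
  assumes F: "F \<in> hardy2 p m" and G: "G \<in> hardy2 p m"
  shows "((\<lambda>\<xi>. of_real (1 / (2 * pi)) * line_inner p m F G \<xi>) \<longlongrightarrow> h2_inner p m F G) (at_right 0)"
proof -
  let ?f = "boundary_fun p m F" and ?g = "boundary_fun p m G"
  obtain M M' where M: "\<And>i j. i < p \<Longrightarrow> j < m \<Longrightarrow> hardy_bound (\<lambda>s. F s $$ (i, j)) M"
    and M': "\<And>i j. i < p \<Longrightarrow> j < m \<Longrightarrow> hardy_bound (\<lambda>s. G s $$ (i, j)) M'"
    using hardy2_obtain_bound[OF F] hardy2_obtain_bound[OF G] by blast
  have int: "integrable lborel (\<lambda>\<omega>. cnj (?f \<omega> $$ (i, j)) * ?g \<omega> $$ (i, j))" if "i < p" "j < m" for i j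
  proof -
    note bf = boundary_fun_entry[OF F that] and bg = boundary_fun_entry[OF G that]
    show ?thesis
      by (rule l2_prod_integrable(1))
        (use bf bg scalar_boundary_l2_finite[OF M[OF that] bf] scalar_boundary_l2_finite[OF M'[OF that] bg]
          in \<open>auto simp: scalar_boundary_def intro!: borel_measurable_cnj\<close>)
  qed
  have c: "?f \<omega> \<in> carrier_mat p m" "?g \<omega> \<in> carrier_mat p m" for \<omega>
    using boundary_fun_exists[OF F] boundary_fun_exists[OF G] by (auto simp: is_boundary_fun_def)
  have "(LINT \<omega>|lborel. mat_trace (mat_adjoint (?f \<omega>) * ?g \<omega>))
      = (LINT \<omega>|lborel. (\<Sum>i<p. \<Sum>j<m. cnj (?f \<omega> $$ (i, j)) * ?g \<omega> $$ (i, j)))"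
    by (intro Bochner_Integration.integral_cong refl mat_trace_adjoint_mult c)
  also have "\<dots> = (\<Sum>i<p. \<Sum>j<m. LINT \<omega>|lborel. cnj (?f \<omega> $$ (i, j)) * ?g \<omega> $$ (i, j))"
    by (subst Bochner_Integration.integral_sum,
        (intro Bochner_Integration.integrable_sum int; simp),
        intro sum.cong refl Bochner_Integration.integral_sum int) auto
  finally have eq: "h2_inner p m F G = of_real (1 / (2 * pi)) * (\<Sum>i<p. \<Sum>j<m. LINT \<omega>|lborel. cnj (?f \<omega> $$ (i, j)) * ?g \<omega> $$ (i, j))"
    by (simp add: h2_inner_def)
  show ?thesis
    unfolding eq line_inner_def
    by (intro tendsto_mult tendsto_const tendsto_sum scalar_boundary_inner_tendsto[OF M _ M'] boundary_fun_entry F G) auto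
qed

lemma h2_inner_unique:
  assumes "F \<in> hardy2 p m" "G \<in> hardy2 p m"
    and "((\<lambda>\<xi>. of_real (1 / (2 * pi)) * line_inner p m F G \<xi>) \<longlongrightarrow> c) (at_right 0)"
  shows "h2_inner p m F G = c"
  using tendsto_unique[OF trivial_limit_at_right_real h2_inner_tendsto[OF assms(1,2)] assms(3)] .

section \<open>Vector space operations on the Hardy space\<close>

lemma hardy_bound_add:
  assumes "hardy_bound f M" "hardy_bound g M'"
  shows "hardy_bound (\<lambda>s. f s + g s) (2 * M + 2 * M')"
  unfolding hardy_bound_def
proof (intro conjI allI impI)
  show "(\<lambda>s. f s + g s) holomorphic_on {s. 0 < Re s}" "0 \<le> 2 * M + 2 * M'"
    using assms by (auto simp: hardy_bound_def intro!: holomorphic_intros)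
  fix \<xi> :: real assume \<xi>: "0 < \<xi>"
  have "l2 (\<lambda>\<omega>. f (Complex \<xi> \<omega>) + g (Complex \<xi> \<omega>)) \<le> 2 * l2 (\<lambda>\<omega>. f (Complex \<xi> \<omega>)) + 2 * l2 (\<lambda>\<omega>. g (Complex \<xi> \<omega>))"
    by (rule l2_add_le[OF hardy_boundD(1)[OF assms(1) \<xi>] hardy_boundD(1)[OF assms(2) \<xi>]])
  also have "\<dots> \<le> 2 * ennreal M + 2 * ennreal M'"
    using assms \<xi> by (intro add_mono mult_left_mono) (auto simp: hardy_bound_def)
  also have "\<dots> = ennreal (2 * M + 2 * M')"
    using assms by (simp add: hardy_bound_def ennreal_mult)
  finally show "l2 (\<lambda>\<omega>. f (Complex \<xi> \<omega>) + g (Complex \<xi> \<omega>)) \<le> ennreal (2 * M + 2 * M')" .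
qed

lemma hardy_bound_cmult:
  assumes "hardy_bound f M"
  shows "hardy_bound (\<lambda>s. a * f s) ((cmod a)\<^sup>2 * M)"
  unfolding hardy_bound_def
proof (intro conjI allI impI)
  show "(\<lambda>s. a * f s) holomorphic_on {s. 0 < Re s}" "0 \<le> (cmod a)\<^sup>2 * M"
    using assms by (auto simp: hardy_bound_def intro!: holomorphic_intros)
  fix \<xi> :: real assume \<xi>: "0 < \<xi>"
  note [measurable] = hardy_boundD(1)[OF assms \<xi>]
  have "l2 (\<lambda>\<omega>. a * f (Complex \<xi> \<omega>)) = ennreal ((cmod a)\<^sup>2) * l2 (\<lambda>\<omega>. f (Complex \<xi> \<omega>))"
    unfolding l2_def by (subst nn_integral_cmult[symmetric]) (auto simp: norm_mult power_mult_distrib ennreal_mult)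
  also have "\<dots> \<le> ennreal ((cmod a)\<^sup>2) * ennreal M"
    using assms \<xi> by (intro mult_left_mono) (auto simp: hardy_bound_def)
  also have "\<dots> = ennreal ((cmod a)\<^sup>2 * M)"
    using assms by (simp add: hardy_bound_def ennreal_mult)
  finally show "l2 (\<lambda>\<omega>. a * f (Complex \<xi> \<omega>)) \<le> ennreal ((cmod a)\<^sup>2 * M)" .
qed

text \<open>Addition of matrices takes its dimensions from the second operand, which explains the
  one-sided hypothesis.\<close>

lemma hardy2_entry_add:
  assumes "G \<in> hardy2 p m" "i < p" "j < m"
  shows "(F + G) s $$ (i, j) = F s $$ (i, j) + G s $$ (i, j)"
  using hardy2_carrier[OF assms(1), of s] assms(2,3) by simp

lemma hardy2_entry_scale:
  assumes "F \<in> hardy2 p m" "i < p" "j < m"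
  shows "scale_fun a F s $$ (i, j) = a * F s $$ (i, j)"
  using hardy2_carrier[OF assms(1), of s] assms(2,3) by (simp add: scale_fun_def)

lemma hardy2_add:
  assumes F: "F \<in> hardy2 p m" and G: "G \<in> hardy2 p m"
  shows "F + G \<in> hardy2 p m"
proof -
  obtain M M' where M: "\<And>i j. i < p \<Longrightarrow> j < m \<Longrightarrow> hardy_bound (\<lambda>s. F s $$ (i, j)) M"
    and M': "\<And>i j. i < p \<Longrightarrow> j < m \<Longrightarrow> hardy_bound (\<lambda>s. G s $$ (i, j)) M'"
    using hardy2_obtain_bound[OF F] hardy2_obtain_bound[OF G] by blast
  have "hardy_bound (\<lambda>s. (F + G) s $$ (i, j)) (2 * M + 2 * M')" if "i < p" "j < m" for i j
    unfolding hardy2_entry_add[OF G that] by (rule hardy_bound_add[OF M[OF that] M'[OF that]])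
  moreover have "(F + G) s \<in> carrier_mat p m" for s
    using hardy2_carrier[OF F] hardy2_carrier[OF G] by simp
  moreover have "(F + G) s = 0\<^sub>m p m" if "Re s \<le> 0" for s
    using hardy2_zero[OF F that] hardy2_zero[OF G that] by simp
  ultimately show ?thesis unfolding hardy2_iff by blast
qed

lemma hardy2_scale:
  assumes F: "F \<in> hardy2 p m"
  shows "scale_fun a F \<in> hardy2 p m"
proof -
  obtain M where M: "\<And>i j. i < p \<Longrightarrow> j < m \<Longrightarrow> hardy_bound (\<lambda>s. F s $$ (i, j)) M"
    using hardy2_obtain_bound[OF F] by blast
  have "hardy_bound (\<lambda>s. scale_fun a F s $$ (i, j)) ((cmod a)\<^sup>2 * M)" if "i < p" "j < m" for i j
    unfolding hardy2_entry_scale[OF F that] by (rule hardy_bound_cmult[OF M[OF that]])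
  moreover have "scale_fun a F s \<in> carrier_mat p m" for s
    using hardy2_carrier[OF F] by (simp add: scale_fun_def)
  moreover have "scale_fun a F s = 0\<^sub>m p m" if "Re s \<le> 0" for s
    using hardy2_zero[OF F that] by (auto simp: scale_fun_def)
  ultimately show ?thesis unfolding hardy2_iff by blast
qed

lemma hardy2_zero_fun: "zero_fun p m \<in> hardy2 p m"
proof -
  have "hardy_bound (\<lambda>s. zero_fun p m s $$ (i, j)) 0" if "i < p" "j < m" for i j
    using that by (simp add: zero_fun_def hardy_bound_def l2_def)
  then show ?thesis unfolding hardy2_iff by (auto simp: zero_fun_def)
qed

lemma hardy2_ext:
  assumes "F \<in> hardy2 p m" "G \<in> hardy2 p m"
    and "\<And>s i j. Re s > 0 \<Longrightarrow> i < p \<Longrightarrow> j < m \<Longrightarrow> F s $$ (i, j) = G s $$ (i, j)"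
  shows "F = G"
proof
  fix s show "F s = G s"
  proof (cases "Re s > 0")
    case True
    then show ?thesis
      using assms(3) hardy2_carrier[OF assms(1), of s] hardy2_carrier[OF assms(2), of s] by (intro eq_matI) auto
  next
    case False
    then show ?thesis using hardy2_zero[OF assms(1)] hardy2_zero[OF assms(2)] by simp
  qed
qed

text \<open>Matrices of all dimensions share one type and so form no group; differences are reduced
  to sums and scalar multiples, for which closure and linearity are proved.\<close>

lemma hardy2_diff_eq:
  assumes "F \<in> hardy2 p m" "G \<in> hardy2 p m"
  shows "F - G = F + scale_fun (-1) G"
proof
  fix s show "(F - G) s = (F + scale_fun (-1) G) s"
    using hardy2_carrier[OF assms(1), of s] hardy2_carrier[OF assms(2), of s]
    by (intro eq_matI) (auto simp: scale_fun_def)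
qed

lemma hardy2_diff: "F \<in> hardy2 p m \<Longrightarrow> G \<in> hardy2 p m \<Longrightarrow> F - G \<in> hardy2 p m"
  by (simp add: hardy2_diff_eq hardy2_add hardy2_scale)

lemma hardy2_uminus_eq:
  assumes "F \<in> hardy2 p m"
  shows "- F = scale_fun (-1) F"
proof
  fix s show "(- F) s = scale_fun (-1) F s"
    using hardy2_carrier[OF assms(1), of s] by (intro eq_matI) (auto simp: scale_fun_def)
qed

section \<open>Sesquilinearity and definiteness\<close>

lemma h2_inner_add_right:
  assumes "F \<in> hardy2 p m" "G \<in> hardy2 p m" "K \<in> hardy2 p m"
  shows "h2_inner p m F (G + K) = h2_inner p m F G + h2_inner p m F K"
proof (rule h2_inner_unique)
  have *: "line_inner p m F (G + K) \<xi> = line_inner p m F G \<xi> + line_inner p m F K \<xi>" if "0 < \<xi>" for \<xi>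
    unfolding line_inner_def sum.distrib[symmetric]
    by (intro sum.cong refl)
      (use assms that in \<open>simp add: hardy2_entry_add line_inner_integrable distrib_left del: plus_fun_apply\<close>)
  have "((\<lambda>\<xi>. of_real (1 / (2 * pi)) * line_inner p m F G \<xi> + of_real (1 / (2 * pi)) * line_inner p m F K \<xi>)
      \<longlongrightarrow> h2_inner p m F G + h2_inner p m F K) (at_right 0)"
    by (intro tendsto_add h2_inner_tendsto assms)
  then show "((\<lambda>\<xi>. of_real (1 / (2 * pi)) * line_inner p m F (G + K) \<xi>) \<longlongrightarrow> h2_inner p m F G + h2_inner p m F K) (at_right 0)"
  proof (rule Lim_transform_eventually)
    show "\<forall>\<^sub>F \<xi> in at_right 0. of_real (1 / (2 * pi)) * line_inner p m F G \<xi> + of_real (1 / (2 * pi)) * line_inner p m F K \<xi> =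
        of_real (1 / (2 * pi)) * line_inner p m F (G + K) \<xi>"
      using eventually_at_right_0_pos by eventually_elim (simp only: * distrib_left)
  qed
qed (use assms in \<open>auto intro: hardy2_add\<close>)

lemma h2_inner_scale_right:
  assumes "F \<in> hardy2 p m" "G \<in> hardy2 p m"
  shows "h2_inner p m F (scale_fun a G) = a * h2_inner p m F G"
proof (rule h2_inner_unique)
  have *: "line_inner p m F (scale_fun a G) \<xi> = a * line_inner p m F G \<xi>" for \<xi>
    unfolding line_inner_def sum_distrib_left
    by (intro sum.cong refl)
      (use assms in \<open>simp add: hardy2_entry_scale mult.left_commute[of _ a]\<close>)
  have "((\<lambda>\<xi>. a * (of_real (1 / (2 * pi)) * line_inner p m F G \<xi>)) \<longlongrightarrow> a * h2_inner p m F G) (at_right 0)"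
    by (intro tendsto_mult tendsto_const h2_inner_tendsto assms)
  then show "((\<lambda>\<xi>. of_real (1 / (2 * pi)) * line_inner p m F (scale_fun a G) \<xi>) \<longlongrightarrow> a * h2_inner p m F G) (at_right 0)"
    by (simp only: * mult.left_commute[of _ a])
qed (use assms in \<open>auto intro: hardy2_scale\<close>)

lemma h2_inner_commute:
  assumes "F \<in> hardy2 p m" "G \<in> hardy2 p m"
  shows "h2_inner p m F G = cnj (h2_inner p m G F)"
proof (rule h2_inner_unique)
  have *: "line_inner p m F G \<xi> = cnj (line_inner p m G F \<xi>)" for \<xi>
    unfolding line_inner_def cnj_sum
  proof (intro sum.cong refl)
    fix i j
    show "(LINT \<omega>|lborel. cnj (F (Complex \<xi> \<omega>) $$ (i, j)) * G (Complex \<xi> \<omega>) $$ (i, j)) =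
      cnj (LINT \<omega>|lborel. cnj (G (Complex \<xi> \<omega>) $$ (i, j)) * F (Complex \<xi> \<omega>) $$ (i, j))"
      by (subst Bochner_Integration.integral_cnj[symmetric])
        (intro Bochner_Integration.integral_cong refl, simp add: mult.commute)
  qed
  have "((\<lambda>\<xi>. cnj (of_real (1 / (2 * pi)) * line_inner p m G F \<xi>)) \<longlongrightarrow> cnj (h2_inner p m G F)) (at_right 0)"
    by (intro tendsto_cnj h2_inner_tendsto assms)
  then show "((\<lambda>\<xi>. of_real (1 / (2 * pi)) * line_inner p m F G \<xi>) \<longlongrightarrow> cnj (h2_inner p m G F)) (at_right 0)"
    by (simp only: * complex_cnj_mult complex_cnj_complex_of_real)
qed (use assms in auto)

lemma h2_inner_add_left:
  assumes "F \<in> hardy2 p m" "G \<in> hardy2 p m" "K \<in> hardy2 p m"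
  shows "h2_inner p m (F + G) K = h2_inner p m F K + h2_inner p m G K"
  using h2_inner_add_right[OF assms(3,1,2)]
    h2_inner_commute[OF hardy2_add[OF assms(1,2)] assms(3)]
    h2_inner_commute[OF assms(1,3)] h2_inner_commute[OF assms(2,3)]
  by simp

lemma h2_inner_scale_left:
  assumes "F \<in> hardy2 p m" "G \<in> hardy2 p m"
  shows "h2_inner p m (scale_fun a F) G = cnj a * h2_inner p m F G"
  using h2_inner_scale_right[OF assms(2,1), of a]
    h2_inner_commute[OF hardy2_scale[OF assms(1)] assms(2)] h2_inner_commute[OF assms(1,2)]
  by simp

lemma h2_inner_diff_left:
  assumes "F \<in> hardy2 p m" "G \<in> hardy2 p m" "K \<in> hardy2 p m"
  shows "h2_inner p m (F - G) K = h2_inner p m F K - h2_inner p m G K"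
  using assms by (simp add: hardy2_diff_eq h2_inner_add_left h2_inner_scale_left hardy2_scale)

lemma h2_inner_diff_right:
  assumes "F \<in> hardy2 p m" "G \<in> hardy2 p m" "K \<in> hardy2 p m"
  shows "h2_inner p m F (G - K) = h2_inner p m F G - h2_inner p m F K"
  using assms by (simp add: hardy2_diff_eq h2_inner_add_right h2_inner_scale_right hardy2_scale)

lemma line_inner_self:
  assumes "F \<in> hardy2 p m" "0 < \<xi>"
  shows "line_inner p m F F \<xi> = of_real (\<Sum>i<p. \<Sum>j<m. (l2_norm (\<lambda>\<omega>. F (Complex \<xi> \<omega>) $$ (i, j)))\<^sup>2)"
  unfolding line_inner_def of_real_sum
  by (intro sum.cong refl of_real_l2_norm_power2 hardy2_line[OF assms(1) _ _ assms(2)]) auto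

text \<open>As a limit of nonnegative reals, the inner product of \<open>F\<close> with itself is
  real and nonnegative, so neither the real part nor the square root in \<open>h2_norm\<close> loses
  information.\<close>

lemma h2_inner_self:
  assumes F: "F \<in> hardy2 p m"
  shows "((\<lambda>\<xi>. \<Sum>i<p. \<Sum>j<m. (l2_norm (\<lambda>\<omega>. F (Complex \<xi> \<omega>) $$ (i, j)))\<^sup>2) \<longlongrightarrow> 2 * pi * (h2_norm p m F)\<^sup>2) (at_right 0)"
    and "h2_inner p m F F = of_real ((h2_norm p m F)\<^sup>2)"
proof -
  let ?N = "\<lambda>\<xi>. \<Sum>i<p. \<Sum>j<m. (l2_norm (\<lambda>\<omega>. F (Complex \<xi> \<omega>) $$ (i, j)))\<^sup>2"
  have lim: "((\<lambda>\<xi>. complex_of_real (1 / (2 * pi) * ?N \<xi>)) \<longlongrightarrow> h2_inner p m F F) (at_right 0)"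
  proof (rule Lim_transform_eventually[OF h2_inner_tendsto[OF F F]])
    show "\<forall>\<^sub>F \<xi> in at_right 0. of_real (1 / (2 * pi)) * line_inner p m F F \<xi> = of_real (1 / (2 * pi) * ?N \<xi>)"
      using eventually_at_right_0_pos by eventually_elim (simp only: line_inner_self[OF F] of_real_mult)
  qed
  have re: "((\<lambda>\<xi>. 1 / (2 * pi) * ?N \<xi>) \<longlongrightarrow> Re (h2_inner p m F F)) (at_right 0)"
    using tendsto_Re[OF lim] by simp
  have im: "Im (h2_inner p m F F) = 0"
    using tendsto_unique[OF trivial_limit_at_right_real tendsto_Im[OF lim], of 0] by simp
  have nn: "0 \<le> Re (h2_inner p m F F)"
    by (rule tendsto_lowerbound[OF re]) (auto simp: sum_nonneg)
  then have eq: "Re (h2_inner p m F F) = (h2_norm p m F)\<^sup>2" by (simp add: h2_norm_def)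
  show "h2_inner p m F F = of_real ((h2_norm p m F)\<^sup>2)"
    using im eq by (simp add: complex_eq_iff)
  have "((\<lambda>\<xi>. 2 * pi * (1 / (2 * pi) * ?N \<xi>)) \<longlongrightarrow> 2 * pi * (h2_norm p m F)\<^sup>2) (at_right 0)"
    using re unfolding eq by (intro tendsto_mult tendsto_const)
  then show "(?N \<longlongrightarrow> 2 * pi * (h2_norm p m F)\<^sup>2) (at_right 0)" by simp
qed

lemma h2_norm_nonneg [simp]:
  assumes "F \<in> hardy2 p m"
  shows "0 \<le> h2_norm p m F"
proof -
  have "Re (h2_inner p m F F) = (h2_norm p m F)\<^sup>2" using h2_inner_self(2)[OF assms] by simp
  then have "0 \<le> Re (h2_inner p m F F)" by simp
  then show ?thesis by (simp add: h2_norm_def)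
qed

text \<open>Line norms grow as the line approaches the imaginary axis, so their limit dominates each
  of them.\<close>

lemma h2_norm_line:
  assumes F: "F \<in> hardy2 p m" and \<xi>: "0 < \<xi>"
  shows "(\<Sum>i<p. \<Sum>j<m. (l2_norm (\<lambda>\<omega>. F (Complex \<xi> \<omega>) $$ (i, j)))\<^sup>2) \<le> 2 * pi * (h2_norm p m F)\<^sup>2"
proof (rule tendsto_lowerbound[OF h2_inner_self(1)[OF F]])
  obtain M where M: "\<And>i j. i < p \<Longrightarrow> j < m \<Longrightarrow> hardy_bound (\<lambda>s. F s $$ (i, j)) M"
    using hardy2_obtain_bound[OF F] by blast
  have "\<forall>\<^sub>F \<eta> in at_right 0. \<eta> \<in> {0<..<\<xi>}" using \<xi> by (rule eventually_at_right_real)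
  then show "\<forall>\<^sub>F \<eta> in at_right 0. (\<Sum>i<p. \<Sum>j<m. (l2_norm (\<lambda>\<omega>. F (Complex \<xi> \<omega>) $$ (i, j)))\<^sup>2)
      \<le> (\<Sum>i<p. \<Sum>j<m. (l2_norm (\<lambda>\<omega>. F (Complex \<eta> \<omega>) $$ (i, j)))\<^sup>2)"
    by eventually_elim (intro sum_mono l2_norm_line_antimono[OF M], auto)
qed auto

lemma h2_norm_le:
  assumes F: "F \<in> hardy2 p m" and c: "0 \<le> c"
    and le: "\<And>\<xi>. 0 < \<xi> \<Longrightarrow> (\<Sum>i<p. \<Sum>j<m. (l2_norm (\<lambda>\<omega>. F (Complex \<xi> \<omega>) $$ (i, j)))\<^sup>2) \<le> 2 * pi * c\<^sup>2"
  shows "h2_norm p m F \<le> c"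
proof -
  have "2 * pi * (h2_norm p m F)\<^sup>2 \<le> 2 * pi * c\<^sup>2"
  proof (rule tendsto_upperbound[OF h2_inner_self(1)[OF F]])
    show "\<forall>\<^sub>F \<xi> in at_right 0. (\<Sum>i<p. \<Sum>j<m. (l2_norm (\<lambda>\<omega>. F (Complex \<xi> \<omega>) $$ (i, j)))\<^sup>2) \<le> 2 * pi * c\<^sup>2"
      using eventually_at_right_0_pos by eventually_elim (rule le)
  qed simp
  then have "(h2_norm p m F)\<^sup>2 \<le> c\<^sup>2" by simp
  then show ?thesis using c by (rule power2_le_imp_le)
qed

text \<open>Makes the norm itself the bound in \<open>hardy_bound\<close>; the scalar point bound
  thereby becomes continuity of point evaluation.\<close>

lemma hardy2_entry_bound:
  assumes F: "F \<in> hardy2 p m" and ij: "i < p" "j < m"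
  shows "hardy_bound (\<lambda>s. F s $$ (i, j)) (2 * pi * (h2_norm p m F)\<^sup>2)"
  unfolding hardy_bound_def
proof (intro conjI allI impI)
  fix \<xi> :: real assume \<xi>: "0 < \<xi>"
  have "(l2_norm (\<lambda>\<omega>. F (Complex \<xi> \<omega>) $$ (i, j)))\<^sup>2 \<le> (\<Sum>j<m. (l2_norm (\<lambda>\<omega>. F (Complex \<xi> \<omega>) $$ (i, j)))\<^sup>2)"
    using ij by (intro member_le_sum) auto
  also have "\<dots> \<le> (\<Sum>i<p. \<Sum>j<m. (l2_norm (\<lambda>\<omega>. F (Complex \<xi> \<omega>) $$ (i, j)))\<^sup>2)"
    using ij by (intro member_le_sum[of i "{..<p}" "\<lambda>i. \<Sum>j<m. (l2_norm (\<lambda>\<omega>. F (Complex \<xi> \<omega>) $$ (i, j)))\<^sup>2"])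
      (auto intro: sum_nonneg)
  also have "\<dots> \<le> 2 * pi * (h2_norm p m F)\<^sup>2" by (rule h2_norm_line[OF F \<xi>])
  finally show "l2 (\<lambda>\<omega>. F (Complex \<xi> \<omega>) $$ (i, j)) \<le> ennreal (2 * pi * (h2_norm p m F)\<^sup>2)"
    using l2_eq_norm[OF hardy2_line(2)[OF F ij \<xi>]] by (simp add: ennreal_leI)
qed (use hardy2_entry_holomorphic[OF assms] in auto)

lemma hardy2_point_bound:
  assumes F: "F \<in> hardy2 p m" and ij: "i < p" "j < m" and d: "0 < d" "d < Re s"
  shows "cmod (F s $$ (i, j)) \<le> sqrt (2 * pi) * sqrt (pi / d) / pi * h2_norm p m F"
  using hardy_point_bound[OF hardy2_entry_bound[OF F ij] d] F
  by (simp add: real_sqrt_mult mult_ac)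

text \<open>Definiteness follows from point evaluation. It gives equality as functions, since
  members vanish outside the half-plane, and supports the uniqueness behind both \<open>THE\<close>
  operators.\<close>

lemma h2_norm_eq_0:
  assumes F: "F \<in> hardy2 p m" and "h2_norm p m F = 0"
  shows "F = zero_fun p m"
proof (rule hardy2_ext[OF F hardy2_zero_fun])
  fix s i j assume s: "Re s > 0" and ij: "i < p" "j < m"
  have "cmod (F s $$ (i, j)) \<le> 0"
    using hardy2_point_bound[OF F ij, of "Re s / 2" s] s assms(2) by simp
  then show "F s $$ (i, j) = zero_fun p m s $$ (i, j)" using ij by (simp add: zero_fun_def)
qed

lemma hardy2_diff_eq_0:
  assumes "F \<in> hardy2 p m" "G \<in> hardy2 p m" "F - G = zero_fun p m"
  shows "F = G"
proof (rule hardy2_ext[OF assms(1,2)])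
  fix s i j assume "i < p" "j < m"
  moreover have "(F - G) s $$ (i, j) = 0" using assms(3) \<open>i < p\<close> \<open>j < m\<close> by (simp add: zero_fun_def)
  ultimately show "F s $$ (i, j) = G s $$ (i, j)"
    using hardy2_carrier[OF assms(2), of s] by simp
qed

section \<open>Completeness\<close>

lemma hardy_bound_cong:
  assumes "hardy_bound f M" "\<And>s. 0 < Re s \<Longrightarrow> f s = g s"
  shows "hardy_bound g M"
proof -
  have "g holomorphic_on {s. 0 < Re s} \<longleftrightarrow> f holomorphic_on {s. 0 < Re s}"
    using assms(2) by (intro holomorphic_cong) auto
  moreover have "(\<lambda>\<omega>. g (Complex \<xi> \<omega>)) = (\<lambda>\<omega>. f (Complex \<xi> \<omega>))" if "0 < \<xi>" for \<xi>
    using assms(2) that by simp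
  ultimately show ?thesis using assms(1) by (simp add: hardy_bound_def)
qed

lemma hardy_bound_sum:
  assumes "finite K" "\<And>k. k \<in> K \<Longrightarrow> \<exists>M. hardy_bound (f k) M"
  shows "\<exists>M. hardy_bound (\<lambda>s. \<Sum>k\<in>K. f k s) M"
  using assms
proof (induction K rule: finite_induct)
  case empty
  have "hardy_bound (\<lambda>s. 0) 0" by (simp add: hardy_bound_def l2_def)
  then show ?case by auto
next
  case (insert k K)
  have "\<exists>M. hardy_bound (f k) M" "\<exists>M. hardy_bound (\<lambda>s. \<Sum>k\<in>K. f k s) M"
    using insert.IH insert.prems by auto
  then obtain M M' where "hardy_bound (f k) M" "hardy_bound (\<lambda>s. \<Sum>k\<in>K. f k s) M'" by blast
  then have "hardy_bound (\<lambda>s. f k s + (\<Sum>k\<in>K. f k s)) (2 * M + 2 * M')" by (rule hardy_bound_add)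
  then show ?case using insert(1,2) by auto
qed

lemma hardy2I:
  assumes "\<And>s. F s \<in> carrier_mat p m" "\<And>s. Re s \<le> 0 \<Longrightarrow> F s = 0\<^sub>m p m"
    and "\<And>i j. i < p \<Longrightarrow> j < m \<Longrightarrow> \<exists>M. hardy_bound (\<lambda>s. F s $$ (i, j)) M"
  shows "F \<in> hardy2 p m"
proof -
  obtain M where M: "\<And>i j. i < p \<Longrightarrow> j < m \<Longrightarrow> hardy_bound (\<lambda>s. F s $$ (i, j)) (M i j)"
    using assms(3) by metis
  \<comment> \<open>All constants are nonnegative, so their sum is a common bound.\<close>
  define K where "K = (\<Sum>ij\<in>{..<p} \<times> {..<m}. M (fst ij) (snd ij))"
  have "hardy_bound (\<lambda>s. F s $$ (i, j)) K" if "i < p" "j < m" for i j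
  proof (rule hardy_bound_mono[OF M[OF that]])
    show "M i j \<le> K"
      unfolding K_def using that M
      by (intro member_le_sum[of "(i, j)" _ "\<lambda>ij. M (fst ij) (snd ij)", simplified]) (auto simp: hardy_bound_def)
  qed
  then show ?thesis using assms(1,2) unfolding hardy2_iff by blast
qed

section \<open>Cauchy-Schwarz and the triangle inequality\<close>

lemma h2_norm_scale:
  assumes "F \<in> hardy2 p m"
  shows "h2_norm p m (scale_fun a F) = cmod a * h2_norm p m F"
proof -
  have "complex_of_real ((h2_norm p m (scale_fun a F))\<^sup>2) = cnj a * (a * of_real ((h2_norm p m F)\<^sup>2))"
    using assms by (simp add: h2_inner_self(2)[symmetric] hardy2_scale h2_inner_scale_left h2_inner_scale_right del: of_real_power)
  also have "\<dots> = of_real ((cmod a * h2_norm p m F)\<^sup>2)"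
    by (simp only: power_mult_distrib of_real_mult complex_norm_square mult_ac)
  finally have "(h2_norm p m (scale_fun a F))\<^sup>2 = (cmod a * h2_norm p m F)\<^sup>2"
    by (simp only: of_real_eq_iff)
  then show ?thesis
    by (rule power2_eq_imp_eq) (use assms in \<open>simp_all add: hardy2_scale\<close>)
qed

lemma h2_norm_diff_sq:
  assumes "F \<in> hardy2 p m" "G \<in> hardy2 p m"
  shows "(h2_norm p m (F - G))\<^sup>2 = (h2_norm p m F)\<^sup>2 + (h2_norm p m G)\<^sup>2 - 2 * Re (h2_inner p m F G)"
proof -
  have "complex_of_real ((h2_norm p m (F - G))\<^sup>2) =
      h2_inner p m F F - h2_inner p m F G - (h2_inner p m G F - h2_inner p m G G)"
    using assms by (simp add: h2_inner_self(2)[symmetric] hardy2_diff h2_inner_diff_left h2_inner_diff_right del: of_real_power)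
  then have "Re (complex_of_real ((h2_norm p m (F - G))\<^sup>2)) =
      Re (h2_inner p m F F - h2_inner p m F G - (h2_inner p m G F - h2_inner p m G G))" by simp
  then show ?thesis
    using h2_inner_commute[OF assms(2,1)] assms by (simp add: h2_inner_self(2))
qed

lemma h2_norm_add_sq:
  assumes "F \<in> hardy2 p m" "G \<in> hardy2 p m"
  shows "(h2_norm p m (F + G))\<^sup>2 = (h2_norm p m F)\<^sup>2 + (h2_norm p m G)\<^sup>2 + 2 * Re (h2_inner p m F G)"
proof -
  have "complex_of_real ((h2_norm p m (F + G))\<^sup>2) =
      h2_inner p m F F + h2_inner p m F G + (h2_inner p m G F + h2_inner p m G G)"
    using assms by (simp add: h2_inner_self(2)[symmetric] hardy2_add h2_inner_add_left h2_inner_add_right del: of_real_power)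
  then have "Re (complex_of_real ((h2_norm p m (F + G))\<^sup>2)) =
      Re (h2_inner p m F F + h2_inner p m F G + (h2_inner p m G F + h2_inner p m G G))" by simp
  then show ?thesis
    using h2_inner_commute[OF assms(2,1)] assms by (simp add: h2_inner_self(2))
qed

text \<open>Pythagoras for removing the component along \<open>G\<close>. Nonnegativity of the left
  side is Cauchy-Schwarz; applied at a nearest point of a subspace, the identity forces
  orthogonality.\<close>

lemma h2_norm_component_removed:
  assumes F: "F \<in> hardy2 p m" and G: "G \<in> hardy2 p m" and nz: "h2_norm p m G \<noteq> 0"
  shows "(h2_norm p m (F - scale_fun (h2_inner p m G F / of_real ((h2_norm p m G)\<^sup>2)) G))\<^sup>2 =
    (h2_norm p m F)\<^sup>2 - (cmod (h2_inner p m G F))\<^sup>2 / (h2_norm p m G)\<^sup>2"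
proof -
  define a where "a = h2_inner p m G F"
  define n where "n = (h2_norm p m G)\<^sup>2"
  have n: "n \<noteq> 0" using nz by (simp add: n_def)
  have "h2_inner p m F (scale_fun (a / of_real n) G) = a / of_real n * cnj a"
    using F G h2_inner_commute[OF F G] by (simp add: h2_inner_scale_right a_def)
  also have "\<dots> = of_real ((cmod a)\<^sup>2 / n)"
    by (simp only: of_real_divide complex_norm_square) simp
  finally have 1: "Re (h2_inner p m F (scale_fun (a / of_real n) G)) = (cmod a)\<^sup>2 / n"
    by simp
  have 2: "(h2_norm p m (scale_fun (a / of_real n) G))\<^sup>2 = (cmod a)\<^sup>2 / n"
    using G n by (simp add: h2_norm_scale norm_divide power_divide power_mult_distrib n_def[symmetric])
      (simp add: power2_eq_square)
  show ?thesis
    using h2_norm_diff_sq[OF F hardy2_scale[OF G], of "a / of_real n"] 1 2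
    unfolding a_def n_def by simp
qed

lemma h2_inner_zero_norm:
  assumes F: "F \<in> hardy2 p m" and G: "G \<in> hardy2 p m" and z: "h2_norm p m G = 0"
  shows "h2_inner p m F G = 0" "h2_inner p m G F = 0"
proof -
  have "G = scale_fun 0 G"
    by (rule hardy2_ext[OF G hardy2_scale[OF G]])
      (simp only: hardy2_entry_scale[OF G], simp add: h2_norm_eq_0[OF G z] zero_fun_def)
  then show "h2_inner p m F G = 0" "h2_inner p m G F = 0"
    using h2_inner_scale_right[OF F G, of 0] h2_inner_scale_left[OF G F, of 0] by simp_all
qed

lemma h2_Cauchy_Schwarz:
  assumes F: "F \<in> hardy2 p m" and G: "G \<in> hardy2 p m"
  shows "cmod (h2_inner p m G F) \<le> h2_norm p m G * h2_norm p m F"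
proof (cases "h2_norm p m G = 0")
  case True
  then show ?thesis using h2_inner_zero_norm(2)[OF F G] by simp
next
  case False
  have "0 \<le> (h2_norm p m F)\<^sup>2 - (cmod (h2_inner p m G F))\<^sup>2 / (h2_norm p m G)\<^sup>2"
    unfolding h2_norm_component_removed[OF F G False, symmetric] by simp
  then have "(cmod (h2_inner p m G F))\<^sup>2 \<le> (h2_norm p m G * h2_norm p m F)\<^sup>2"
    using False by (simp add: field_simps power_mult_distrib)
  then show ?thesis by (rule power2_le_imp_le) (simp add: F G)
qed

lemma h2_norm_triangle:
  assumes F: "F \<in> hardy2 p m" and G: "G \<in> hardy2 p m"
  shows "h2_norm p m (F + G) \<le> h2_norm p m F + h2_norm p m G"
proof -
  have "Re (h2_inner p m F G) \<le> h2_norm p m F * h2_norm p m G"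
    using complex_Re_le_cmod h2_Cauchy_Schwarz[OF G F] by (rule order_trans)
  then have "(h2_norm p m (F + G))\<^sup>2 \<le> (h2_norm p m F + h2_norm p m G)\<^sup>2"
    unfolding h2_norm_add_sq[OF F G] by (simp add: power2_sum)
  then show ?thesis by (rule power2_le_imp_le) (simp add: F G)
qed

lemma h2_norm_le_entries:
  assumes F: "F \<in> hardy2 p m" and c: "0 \<le> c"
    and le: "\<And>i j. i < p \<Longrightarrow> j < m \<Longrightarrow> hardy_bound (\<lambda>s. F s $$ (i, j)) (2 * pi * c\<^sup>2)"
  shows "h2_norm p m F \<le> sqrt (p * m) * c"
proof (rule h2_norm_le[OF F])
  show "0 \<le> sqrt (p * m) * c" using c by simp
  fix \<xi> :: real assume \<xi>: "0 < \<xi>"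
  have "(l2_norm (\<lambda>\<omega>. F (Complex \<xi> \<omega>) $$ (i, j)))\<^sup>2 \<le> 2 * pi * c\<^sup>2" if "i < p" "j < m" for i j
  proof -
    have "(l2_norm (\<lambda>\<omega>. F (Complex \<xi> \<omega>) $$ (i, j)))\<^sup>2 \<le> (sqrt (2 * pi * c\<^sup>2))\<^sup>2"
      by (intro power_mono hardy_boundD(3)[OF le[OF that] \<xi>]) auto
    then show ?thesis by simp
  qed
  then have "(\<Sum>i<p. \<Sum>j<m. (l2_norm (\<lambda>\<omega>. F (Complex \<xi> \<omega>) $$ (i, j)))\<^sup>2) \<le> (\<Sum>i<p. \<Sum>j<m. 2 * pi * c\<^sup>2)"
    by (intro sum_mono) auto
  also have "\<dots> = 2 * pi * (sqrt (p * m) * c)\<^sup>2"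
    by (simp add: power_mult_distrib)
  finally show "(\<Sum>i<p. \<Sum>j<m. (l2_norm (\<lambda>\<omega>. F (Complex \<xi> \<omega>) $$ (i, j)))\<^sup>2) \<le> 2 * pi * (sqrt (p * m) * c)\<^sup>2" .
qed

lemma hardy2_entry_diff:
  assumes "G \<in> hardy2 p m" "i < p" "j < m"
  shows "(F - G) s $$ (i, j) = F s $$ (i, j) - G s $$ (i, j)"
  using hardy2_carrier[OF assms(1), of s] assms(2,3) by simp

section \<open>Convergence of Cauchy sequences\<close>

text \<open>The point bound is uniform on \<open>d < Re s\<close>, so entries converge uniformly
  there and the limit is holomorphic. This says nothing about norms: membership of the limit and
  norm convergence come from Fatou's lemma on each vertical line.\<close>

lemma hardy2_complete:
  assumes F: "\<And>n. F n \<in> hardy2 p m"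
    and Cauchy: "\<And>e. 0 < e \<Longrightarrow> \<exists>N. \<forall>n\<ge>N. \<forall>k\<ge>N. h2_norm p m (F n - F k) < e"
  shows "\<exists>L\<in>hardy2 p m. (\<lambda>n. h2_norm p m (F n - L)) \<longlonglongrightarrow> 0"
proof -
  define f where "f = (\<lambda>i j s. lim (\<lambda>n. F n s $$ (i, j)))"
  have unif: "uniform_limit {s. d < Re s} (\<lambda>n s. F n s $$ (i, j)) (f i j) sequentially"
    if "0 < d" "i < p" "j < m" for d i j
  proof -
    let ?C = "sqrt (2 * pi) * sqrt (pi / d) / pi"
    have C: "?C > 0" using that by simp
    have "uniformly_Cauchy_on {s. d < Re s} (\<lambda>n s. F n s $$ (i, j))"
      unfolding uniformly_Cauchy_on_def
    proof (intro allI impI)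
      fix e :: real assume "0 < e"
      then obtain N where N: "\<And>n k. n \<ge> N \<Longrightarrow> k \<ge> N \<Longrightarrow> h2_norm p m (F n - F k) < e / ?C"
        using Cauchy[OF divide_pos_pos[OF \<open>0 < e\<close> C]] by blast
      have "dist (F n s $$ (i, j)) (F k s $$ (i, j)) < e" if s: "d < Re s" and "n \<ge> N" "k \<ge> N" for s n k
      proof -
        have "cmod ((F n - F k) s $$ (i, j)) \<le> ?C * h2_norm p m (F n - F k)"
          by (rule hardy2_point_bound[OF hardy2_diff[OF F F] \<open>i < p\<close> \<open>j < m\<close> \<open>0 < d\<close> s])
        also have "\<dots> < ?C * (e / ?C)"
          using N[OF that(2,3)] C by (rule mult_strict_left_mono)
        also have "\<dots> = e" using C \<open>0 < d\<close> by simp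
        finally show ?thesis
          by (simp only: hardy2_entry_diff[OF F \<open>i < p\<close> \<open>j < m\<close>] dist_norm)
      qed
      then show "\<exists>M. \<forall>x\<in>{s. d < Re s}. \<forall>m\<ge>M. \<forall>n\<ge>M. dist (F m x $$ (i, j)) (F n x $$ (i, j)) < e"
        by blast
    qed
    then show ?thesis
      unfolding f_def by (subst uniformly_convergent_uniform_limit_iff[symmetric]) (rule Cauchy_uniformly_convergent)
  qed
  have hol: "f i j holomorphic_on {s. 0 < Re s}" if "i < p" "j < m" for i j
  proof (rule holomorphic_uniform_sequence[OF open_right_half_plane])
    show "(\<lambda>s. F n s $$ (i, j)) holomorphic_on {s. 0 < Re s}" for n
      by (rule hardy2_entry_holomorphic[OF F that])
    fix x assume "x \<in> {s. 0 < Re s}"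
    then have x: "0 < Re x" by simp
    \<comment> \<open>The radius leaves real parts of at least \<open>2 * Re x / 3\<close>, within
      the region of uniform convergence for \<open>d = Re x / 2\<close>.\<close>
    have sub: "cball x (Re x / 3) \<subseteq> {s. Re x / 2 < Re s}"
    proof
      fix z assume "z \<in> cball x (Re x / 3)"
      then have "\<bar>Re (x - z)\<bar> \<le> Re x / 3"
        using abs_Re_le_cmod[of "x - z"] by (simp add: dist_norm del: minus_complex.simps)
      then have "\<bar>Re x - Re z\<bar> \<le> Re x / 3" by simp
      then have "Re x / 2 < Re z" using x by linarith
      then show "z \<in> {s. Re x / 2 < Re s}" by simp
    qed
    show "\<exists>d>0. cball x d \<subseteq> {s. 0 < Re s} \<and> uniform_limit (cball x d) (\<lambda>n s. F n s $$ (i, j)) (f i j) sequentially"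
    proof (intro exI conjI)
      show "0 < Re x / 3" using x by simp
      show "cball x (Re x / 3) \<subseteq> {s. 0 < Re s}" using sub x by force
      show "uniform_limit (cball x (Re x / 3)) (\<lambda>n s. F n s $$ (i, j)) (f i j) sequentially"
        by (rule uniform_limit_on_subset[OF unif[of "Re x / 2"] sub]) (use x that in auto)
    qed
  qed
  have ptwise: "(\<lambda>n. F n s $$ (i, j)) \<longlonglongrightarrow> f i j s" if "i < p" "j < m" "0 < Re s" for i j s
    by (rule tendsto_uniform_limitI[OF unif[of "Re s / 2"]]) (use that in auto)
  \<comment> \<open>Used twice: with \<open>e = 1\<close> for membership of the limit, and with
    small \<open>e\<close> for convergence in norm.\<close>
  have close: "hardy_bound (\<lambda>s. F n s $$ (i, j) - f i j s) (2 * pi * e\<^sup>2)"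
    if e: "0 \<le> e" and n: "\<forall>\<^sub>F k in sequentially. h2_norm p m (F n - F k) \<le> e" and ij: "i < p" "j < m" for e n i j
    unfolding hardy_bound_def
  proof (intro conjI allI impI)
    show "(\<lambda>s. F n s $$ (i, j) - f i j s) holomorphic_on {s. 0 < Re s}"
      by (intro holomorphic_on_diff hol hardy2_entry_holomorphic[OF F] ij)
    show "0 \<le> 2 * pi * e\<^sup>2" by simp
    fix \<xi> :: real assume \<xi>: "0 < \<xi>"
    show "l2 (\<lambda>\<omega>. F n (Complex \<xi> \<omega>) $$ (i, j) - f i j (Complex \<xi> \<omega>)) \<le> ennreal (2 * pi * e\<^sup>2)"
    proof (rule l2_Fatou[where u = "\<lambda>k \<omega>. F n (Complex \<xi> \<omega>) $$ (i, j) - F k (Complex \<xi> \<omega>) $$ (i, j)"])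
      show "(\<lambda>\<omega>. F n (Complex \<xi> \<omega>) $$ (i, j) - F k (Complex \<xi> \<omega>) $$ (i, j)) \<in> borel_measurable lborel" for k
        by (intro borel_measurable_diff hardy2_line(1)[OF F ij \<xi>])
      show "AE \<omega> in lborel. (\<lambda>k. F n (Complex \<xi> \<omega>) $$ (i, j) - F k (Complex \<xi> \<omega>) $$ (i, j))
          \<longlonglongrightarrow> F n (Complex \<xi> \<omega>) $$ (i, j) - f i j (Complex \<xi> \<omega>)"
        using \<xi> ij by (intro AE_I2 tendsto_diff tendsto_const ptwise) auto
      show "\<forall>\<^sub>F k in sequentially. l2 (\<lambda>\<omega>. F n (Complex \<xi> \<omega>) $$ (i, j) - F k (Complex \<xi> \<omega>) $$ (i, j)) \<le> ennreal (2 * pi * e\<^sup>2)"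
        using n
      proof eventually_elim
        fix k assume k: "h2_norm p m (F n - F k) \<le> e"
        have "l2 (\<lambda>\<omega>. F n (Complex \<xi> \<omega>) $$ (i, j) - F k (Complex \<xi> \<omega>) $$ (i, j)) \<le> ennreal (2 * pi * (h2_norm p m (F n - F k))\<^sup>2)"
          using hardy2_entry_bound[OF hardy2_diff[OF F F] ij, of n k] \<xi>
          unfolding hardy_bound_def hardy2_entry_diff[OF F ij] by blast
        also have "\<dots> \<le> ennreal (2 * pi * e\<^sup>2)"
          using k by (intro ennreal_leI mult_left_mono power_mono) (auto simp: hardy2_diff F)
        finally show "l2 (\<lambda>\<omega>. F n (Complex \<xi> \<omega>) $$ (i, j) - F k (Complex \<xi> \<omega>) $$ (i, j)) \<le> ennreal (2 * pi * e\<^sup>2)" .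
      qed
    qed
  qed
  define L where "L = (\<lambda>s. if 0 < Re s then mat p m (\<lambda>(i, j). f i j s) else 0\<^sub>m p m)"
  have L_entry: "L s $$ (i, j) = f i j s" if "i < p" "j < m" "0 < Re s" for i j s
    using that by (simp add: L_def)
  have L: "L \<in> hardy2 p m"
  proof (rule hardy2I)
    fix i j assume ij: "i < p" "j < m"
    obtain N where N: "\<forall>n\<ge>N. \<forall>k\<ge>N. h2_norm p m (F n - F k) < 1"
      using Cauchy[of 1] by auto
    have "\<forall>\<^sub>F k in sequentially. h2_norm p m (F N - F k) \<le> 1"
      using N by (intro eventually_sequentiallyI[of N]) (auto intro: less_imp_le)
    from close[OF _ this ij] have "hardy_bound (\<lambda>s. F N s $$ (i, j) - f i j s) (2 * pi * 1\<^sup>2)" by simp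
    \<comment> \<open>The limit entry is that of \<open>F N\<close> minus the bounded difference,
      and so inherits a Hardy bound.\<close>
    from hardy_bound_add[OF hardy2_entry_bound[OF F ij] hardy_bound_cmult[OF this, of "-1"]]
    have "\<exists>M. hardy_bound (\<lambda>s. F N s $$ (i, j) + -1 * (F N s $$ (i, j) - f i j s)) M" by blast
    then obtain M where "hardy_bound (\<lambda>s. F N s $$ (i, j) + -1 * (F N s $$ (i, j) - f i j s)) M" ..
    then have "hardy_bound (\<lambda>s. L s $$ (i, j)) M"
      by (rule hardy_bound_cong) (simp add: L_entry ij)
    then show "\<exists>M. hardy_bound (\<lambda>s. L s $$ (i, j)) M" ..
  qed (auto simp: L_def)
  have "(\<lambda>n. h2_norm p m (F n - L)) \<longlonglongrightarrow> 0"
  proof (rule LIMSEQ_I)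
    fix e :: real assume e: "0 < e"
    \<comment> \<open>The summand 1 keeps the denominator positive when \<open>p\<close> or
      \<open>m\<close> is 0 and makes the final inequality strict.\<close>
    define e' where "e' = e / (sqrt (p * m) + 1)"
    have e': "0 < e'" using e unfolding e'_def by (intro divide_pos_pos) (auto intro: add_nonneg_pos)
    obtain N where N: "\<And>n k. n \<ge> N \<Longrightarrow> k \<ge> N \<Longrightarrow> h2_norm p m (F n - F k) < e'"
      using Cauchy[OF e'] by blast
    have "norm (h2_norm p m (F n - L) - 0) < e" if n: "n \<ge> N" for n
    proof -
      have ev: "\<forall>\<^sub>F k in sequentially. h2_norm p m (F n - F k) \<le> e'"
        using N[OF n] by (intro eventually_sequentiallyI[of N]) (auto intro: less_imp_le)
      have "h2_norm p m (F n - L) \<le> sqrt (p * m) * e'"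
      proof (rule h2_norm_le_entries[OF hardy2_diff[OF F L]])
        fix i j assume ij: "i < p" "j < m"
        show "hardy_bound (\<lambda>s. (F n - L) s $$ (i, j)) (2 * pi * e'\<^sup>2)"
          by (rule hardy_bound_cong[OF close[OF _ ev ij]])
            (use e' ij in \<open>simp_all only: hardy2_entry_diff[OF L ij] L_entry less_imp_le\<close>)
      qed (use e' in auto)
      also have "\<dots> < (sqrt (p * m) + 1) * e'"
        using e' by (intro mult_strict_right_mono) auto
      also have "\<dots> = e"
        unfolding e'_def by (simp add: add_nonneg_eq_0_iff)
      finally show ?thesis by (simp add: hardy2_diff F L)
    qed
    then show "\<exists>N. \<forall>n\<ge>N. norm (h2_norm p m (F n - L) - 0) < e" by blast
  qed
  then show ?thesis using L by blast
qed

section \<open>Orthogonal projection and gradient\<close>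

lemma hardy2_dim:
  assumes "F \<in> hardy2 p m"
  shows "dim_row (F s) = p" "dim_col (F s) = m"
  using hardy2_carrier[OF assms, of s] by auto

lemma h2_closed_subspaceD:
  assumes "h2_closed_subspace p m W"
  shows "W \<subseteq> hardy2 p m" "zero_fun p m \<in> W"
    and "F \<in> W \<Longrightarrow> G \<in> W \<Longrightarrow> F + G \<in> W" "F \<in> W \<Longrightarrow> scale_fun a F \<in> W"
    and "F \<in> hardy2 p m \<Longrightarrow> (\<And>e. 0 < e \<Longrightarrow> \<exists>G\<in>W. h2_norm p m (F - G) < e) \<Longrightarrow> F \<in> W"
  using assms unfolding h2_closed_subspace_def by blast+

lemma h2_closed_subspace_diff:
  assumes W: "h2_closed_subspace p m W" and FG: "F \<in> W" "G \<in> W"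
  shows "F - G \<in> W"
proof -
  have "F - G = F + scale_fun (-1) G"
    by (rule hardy2_diff_eq) (use FG h2_closed_subspaceD(1)[OF W] in blast)+
  then show ?thesis using FG by (simp add: h2_closed_subspaceD(3,4)[OF W])
qed

lemma h2_norm_minus_commute:
  assumes "F \<in> hardy2 p m" "G \<in> hardy2 p m"
  shows "h2_norm p m (F - G) = h2_norm p m (G - F)"
proof -
  have "G - F = scale_fun (-1) (F - G)"
    by (rule hardy2_ext[OF hardy2_diff[OF assms(2,1)] hardy2_scale[OF hardy2_diff[OF assms]]])
      (simp only: hardy2_entry_scale[OF hardy2_diff[OF assms]] hardy2_entry_diff[OF assms(1)] hardy2_entry_diff[OF assms(2)], simp)
  then show ?thesis by (simp add: h2_norm_scale hardy2_diff assms)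
qed

text \<open>A minimizing sequence for the distance to \<open>X\<close> is Cauchy by the
  parallelogram law; its limit lies in \<open>W\<close> by closedness, and a nearest point has an
  orthogonal error.\<close>

lemma h2_projection_exists:
  assumes X: "X \<in> hardy2 p m" and W: "h2_closed_subspace p m W"
  shows "\<exists>P\<in>W. \<forall>V\<in>W. h2_inner p m (X - P) V = 0"
proof -
  note D = h2_closed_subspaceD[OF W]
  have WH: "G \<in> hardy2 p m" if "G \<in> W" for G using D(1) that by blast
  define N where "N = (\<lambda>G. (h2_norm p m (X - G))\<^sup>2)"
  define d where "d = (INF G\<in>W. N G)"
  have bdd: "bdd_below (N ` W)" by (rule bdd_belowI[of _ 0]) (auto simp: N_def)
  have d_le: "d \<le> N G" if "G \<in> W" for G
    unfolding d_def using that bdd by (rule cINF_lower[rotated])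
  have "\<exists>G\<in>W. N G < d + 1 / real (Suc n)" for n
  proof -
    have "(INF G\<in>W. N G) < d + 1 / real (Suc n)" by (simp add: d_def)
    then show ?thesis using cINF_less_iff[OF _ bdd] D(2) by blast
  qed
  then obtain G where G: "\<And>n. G n \<in> W" "\<And>n. N (G n) < d + 1 / real (Suc n)" by metis
  note GH = WH[OF G(1)]
  have diff: "(h2_norm p m (G n - G k))\<^sup>2 \<le> 2 / real (Suc n) + 2 / real (Suc k)" for n k
  proof -
    define u v where "u = X - G n" and "v = X - G k"
    have uv: "u \<in> hardy2 p m" "v \<in> hardy2 p m" by (simp_all add: u_def v_def hardy2_diff X GH)
    \<comment> \<open>The midpoint of \<open>G n\<close> and \<open>G k\<close> lies in
      \<open>W\<close>, so \<open>u + v\<close>, twice its error, has squared norm at least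
      \<open>4 * d\<close>; the parallelogram law then leaves little for
      \<open>G n - G k\<close>.\<close>
    define Q where "Q = scale_fun (1/2) (G n + G k)"
    have Q: "Q \<in> W" unfolding Q_def by (intro D(3,4) G)
    have "u + v = scale_fun 2 (X - Q)"
    proof (rule hardy2_ext[OF hardy2_add[OF uv] hardy2_scale[OF hardy2_diff[OF X WH[OF Q]]]])
      fix s i j assume ij: "i < p" "j < m"
      then show "(u + v) s $$ (i, j) = scale_fun 2 (X - Q) s $$ (i, j)"
        by (simp add: u_def v_def Q_def scale_fun_def hardy2_dim[OF X] hardy2_dim[OF GH] field_simps)
    qed
    then have "(h2_norm p m (u + v))\<^sup>2 = 4 * N Q"
      by (simp add: N_def h2_norm_scale hardy2_diff X WH[OF Q] power_mult_distrib)
    then have 1: "(h2_norm p m (u + v))\<^sup>2 \<ge> 4 * d" using d_le[OF Q] by simp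
    have "G n - G k = v - u"
    proof (rule hardy2_ext[OF hardy2_diff[OF GH GH] hardy2_diff[OF uv(2,1)]])
      fix s i j assume ij: "i < p" "j < m"
      then show "(G n - G k) s $$ (i, j) = (v - u) s $$ (i, j)"
        by (simp add: u_def v_def hardy2_dim[OF GH])
    qed
    then have "(h2_norm p m (G n - G k))\<^sup>2 = 2 * (h2_norm p m u)\<^sup>2 + 2 * (h2_norm p m v)\<^sup>2 - (h2_norm p m (u + v))\<^sup>2"
      using h2_norm_diff_sq[OF uv(2,1)] h2_norm_add_sq[OF uv] h2_inner_commute[OF uv] by simp
    also have "\<dots> \<le> 2 * (d + 1 / real (Suc n)) + 2 * (d + 1 / real (Suc k)) - 4 * d"
    proof -
      have "2 * a + 2 * b - c \<le> 2 * x + 2 * y - 4 * d" if "a < x" "b < y" "4 * d \<le> c" for a b c x y :: real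
        using that by linarith
      moreover have "(h2_norm p m u)\<^sup>2 < d + 1 / real (Suc n)" "(h2_norm p m v)\<^sup>2 < d + 1 / real (Suc k)"
        using G(2)[of n] G(2)[of k] unfolding N_def u_def v_def .
      ultimately show ?thesis using 1 by blast
    qed
    also have "\<dots> = 2 / real (Suc n) + 2 / real (Suc k)" by simp
    finally show ?thesis .
  qed
  have "\<exists>P\<in>hardy2 p m. (\<lambda>n. h2_norm p m (G n - P)) \<longlonglongrightarrow> 0"
  proof (rule hardy2_complete[OF GH])
    fix e :: real assume e: "0 < e"
    \<comment> \<open>Makes each of the two terms of \<open>diff\<close> smaller than half the
      square of \<open>e\<close>.\<close>
    obtain M where M: "4 / e\<^sup>2 < real M" using reals_Archimedean2 by blast
    have "h2_norm p m (G n - G k) < e" if "n \<ge> M" "k \<ge> M" for n k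
    proof -
      have sm: "2 / real (Suc l) < e\<^sup>2 / 2" if "l \<ge> M" for l
      proof -
        have "4 / e\<^sup>2 < real (Suc l)" using M that by linarith
        then show ?thesis using e by (simp add: field_simps)
      qed
      have "(h2_norm p m (G n - G k))\<^sup>2 < e\<^sup>2"
        using diff[of n k] sm[OF that(1)] sm[OF that(2)] by linarith
      then show ?thesis using e by (simp add: power_less_imp_less_base)
    qed
    then show "\<exists>N. \<forall>n\<ge>N. \<forall>k\<ge>N. h2_norm p m (G n - G k) < e" by blast
  qed
  then obtain P where P: "P \<in> hardy2 p m" "(\<lambda>n. h2_norm p m (G n - P)) \<longlonglongrightarrow> 0" by blast
  have PW: "P \<in> W"
  proof (rule D(5)[OF P(1)])
    fix e :: real assume "0 < e"
    then have "\<forall>\<^sub>F n in sequentially. h2_norm p m (G n - P) < e" by (rule order_tendstoD(2)[OF P(2)])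
    then obtain n where "h2_norm p m (G n - P) < e" using eventually_happens by force
    then have "h2_norm p m (P - G n) < e" by (simp only: h2_norm_minus_commute[OF P(1) GH])
    then show "\<exists>G\<in>W. h2_norm p m (P - G) < e" using G(1)[of n] by blast
  qed
  \<comment> \<open>Passing through \<open>G n\<close> by the triangle inequality shows that the
    infimum is attained at \<open>P\<close>.\<close>
  have "h2_norm p m (X - P) \<le> sqrt d"
  proof (rule LIMSEQ_le_const)
    have "(\<lambda>n. 1 / real (Suc n)) \<longlonglongrightarrow> 0" by (rule LIMSEQ_Suc[OF lim_1_over_n])
    then have "(\<lambda>n. sqrt (d + 1 / real (Suc n)) + h2_norm p m (G n - P)) \<longlonglongrightarrow> sqrt (d + 0) + 0"
      by (intro tendsto_add tendsto_real_sqrt tendsto_const P(2))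
    then show "(\<lambda>n. sqrt (d + 1 / real (Suc n)) + h2_norm p m (G n - P)) \<longlonglongrightarrow> sqrt d" by simp
    show "\<exists>M. \<forall>n\<ge>M. h2_norm p m (X - P) \<le> sqrt (d + 1 / real (Suc n)) + h2_norm p m (G n - P)"
    proof (intro exI allI impI)
      fix n
      have "X - P = (X - G n) + (G n - P)"
      proof (rule hardy2_ext[OF hardy2_diff[OF X P(1)] hardy2_add[OF hardy2_diff[OF X GH] hardy2_diff[OF GH P(1)]]])
        fix s i j assume ij: "i < p" "j < m"
        show "(X - P) s $$ (i, j) = ((X - G n) + (G n - P)) s $$ (i, j)"
          unfolding hardy2_entry_add[OF hardy2_diff[OF GH P(1)] ij] hardy2_entry_diff[OF GH ij] hardy2_entry_diff[OF P(1) ij]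
          by simp
      qed
      then have "h2_norm p m (X - P) \<le> h2_norm p m (X - G n) + h2_norm p m (G n - P)"
        using h2_norm_triangle[OF hardy2_diff[OF X GH] hardy2_diff[OF GH P(1)]] by simp
      moreover have "h2_norm p m (X - G n) \<le> sqrt (d + 1 / real (Suc n))"
        using G(2)[of n] by (intro real_le_rsqrt) (simp add: N_def less_imp_le)
      ultimately show "h2_norm p m (X - P) \<le> sqrt (d + 1 / real (Suc n)) + h2_norm p m (G n - P)" by simp
    qed
  qed
  moreover have "0 \<le> d" unfolding d_def using D(2) by (intro cINF_greatest) (auto simp: N_def)
  ultimately have min: "N P \<le> d"
    unfolding N_def by (metis X P(1) hardy2_diff h2_norm_nonneg power_mono real_sqrt_pow2)
  have "h2_inner p m (X - P) V = 0" if V: "V \<in> W" for V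
  proof (cases "h2_norm p m V = 0")
    case True
    then show ?thesis using h2_inner_zero_norm(1)[OF hardy2_diff[OF X P(1)] WH[OF V]] by simp
  next
    case False
    let ?Y = "X - P" and ?n = "(h2_norm p m V)\<^sup>2"
    \<comment> \<open>The component of the error along \<open>V\<close>. Moving from
      \<open>P\<close> to \<open>P + Z\<close> would bring the distance below the infimum unless the
      inner product vanishes.\<close>
    define Z where "Z = scale_fun (h2_inner p m V ?Y / of_real ?n) V"
    have Z: "Z \<in> W" unfolding Z_def by (rule D(4)[OF V])
    have Y: "?Y \<in> hardy2 p m" by (rule hardy2_diff[OF X P(1)])
    have "X - (P + Z) = ?Y - Z"
    proof (rule hardy2_ext[OF hardy2_diff[OF X WH[OF D(3)[OF PW Z]]] hardy2_diff[OF Y WH[OF Z]]])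
      fix s i j assume ij: "i < p" "j < m"
      show "(X - (P + Z)) s $$ (i, j) = (?Y - Z) s $$ (i, j)"
        unfolding hardy2_entry_diff[OF WH[OF D(3)[OF PW Z]] ij] hardy2_entry_diff[OF WH[OF Z] ij]
          hardy2_entry_diff[OF P(1) ij] hardy2_entry_add[OF WH[OF Z] ij] by simp
    qed
    then have "N (P + Z) = N P - (cmod (h2_inner p m V ?Y))\<^sup>2 / ?n"
      unfolding N_def using h2_norm_component_removed[OF Y WH[OF V] False] by (simp add: Z_def)
    then have "(cmod (h2_inner p m V ?Y))\<^sup>2 / ?n \<le> 0"
      using d_le[OF D(3)[OF PW Z]] min by simp
    then have "h2_inner p m V ?Y = 0"
      using False by (simp add: divide_le_0_iff)
    then show ?thesis using h2_inner_commute[OF Y WH[OF V]] by simp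
  qed
  then show ?thesis using PW by blast
qed

lemma h2_closed_subspace_hardy2: "h2_closed_subspace p m (hardy2 p m)"
  by (simp add: h2_closed_subspace_def hardy2_zero_fun hardy2_add hardy2_scale)

text \<open>The space \<open>hardy2\<close> itself belongs to the intersected family, which places
  the span inside it.\<close>

lemma h2_closed_subspace_span:
  assumes "S \<subseteq> hardy2 p m"
  shows "h2_closed_subspace p m (h2_closed_span p m S)"
  unfolding h2_closed_subspace_def
proof (intro conjI ballI allI impI)
  show sub: "h2_closed_span p m S \<subseteq> hardy2 p m"
    unfolding h2_closed_span_def using h2_closed_subspace_hardy2 assms by blast
  show "zero_fun p m \<in> h2_closed_span p m S"
    unfolding h2_closed_span_def by (auto intro: h2_closed_subspaceD(2))
  show "F + G \<in> h2_closed_span p m S" if "F \<in> h2_closed_span p m S" "G \<in> h2_closed_span p m S" for F G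
    using that unfolding h2_closed_span_def by (auto intro: h2_closed_subspaceD(3))
  show "scale_fun a F \<in> h2_closed_span p m S" if "F \<in> h2_closed_span p m S" for a F
    using that unfolding h2_closed_span_def by (auto intro: h2_closed_subspaceD(4))
  show "F \<in> h2_closed_span p m S"
    if F: "F \<in> hardy2 p m" and ap: "\<forall>\<epsilon>>0. \<exists>G\<in>h2_closed_span p m S. h2_norm p m (F - G) < \<epsilon>" for F
    unfolding h2_closed_span_def
  proof (rule InterI, clarify)
    fix W assume W: "h2_closed_subspace p m W" "S \<subseteq> W"
    then have "h2_closed_span p m S \<subseteq> W" by (auto simp: h2_closed_span_def)
    then show "F \<in> W" using ap by (intro h2_closed_subspaceD(5)[OF W(1) F]) blast
  qed
qed

text \<open>\<open>h2_orth\<close> tests a set only; being a closed subspace, the orthogonal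
  complement of \<open>D\<close> contains the closed span of any set it contains. Closedness is
  Cauchy-Schwarz.\<close>

lemma h2_closed_subspace_orth:
  assumes D: "D \<in> hardy2 p m"
  shows "h2_closed_subspace p m {F \<in> hardy2 p m. h2_inner p m D F = 0}"
  unfolding h2_closed_subspace_def
proof (intro conjI ballI allI impI)
  show "zero_fun p m \<in> {F \<in> hardy2 p m. h2_inner p m D F = 0}"
  proof -
    have "zero_fun p m = scale_fun 0 (zero_fun p m)" by (auto simp: scale_fun_def zero_fun_def)
    then have "h2_inner p m D (zero_fun p m) = 0"
      using h2_inner_scale_right[OF D hardy2_zero_fun, of 0] by simp
    then show ?thesis by (simp add: hardy2_zero_fun)
  qed
  fix F assume F: "F \<in> hardy2 p m"
    and ap: "\<forall>\<epsilon>>0. \<exists>G\<in>{F \<in> hardy2 p m. h2_inner p m D F = 0}. h2_norm p m (F - G) < \<epsilon>"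
  have "cmod (h2_inner p m D F) \<le> 0"
  proof (rule field_le_epsilon)
    fix e :: real assume e: "0 < e"
    \<comment> \<open>The summand 1 allows for a vanishing norm of \<open>D\<close>.\<close>
    let ?c = "h2_norm p m D + 1"
    have c: "0 < ?c" using h2_norm_nonneg[OF D] by linarith
    then obtain G where G: "G \<in> hardy2 p m" "h2_inner p m D G = 0" "h2_norm p m (F - G) < e / ?c"
      using ap e by (metis (mono_tags, lifting) divide_pos_pos mem_Collect_eq)
    have "h2_inner p m D F = h2_inner p m D (F - G)"
      using h2_inner_diff_right[OF D F G(1)] G(2) by simp
    then have "cmod (h2_inner p m D F) \<le> h2_norm p m D * h2_norm p m (F - G)"
      using h2_Cauchy_Schwarz[OF hardy2_diff[OF F G(1)] D] by simp
    also have "\<dots> \<le> ?c * (e / ?c)"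
      using G(3) D hardy2_diff[OF F G(1)] by (intro mult_mono) auto
    also have "\<dots> = e" using c by simp
    finally show "cmod (h2_inner p m D F) \<le> 0 + e" by simp
  qed
  then show "F \<in> {F \<in> hardy2 p m. h2_inner p m D F = 0}" using F by simp
qed (use D in \<open>auto simp: hardy2_add hardy2_scale h2_inner_add_right h2_inner_scale_right\<close>)

text \<open>The projector is defined by \<open>THE\<close>, so uniqueness is needed as well: the
  difference of two candidates lies in the closed span and is orthogonal to \<open>S\<close>, hence
  to the span and to itself.\<close>

lemma h2_proj:
  assumes S: "S \<subseteq> hardy2 p m" and X: "X \<in> hardy2 p m"
  shows "h2_proj p m S X \<in> hardy2 p m" "h2_orth p m (X - h2_proj p m S X) S"
proof -
  let ?W = "h2_closed_span p m S"
  have W: "h2_closed_subspace p m ?W" by (rule h2_closed_subspace_span[OF S])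
  have SW: "S \<subseteq> ?W" by (auto simp: h2_closed_span_def)
  have WH: "F \<in> hardy2 p m" if "F \<in> ?W" for F using h2_closed_subspaceD(1)[OF W] that by blast
  have "\<exists>!P. P \<in> ?W \<and> h2_orth p m (X - P) S"
  proof (rule ex_ex1I)
    show "\<exists>P. P \<in> ?W \<and> h2_orth p m (X - P) S"
      using h2_projection_exists[OF X W] SW by (auto simp: h2_orth_def)
  next
    fix P Q assume "P \<in> ?W \<and> h2_orth p m (X - P) S" "Q \<in> ?W \<and> h2_orth p m (X - Q) S"
    then have P: "P \<in> ?W" "h2_orth p m (X - P) S" and Q: "Q \<in> ?W" "h2_orth p m (X - Q) S" by auto
    note PH = WH[OF P(1)] and QH = WH[OF Q(1)]
    define E where "E = P - Q"
    have EW: "E \<in> ?W"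
      unfolding E_def by (rule h2_closed_subspace_diff[OF W P(1) Q(1)])
    have E: "E \<in> hardy2 p m" by (rule WH[OF EW])
    have "h2_inner p m E V = 0" if V: "V \<in> S" for V
    proof -
      have VH: "V \<in> hardy2 p m" using S V by blast
      have "h2_inner p m (X - P) V = 0" "h2_inner p m (X - Q) V = 0"
        using P(2) Q(2) V by (auto simp: h2_orth_def)
      then show ?thesis
        unfolding E_def h2_inner_diff_left[OF PH QH VH] h2_inner_diff_left[OF X PH VH] h2_inner_diff_left[OF X QH VH]
        by simp
    qed
    then have "S \<subseteq> {F \<in> hardy2 p m. h2_inner p m E F = 0}" using S by blast
    with h2_closed_subspace_orth[OF E] have "?W \<subseteq> {F \<in> hardy2 p m. h2_inner p m E F = 0}"
      by (auto simp: h2_closed_span_def)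
    then have "h2_inner p m E E = 0" using EW by blast
    then have "h2_norm p m E = 0" using h2_inner_self(2)[OF E] by simp
    then show "P = Q" using h2_norm_eq_0[OF E] hardy2_diff_eq_0[OF PH QH] by (simp add: E_def)
  qed
  from theI'[OF this] show "h2_proj p m S X \<in> hardy2 p m" "h2_orth p m (X - h2_proj p m S X) S"
    unfolding h2_proj_def using WH by auto
qed

section \<open>The gradient of the squared distance\<close>

text \<open>The squared distance expands with remainder exactly the squared norm of
  \<open>X\<close>, so \<open>\<delta> = \<epsilon>\<close> works for \<open>G - H\<close>. A
  competitor \<open>W\<close> is tested along its own error \<open>E\<close>, where the linear
  discrepancy is too large to be \<open>o(norm X)\<close>.\<close>

lemma wirtinger_grad_dist_sq:
  assumes H: "H \<in> hardy2 p m" and G: "G \<in> hardy2 p m"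
  shows "wirtinger_grad p m (\<lambda>F. (h2_norm p m (H - F))\<^sup>2) G = G - H"
proof -
  let ?f = "\<lambda>F. (h2_norm p m (H - F))\<^sup>2"
  have increment: "?f (G + X) - ?f G - 2 * Re (h2_inner p m W X) =
      (h2_norm p m X)\<^sup>2 - 2 * Re (h2_inner p m (W - (G - H)) X)"
    if X: "X \<in> hardy2 p m" and W: "W \<in> hardy2 p m" for X W
  proof -
    note GH = hardy2_diff[OF G H] and HG = hardy2_diff[OF H G]
    have "H - (G + X) = (H - G) - X"
    proof (rule hardy2_ext[OF hardy2_diff[OF H hardy2_add[OF G X]] hardy2_diff[OF HG X]])
      fix s i j assume ij: "i < p" "j < m"
      show "(H - (G + X)) s $$ (i, j) = ((H - G) - X) s $$ (i, j)"
        unfolding hardy2_entry_diff[OF hardy2_add[OF G X] ij] hardy2_entry_diff[OF X ij]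
          hardy2_entry_diff[OF G ij] hardy2_entry_add[OF X ij] by simp
    qed
    then have "?f (G + X) = ?f G + (h2_norm p m X)\<^sup>2 - 2 * Re (h2_inner p m (H - G) X)"
      using h2_norm_diff_sq[OF HG X] by simp
    then show ?thesis
      unfolding h2_inner_diff_left[OF W GH X] h2_inner_diff_left[OF G H X] h2_inner_diff_left[OF H G X]
      by simp
  qed
  show ?thesis
    unfolding wirtinger_grad_def
  proof (rule the_equality)
    note GH = hardy2_diff[OF G H]
    have "\<bar>?f (G + X) - ?f G - 2 * Re (h2_inner p m (G - H) X)\<bar> \<le> e * h2_norm p m X"
      if X: "X \<in> hardy2 p m" and e: "h2_norm p m X < e" for X e
    proof -
      have "h2_inner p m (G - H - (G - H)) X = 0"
        unfolding h2_inner_diff_left[OF GH GH X] by simp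
      then have "?f (G + X) - ?f G - 2 * Re (h2_inner p m (G - H) X) = h2_norm p m X * h2_norm p m X"
        unfolding increment[OF X GH] by (simp add: power2_eq_square)
      moreover have "h2_norm p m X * h2_norm p m X \<le> e * h2_norm p m X"
        using e X by (intro mult_right_mono) auto
      ultimately show ?thesis using X by simp
    qed
    then show "G - H \<in> hardy2 p m \<and> (\<forall>\<epsilon>>0. \<exists>\<delta>>0. \<forall>X\<in>hardy2 p m. h2_norm p m X < \<delta> \<longrightarrow>
        \<bar>?f (G + X) - ?f G - 2 * Re (h2_inner p m (G - H) X)\<bar> \<le> \<epsilon> * h2_norm p m X)"
      using GH by blast
  next
    fix W assume "W \<in> hardy2 p m \<and> (\<forall>\<epsilon>>0. \<exists>\<delta>>0. \<forall>X\<in>hardy2 p m. h2_norm p m X < \<delta> \<longrightarrow>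
        \<bar>?f (G + X) - ?f G - 2 * Re (h2_inner p m W X)\<bar> \<le> \<epsilon> * h2_norm p m X)"
    then have W: "W \<in> hardy2 p m" and
      app: "\<And>e. 0 < e \<Longrightarrow> \<exists>\<delta>>0. \<forall>X\<in>hardy2 p m. h2_norm p m X < \<delta> \<longrightarrow>
        \<bar>?f (G + X) - ?f G - 2 * Re (h2_inner p m W X)\<bar> \<le> e * h2_norm p m X" by blast+
    define E where "E = W - (G - H)"
    have E: "E \<in> hardy2 p m" unfolding E_def by (rule hardy2_diff[OF W hardy2_diff[OF G H]])
    have "h2_norm p m E \<le> 0"
    proof (rule ccontr)
      define n where "n = h2_norm p m E"
      assume "\<not> h2_norm p m E \<le> 0"
      then have n: "0 < n" by (simp add: n_def)
      obtain \<delta> where \<delta>: "0 < \<delta>" and ap: "\<And>X. X \<in> hardy2 p m \<Longrightarrow> h2_norm p m X < \<delta> \<Longrightarrow>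
          \<bar>?f (G + X) - ?f G - 2 * Re (h2_inner p m W X)\<bar> \<le> n / 2 * h2_norm p m X"
        using app[of "n / 2"] n by auto
      \<comment> \<open>\<open>t * n < \<delta>\<close> makes \<open>X\<close> admissible, and
        \<open>t \<le> 1 / 2\<close> bounds the quadratic term by \<open>t * n\<^sup>2 / 2\<close>.
        At accuracy \<open>n / 2\<close> the linear term \<open>2 * (t * n\<^sup>2)\<close> would
        then be at most \<open>t * n\<^sup>2\<close>.\<close>
      define t where "t = min (\<delta> / (2 * n)) (1 / 2)"
      have t: "0 < t" "t * n < \<delta>" "t \<le> 1 / 2"
      proof -
        show "0 < t" "t \<le> 1 / 2" using \<delta> n by (auto simp: t_def)
        have "t * n \<le> \<delta> / (2 * n) * n" unfolding t_def using n by (intro mult_right_mono) auto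
        then show "t * n < \<delta>" using n \<delta> by simp
      qed
      define X where "X = scale_fun (of_real t) E"
      have X: "X \<in> hardy2 p m" unfolding X_def by (rule hardy2_scale[OF E])
      have nX: "h2_norm p m X = t * n" unfolding X_def using t by (simp add: h2_norm_scale[OF E] n_def)
      have "h2_inner p m E X = of_real (t * n\<^sup>2)"
        unfolding X_def by (simp add: h2_inner_scale_right[OF E E] h2_inner_self(2)[OF E] n_def)
      then have "\<bar>(t * n)\<^sup>2 - 2 * (t * n\<^sup>2)\<bar> \<le> n / 2 * (t * n)"
        using ap[OF X] t(2) unfolding increment[OF X W] nX E_def[symmetric] by simp
      then have "2 * (t * n\<^sup>2) - (t * n)\<^sup>2 \<le> n / 2 * (t * n)" by linarith
      also have "n / 2 * (t * n) = t * n\<^sup>2 / 2" by (simp add: power2_eq_square)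
      finally have "2 * (t * n\<^sup>2) - (t * n)\<^sup>2 \<le> t * n\<^sup>2 / 2" .
      moreover have "(t * n)\<^sup>2 \<le> t * n\<^sup>2 / 2"
      proof -
        have "t * (t * n\<^sup>2) \<le> 1 / 2 * (t * n\<^sup>2)" using t n by (intro mult_right_mono) auto
        then show ?thesis by (simp add: power2_eq_square mult_ac)
      qed
      moreover have "0 < t * n\<^sup>2" using t n by simp
      ultimately show False by linarith
    qed
    then have "h2_norm p m E = 0" using h2_norm_nonneg[OF E] by linarith
    then show "W = G - H"
      using h2_norm_eq_0[OF E] hardy2_diff_eq_0[OF W hardy2_diff[OF G H]] by (simp add: E_def)
  qed
qed

section \<open>Stable systems\<close>

lemma holomorphic_on_det:
  fixes N :: "complex \<Rightarrow> complex mat"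
  assumes "\<And>s. N s \<in> carrier_mat n n"
    and "\<And>i j. i < n \<Longrightarrow> j < n \<Longrightarrow> (\<lambda>s. N s $$ (i, j)) holomorphic_on S"
  shows "(\<lambda>s. det (N s)) holomorphic_on S"
  unfolding det_def'[OF assms(1)]
proof (intro holomorphic_on_sum holomorphic_on_mult holomorphic_on_const holomorphic_on_prod assms(2))
  fix \<pi> i assume "\<pi> \<in> {p. p permutes {0..<n}}" "i \<in> {0..<n}"
  then show "i < n" "\<pi> i < n" using permutes_in_image[of \<pi> "{0..<n}" i] by auto
qed

text \<open>\<open>mat_inverse\<close> is Gauss-Jordan elimination, from which the dependence on
  \<open>s\<close> cannot be read off; Cramer's rule exhibits the entries as quotients of
  polynomials in \<open>s\<close>.\<close>

lemma resolvent_cofactor: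
  assumes A: "A \<in> carrier_mat r r" and s: "\<not> eigenvalue A s"
  defines "M \<equiv> s \<cdot>\<^sub>m 1\<^sub>m (dim_row A) - A" and "R \<equiv> the (mat_inverse (s \<cdot>\<^sub>m 1\<^sub>m (dim_row A) - A))"
  shows "M \<in> carrier_mat r r" "R \<in> carrier_mat r r" "M * R = 1\<^sub>m r" "det M \<noteq> 0"
    and "i < r \<Longrightarrow> j < r \<Longrightarrow> R $$ (i, j) = cofactor M j i / det M"
proof -
  show M: "M \<in> carrier_mat r r" using A by (simp add: M_def minus_carrier_mat)
  show det: "det M \<noteq> 0"
  proof
    assume "det M = 0"
    then obtain v where v: "v \<in> carrier_vec r" "v \<noteq> 0\<^sub>v r" "M *\<^sub>v v = 0\<^sub>v r"
      using det_0_iff_vec_prod_zero_field[OF M] by blast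
    have "M *\<^sub>v v = s \<cdot>\<^sub>v v - A *\<^sub>v v"
      using A v(1) unfolding M_def
      by (subst minus_mult_distrib_mat_vec[of _ r r]) auto
    then have z: "s \<cdot>\<^sub>v v - A *\<^sub>v v = 0\<^sub>v r" using v(3) by simp
    have "A *\<^sub>v v = s \<cdot>\<^sub>v v"
    proof (rule eq_vecI)
      fix i assume "i < dim_vec (s \<cdot>\<^sub>v v)"
      then have i: "i < r" using v(1) by simp
      have "(s \<cdot>\<^sub>v v - A *\<^sub>v v) $ i = 0" using z i by simp
      then show "(A *\<^sub>v v) $ i = (s \<cdot>\<^sub>v v) $ i" using i A v(1) by simp
    qed (use A v(1) in auto)
    then have "eigenvector A v s" using A v by (simp add: eigenvector_def)
    then show False using s by (auto simp: eigenvalue_def)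
  qed
  have "mat_inverse M \<noteq> None"
    using mat_inverse(1)[OF M, where b = "()"] det_non_zero_imp_unit[OF M det, where b = "()"] by blast
  then have "mat_inverse M = Some R" by (auto simp: R_def M_def)
  from mat_inverse(2)[OF M this] have MR: "M * R = 1\<^sub>m r" "R * M = 1\<^sub>m r" and R: "R \<in> carrier_mat r r" by auto
  show "R \<in> carrier_mat r r" "M * R = 1\<^sub>m r" by fact+
  have "R * (M * adj_mat M) = adj_mat M"
    using R M adj_mat(1)[OF M] MR(2) by (simp flip: assoc_mult_mat[of R r r M r "adj_mat M" r])
  then have adj: "det M \<cdot>\<^sub>m R = adj_mat M"
    unfolding adj_mat(2)[OF M] mult_smult_distrib[OF R one_carrier_mat] right_mult_one_mat[OF R] .
  assume ij: "i < r" "j < r"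
  have "det M * R $$ (i, j) = (det M \<cdot>\<^sub>m R) $$ (i, j)" using R ij by simp
  also have "\<dots> = cofactor M j i" unfolding adj using M ij by (simp add: adj_mat_def)
  finally have "det M * R $$ (i, j) = cofactor M j i" .
  then show "R $$ (i, j) = cofactor M j i / det M" using det by (simp add: field_simps)
qed

text \<open>A bound \<open>L / (1 + cmod s)\<close> on the closed half-plane makes all vertical
  lines uniformly square-integrable. For large \<open>s\<close> it follows from the resolvent
  equation, for bounded \<open>s\<close> from compactness; the latter uses continuity up to the
  imaginary axis, where a Hurwitz matrix has no eigenvalue.\<close>

lemma resolvent_entry_bound:
  assumes A: "A \<in> carrier_mat r r" and hz: "hurwitz A" and ij: "i < r" "j < r"
  shows "\<exists>M. hardy_bound (\<lambda>s. the (mat_inverse (s \<cdot>\<^sub>m 1\<^sub>m (dim_row A) - A)) $$ (i, j)) M"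
proof -
  define N where "N s = s \<cdot>\<^sub>m 1\<^sub>m (dim_row A) - A" for s
  define R where "R s = the (mat_inverse (N s))" for s
  have ev: "\<not> eigenvalue A s" if "0 \<le> Re s" for s using hz that by (auto simp: hurwitz_def)
  note res = resolvent_cofactor[OF A ev, folded N_def R_def]
  have N: "N s \<in> carrier_mat r r" for s using A by (simp add: N_def minus_carrier_mat)
  have N_entry: "N s $$ (k, l) = s * (if k = l then 1 else 0) - A $$ (k, l)" if "k < r" "l < r" for s k l
    using A that by (simp add: N_def)
  have N_hol: "(\<lambda>s. N s $$ (k, l)) holomorphic_on UNIV" if "k < r" "l < r" for k l
    unfolding N_entry[OF that] by (intro holomorphic_intros)
  have det_hol: "(\<lambda>s. det (N s)) holomorphic_on UNIV"
  proof (rule holomorphic_on_det[where N = N and n = r])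
    show "N s \<in> carrier_mat r r" for s by (rule N)
    show "(\<lambda>s. N s $$ (k, l)) holomorphic_on UNIV" if "k < r" "l < r" for k l by (rule N_hol[OF that])
  qed
  have cof_hol: "(\<lambda>s. cofactor (N s) j k) holomorphic_on UNIV" if "k < r" for k
  proof -
    have "(\<lambda>s. det (mat_delete (N s) j k)) holomorphic_on UNIV"
    proof (rule holomorphic_on_det[where n = "r - 1" and N = "\<lambda>s. mat_delete (N s) j k"])
      show "mat_delete (N s) j k \<in> carrier_mat (r - 1) (r - 1)" for s
        unfolding mat_delete_def carrier_matD[OF N] by (rule mat_carrier)
    next
      fix a b assume ab: "a < r - 1" "b < r - 1"
      define a' b' where "a' = (if a < j then a else Suc a)" and "b' = (if b < k then b else Suc b)"
      have ab': "a' < r" "b' < r" using ab by (auto simp: a'_def b'_def)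
      have "mat_delete (N s) j k $$ (a, b) = N s $$ (a', b')" for s
        using ab unfolding mat_delete_def carrier_matD[OF N] a'_def b'_def by simp
      then show "(\<lambda>s. mat_delete (N s) j k $$ (a, b)) holomorphic_on UNIV"
        using N_hol[OF ab'] by (simp only:)
    qed
    then show ?thesis
      unfolding cofactor_def by (rule holomorphic_on_mult[OF holomorphic_on_const])
  qed
  have R_hol: "(\<lambda>s. R s $$ (k, j)) holomorphic_on {s. 0 < Re s}"
    and R_cont: "continuous_on {s. 0 \<le> Re s} (\<lambda>s. R s $$ (k, j))" if k: "k < r" for k
  proof -
    have "(\<lambda>s. cofactor (N s) j k / det (N s)) holomorphic_on {s. 0 < Re s}"
      using res(4) by (intro holomorphic_on_divide holomorphic_on_subset[OF det_hol] holomorphic_on_subset[OF cof_hol[OF k]]) auto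
    then show "(\<lambda>s. R s $$ (k, j)) holomorphic_on {s. 0 < Re s}"
      by (rule holomorphic_transform) (simp add: res(5) k ij)
    have "continuous_on {s. 0 \<le> Re s} (\<lambda>s. cofactor (N s) j k / det (N s))"
      using res(4)
      by (intro continuous_on_divide holomorphic_on_imp_continuous_on
          holomorphic_on_subset[OF det_hol] holomorphic_on_subset[OF cof_hol[OF k]]) auto
    then show "continuous_on {s. 0 \<le> Re s} (\<lambda>s. R s $$ (k, j))"
      by (rule continuous_on_eq) (simp add: res(5) k ij)
  qed
  define a where "a = (\<Sum>k<r. \<Sum>l<r. cmod (A $$ (k, l)))"
  have a0: "0 \<le> a" by (simp add: a_def sum_nonneg)
  \<comment> \<open>Beyond \<open>\<rho>\<close> one has \<open>a \<le> cmod s / 2\<close>, so the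
    contribution of \<open>A\<close> is absorbed into the left side; the summand 1 ensures
    \<open>cmod s \<ge> 1\<close>.\<close>
  define \<rho> where "\<rho> = 2 * a + 1"
  have large: "cmod (R s $$ (i, j)) \<le> 2 / cmod s" if s: "0 \<le> Re s" "\<rho> \<le> cmod s" for s
  proof -
    define n where "n = (\<Sum>k<r. cmod (R s $$ (k, j)))"
    have n_ge: "cmod (R s $$ (k, j)) \<le> n" if "k < r" for k
      unfolding n_def using that by (intro member_le_sum) auto
    \<comment> \<open>Row \<open>k\<close> of \<open>N s * R s = 1\<close>, solved for the term with
      \<open>s\<close>. Summing moduli over \<open>k\<close> gives
      \<open>cmod s * n \<le> a * n + 1\<close> for column \<open>j\<close>.\<close>
    have eq: "s * R s $$ (k, j) = (\<Sum>l<r. A $$ (k, l) * R s $$ (l, j)) + (if k = j then 1 else 0)" if k: "k < r" for k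
    proof -
      have "(if k = j then 1 else 0) = (N s * R s) $$ (k, j)"
        using res(3)[OF s(1)] k ij by simp
      also have "\<dots> = (\<Sum>l<r. N s $$ (k, l) * R s $$ (l, j))"
        using N[of s] res(2)[OF s(1)] k ij by (simp add: scalar_prod_def lessThan_atLeast0)
      also have "\<dots> = (\<Sum>l<r. (if l = k then s * R s $$ (l, j) else 0) - A $$ (k, l) * R s $$ (l, j))"
        using k by (intro sum.cong) (auto simp: N_entry algebra_simps)
      also have "\<dots> = s * R s $$ (k, j) - (\<Sum>l<r. A $$ (k, l) * R s $$ (l, j))"
        using k by (simp add: sum_subtractf)
      finally show ?thesis by (simp add: algebra_simps)
    qed
    have "cmod s * n = (\<Sum>k<r. cmod (s * R s $$ (k, j)))"
      by (simp add: n_def sum_distrib_left norm_mult)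
    also have "\<dots> \<le> (\<Sum>k<r. (\<Sum>l<r. cmod (A $$ (k, l)) * n) + (if k = j then 1 else 0))"
    proof (rule sum_mono)
      fix k assume "k \<in> {..<r}"
      then have k: "k < r" by simp
      have "cmod (s * R s $$ (k, j)) \<le> cmod (\<Sum>l<r. A $$ (k, l) * R s $$ (l, j)) + cmod (if k = j then 1 else 0)"
        unfolding eq[OF k] by (rule norm_triangle_ineq)
      also have "cmod (\<Sum>l<r. A $$ (k, l) * R s $$ (l, j)) \<le> (\<Sum>l<r. cmod (A $$ (k, l)) * n)"
        by (rule sum_norm_le) (simp add: norm_mult mult_left_mono n_ge)
      finally show "cmod (s * R s $$ (k, j)) \<le> (\<Sum>l<r. cmod (A $$ (k, l)) * n) + (if k = j then 1 else 0)"
        by (simp split: if_splits)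
    qed
    also have "\<dots> = a * n + 1"
      using ij by (simp add: sum.distrib a_def sum_distrib_right)
    finally have "cmod s * n \<le> a * n + 1" .
    moreover have "a * n \<le> (cmod s / 2) * n"
      using s a0 by (intro mult_right_mono) (auto simp: \<rho>_def n_def sum_nonneg)
    ultimately have "cmod s * n \<le> 2" by linarith
    moreover have "0 < cmod s" using s(2) a0 unfolding \<rho>_def by linarith
    ultimately have "n \<le> 2 / cmod s" by (simp add: pos_le_divide_eq mult.commute)
    then show ?thesis using n_ge[OF ij(1)] by linarith
  qed
  have "compact ({s. 0 \<le> Re s} \<inter> cball 0 \<rho>)"
    by (rule closed_Int_compact) (auto simp: closed_halfspace_Re_ge)
  then have "compact ((\<lambda>s. R s $$ (i, j)) ` ({s. 0 \<le> Re s} \<inter> cball 0 \<rho>))"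
    by (rule compact_continuous_image[rotated]) (rule continuous_on_subset[OF R_cont[OF ij(1)]], simp)
  then obtain K where K: "0 < K" "\<And>s. 0 \<le> Re s \<Longrightarrow> cmod s \<le> \<rho> \<Longrightarrow> cmod (R s $$ (i, j)) \<le> K"
    using compact_imp_bounded[of "(\<lambda>s. R s $$ (i, j)) ` ({s. 0 \<le> Re s} \<inter> cball 0 \<rho>)"]
    unfolding bounded_pos by auto
  \<comment> \<open>Inside the disc \<open>1 + cmod s \<le> 1 + \<rho>\<close>; outside,
    \<open>1 + cmod s \<le> 2 * cmod s\<close> meets the bound \<open>2 / cmod s\<close>, which
    gives 4.\<close>
  define L where "L = max 4 (K * (1 + \<rho>))"
  have L: "0 \<le> L" "cmod (R s $$ (i, j)) \<le> L / (1 + cmod s)" if s: "0 \<le> Re s" for s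
  proof -
    show "0 \<le> L" by (simp add: L_def)
    have pos: "0 < 1 + cmod s" by (simp add: add_pos_nonneg)
    have "cmod (R s $$ (i, j)) * (1 + cmod s) \<le> L"
    proof (cases "cmod s \<le> \<rho>")
      case True
      have "cmod (R s $$ (i, j)) * (1 + cmod s) \<le> K * (1 + \<rho>)"
        using K True s by (intro mult_mono) auto
      then show ?thesis by (simp add: L_def)
    next
      case False
      then have s1: "1 \<le> cmod s" "\<rho> \<le> cmod s" using a0 by (auto simp: \<rho>_def)
      have "cmod (R s $$ (i, j)) * (1 + cmod s) \<le> 2 / cmod s * (2 * cmod s)"
        using large[OF s s1(2)] s1 by (intro mult_mono) auto
      also have "\<dots> = 4" using s1 by (auto simp: field_simps)
      finally show ?thesis by (simp add: L_def)
    qed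
    then show "cmod (R s $$ (i, j)) \<le> L / (1 + cmod s)"
      using pos by (simp add: pos_le_divide_eq)
  qed
  have "hardy_bound (\<lambda>s. R s $$ (i, j)) (L\<^sup>2 * pi)"
    unfolding hardy_bound_def
  proof (intro conjI allI impI)
    show "(\<lambda>s. R s $$ (i, j)) holomorphic_on {s. 0 < Re s}" by (rule R_hol[OF ij(1)])
    show "0 \<le> L\<^sup>2 * pi" by simp
    fix \<xi> :: real assume \<xi>: "0 < \<xi>"
    have "l2 (\<lambda>\<omega>. R (Complex \<xi> \<omega>) $$ (i, j)) \<le> (\<integral>\<^sup>+\<omega>. ennreal (L\<^sup>2) * ennreal (1 / (1\<^sup>2 + (\<omega> - 0)\<^sup>2)) \<partial>lborel)"
      unfolding l2_def
    proof (rule nn_integral_mono)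
      fix \<omega>
      let ?s = "Complex \<xi> \<omega>"
      have "\<omega>\<^sup>2 \<le> (cmod ?s)\<^sup>2" by (simp add: cmod_power2)
      also have "1 + (cmod ?s)\<^sup>2 \<le> (1 + cmod ?s)\<^sup>2" by (simp add: power2_sum)
      finally have le: "1 + \<omega>\<^sup>2 \<le> (1 + cmod ?s)\<^sup>2" by simp
      have pos: "0 < 1 + \<omega>\<^sup>2" by (simp add: add_pos_nonneg)
      have "(cmod (R ?s $$ (i, j)))\<^sup>2 \<le> (L / (1 + cmod ?s))\<^sup>2"
        using L[of ?s] \<xi> by (intro power_mono) auto
      also have "\<dots> = L\<^sup>2 / (1 + cmod ?s)\<^sup>2" by (simp add: power_divide)
      also have "\<dots> \<le> L\<^sup>2 / (1 + \<omega>\<^sup>2)"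
        using le pos by (intro divide_left_mono mult_pos_pos) auto
      finally have "(cmod (R ?s $$ (i, j)))\<^sup>2 \<le> L\<^sup>2 * (1 / (1\<^sup>2 + (\<omega> - 0)\<^sup>2))" by simp
      then have "ennreal ((cmod (R ?s $$ (i, j)))\<^sup>2) \<le> ennreal (L\<^sup>2 * (1 / (1\<^sup>2 + (\<omega> - 0)\<^sup>2)))"
        by (rule ennreal_leI)
      also have "\<dots> = ennreal (L\<^sup>2) * ennreal (1 / (1\<^sup>2 + (\<omega> - 0)\<^sup>2))"
        by (rule ennreal_mult) auto
      finally show "ennreal ((cmod (R ?s $$ (i, j)))\<^sup>2) \<le> ennreal (L\<^sup>2) * ennreal (1 / (1\<^sup>2 + (\<omega> - 0)\<^sup>2))" .
    qed
    also have "\<dots> = ennreal (L\<^sup>2) * (\<integral>\<^sup>+\<omega>. ennreal (1 / (1\<^sup>2 + (\<omega> - 0)\<^sup>2)) \<partial>lborel)"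
      by (rule nn_integral_cmult) auto
    also have "\<dots> \<le> ennreal (L\<^sup>2) * ennreal (pi / 1)"
      by (intro mult_left_mono nn_integral_inverse_square_le) auto
    also have "\<dots> = ennreal (L\<^sup>2 * pi)" by (simp add: ennreal_mult)
    finally show "l2 (\<lambda>\<omega>. R (Complex \<xi> \<omega>) $$ (i, j)) \<le> ennreal (L\<^sup>2 * pi)" .
  qed
  then show ?thesis unfolding R_def N_def by blast
qed

text \<open>Entries of a transfer function are fixed linear combinations of resolvent entries. This
  membership makes the inner product laws available for all systems in the theorem.\<close>

lemma sys_manifold_hardy2:
  assumes "F \<in> sys_manifold p m r"
  shows "F \<in> hardy2 p m"
proof -
  obtain A B C where hz: "hurwitz A" and real: "realizes p m r A B C F"
    and zero: "\<And>s. Re s \<le> 0 \<Longrightarrow> F s = 0\<^sub>m p m"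
    using assms by (auto simp: sys_manifold_def)
  define R where "R = (\<lambda>s. the (mat_inverse (s \<cdot>\<^sub>m 1\<^sub>m (dim_row A) - A)))"
  have ABC: "A \<in> carrier_mat r r" "B \<in> carrier_mat r m" "C \<in> carrier_mat p r"
    using real by (auto simp: realizes_def)
  have ev: "\<not> eigenvalue A s" if "0 \<le> Re s" for s using hz that by (auto simp: hurwitz_def)
  have F: "F s = C * R s * B" "R s \<in> carrier_mat r r" if "0 < Re s" for s
    using real ev[of s] that resolvent_cofactor(2)[OF ABC(1) ev[of s]]
    by (auto simp: realizes_def transfer_def R_def)
  show ?thesis
  proof (rule hardy2I)
    show "F s \<in> carrier_mat p m" for s
      using F[of s] zero[of s] ABC by (cases "0 < Re s") auto
    fix i j assume ij: "i < p" "j < m"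
    have entry: "F s $$ (i, j) = (\<Sum>k<r. \<Sum>l<r. (C $$ (i, k) * B $$ (l, j)) * R s $$ (k, l))" if "0 < Re s" for s
    proof -
      have "F s $$ (i, j) = (\<Sum>k<r. C $$ (i, k) * (\<Sum>l<r. R s $$ (k, l) * B $$ (l, j)))"
        using F[OF that] ABC ij by (simp add: scalar_prod_def lessThan_atLeast0)
      then show ?thesis by (simp add: sum_distrib_left mult_ac)
    qed
    have "\<exists>M. hardy_bound (\<lambda>s. (C $$ (i, k) * B $$ (l, j)) * R s $$ (k, l)) M" if "k < r" "l < r" for k l
      using resolvent_entry_bound[OF ABC(1) hz that] hardy_bound_cmult unfolding R_def by blast
    then have "\<exists>M. hardy_bound (\<lambda>s. \<Sum>k<r. \<Sum>l<r. (C $$ (i, k) * B $$ (l, j)) * R s $$ (k, l)) M"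
      by (intro hardy_bound_sum) auto
    then obtain M where "hardy_bound (\<lambda>s. \<Sum>k<r. \<Sum>l<r. (C $$ (i, k) * B $$ (l, j)) * R s $$ (k, l)) M" ..
    then have "hardy_bound (\<lambda>s. F s $$ (i, j)) M"
      by (rule hardy_bound_cong) (simp only: entry)
    then show "\<exists>M. hardy_bound (\<lambda>s. F s $$ (i, j)) M" ..
  qed (rule zero)
qed

text \<open>A tangent vector is \<open>\<gamma>' 0\<close>, which the case \<open>t = 0\<close> of
  the definition places in the Hardy space.\<close>

lemma tangent_space_hardy2: "tangent_space p m r F \<subseteq> hardy2 p m"
  by (force simp: tangent_space_def)

section \<open>The IRKA step as a retraction step\<close>

theorem theorem7p2:
  fixes p m r :: nat
    and H Hk Hk1 :: "complex \<Rightarrow> complex mat"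
    and f :: "(complex \<Rightarrow> complex mat) \<Rightarrow> real"
    and D :: "(complex \<Rightarrow> complex mat) \<Rightarrow> (complex \<Rightarrow> complex mat) set"
    and R :: "(complex \<Rightarrow> complex mat) \<Rightarrow> (complex \<Rightarrow> complex mat) \<Rightarrow> (complex \<Rightarrow> complex mat)"
  assumes "H \<in> hardy2 p m"
    and "Hk \<in> sys_manifold p m r" and "Hk1 \<in> sys_manifold p m r"
    and "irka_step p m r H Hk Hk1"
    and "f = (\<lambda>G. (h2_norm p m (H - G))\<^sup>2)"
    and "orthographic_retraction p m r D R"
    and "h2_orth p m (H - Hk1) (tangent_space p m r Hk)"
    and "\<And>G. G \<in> sys_manifold p m r \<Longrightarrow> h2_orth p m (H - G) (tangent_space p m r Hk) \<Longrightarrow> G = Hk1"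
    and "- riem_grad p m r f Hk \<in> D Hk"
  shows "Hk1 = R Hk (- riem_grad p m r f Hk)"
proof -
  let ?T = "tangent_space p m r Hk"
  define P where "P = riem_grad p m r f Hk"
  define G where "G = R Hk (- P)"
  note H = assms(1) and Hk = sys_manifold_hardy2[OF assms(2)]
  have "P = h2_proj p m ?T (Hk - H)"
    unfolding P_def riem_grad_def assms(5) by (simp only: wirtinger_grad_dist_sq[OF H Hk])
  with h2_proj[OF tangent_space_hardy2 hardy2_diff[OF Hk H]]
  have P: "P \<in> hardy2 p m" and P_orth: "h2_orth p m (Hk - H - P) ?T" by simp_all
  \<comment> \<open>That the retraction exists at the negative gradient means
    \<open>- P \<in> D Hk\<close>; the two defining properties of an orthographic retraction
    follow.\<close>
  have G_M: "G \<in> sys_manifold p m r" and G_orth: "h2_orth p m (Hk + - P - G) ?T"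
    using assms(2,6,9) unfolding orthographic_retraction_def G_def P_def by blast+
  note G = sys_manifold_hardy2[OF G_M]
  \<comment> \<open>Linearity is available for \<open>scale_fun\<close>, so the negative of
    \<open>P\<close> is treated as a scalar multiple.\<close>
  have mP: "- P \<in> hardy2 p m"
    unfolding hardy2_uminus_eq[OF P] by (rule hardy2_scale[OF P])
  have "h2_inner p m (H - G) V = 0" if "V \<in> ?T" for V
  proof -
    have V: "V \<in> hardy2 p m" using that tangent_space_hardy2 by blast
    have mPV: "h2_inner p m (- P) V = - h2_inner p m P V"
      unfolding hardy2_uminus_eq[OF P] h2_inner_scale_left[OF P V] by simp
    have "h2_inner p m (Hk - H - P) V = 0" "h2_inner p m (Hk + - P - G) V = 0"
      using P_orth G_orth that by (auto simp: h2_orth_def)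
    then show ?thesis
      unfolding h2_inner_diff_left[OF hardy2_diff[OF Hk H] P V] h2_inner_diff_left[OF Hk H V]
        h2_inner_diff_left[OF hardy2_add[OF Hk mP] G V] h2_inner_add_left[OF Hk mP V] mPV
        h2_inner_diff_left[OF H G V]
      by (simp add: algebra_simps)
  qed
  then have "G = Hk1" by (intro assms(8) G_M) (simp add: h2_orth_def)
  then show ?thesis by (simp add: G_def P_def)
qed

end
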